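(* Let $\sigma$ be the substitution of $\mathrm{Free}_1(\mathcal{MV})$ with $\sigma(x_0)=s$. Then the following are equivalent: (i) $\sigma$ is generic; (ii) $\sigma$ is ergodic; (iii) $\sigma$ is noninvertible and $G_s$ is strongly connected. Furthermore the following are equivalent: (iv) $\sigma$ is mixing; (v) $\sigma$ is exact; (vi) $\sigma$ is noninvertible and $G_s$ is primitive. If any of (i)–(vi) holds, then there is a unique Borel probability measure $\mu$ on $[0,1]$ with $\lambda\ll\mu$ such that $s:[0,1]\to[0,1]$ preserves $\mu$ and is ergodic with respect to it; moreover $\mu\ll\lambda$, and the density $d\mu/d\lambda\in L_1([0,1],\lambda)$ has rational values and is constant on each interval $I_1,\dots,I_r$.
   Context: $\mathrm{Free}_1(\mathcal{MV})$ is the algebra of McNaughton functions $t:[0,1]\to[0,1]$ (continuous, piecewise affine with finitely many pieces each of the form $ax+b$, $a,b\in\mathbb Z$) under pointwise Łukasiewicz operations $a\star b=\max(0,a+b-1)$, $a\to b=\min(1,1-a+b)$, $0,1$; $x_0$ is the identity function. A substitution is an endomorphism $\sigma$; it is determined by $s=\sigma(x_0)$ via $\sigma(t)=t\circ s$; it is invertible if it is an automorphism. $X$ is the set of proper prime filters (filter = preimage of $1$ under a homomorphism) with topology having subbasis $O_a=\{\mathfrak p:a\notin\mathfrak p\}$; $\pi:[0,1]\to X$, $\pi(p)=\{t:t(p)=1\}$; $\lambda$ on $X$ is the pushforward of Lebesgue measure $\lambda$ via $\pi$; $S(\mathfrak p)=\sigma^{-1}[\mathfrak p]$. A probability measure $\mu$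 on $X$ is algebraically equivalent to $\lambda$ if $\mu(A)=\lambda(R^{-1}[A])$ where $R$ is the dual $\mathfrak p\mapsto\rho^{-1}[\mathfrak p]$ of some automorphism $\rho$. $\sigma$ is generic if for every $\mu$ algebraically equivalent to $\lambda$, $\mu$-almost every point has dense orbit $\{S^k(x):k\ge0\}$. $\sigma$ is ergodic (resp. mixing, exact) if there is a Borel probability $\mu$ on $X$ such that all measures algebraically equivalent to $\lambda$ are absolutely continuous w.r.t. $\mu$, $S$ preserves $\mu$, and $(X,\mu,S)$ is ergodic (invariant sets have measure 0 or 1), resp. mixing ($\mu(A\cap S^{-k}B)\to\mu(A)\mu(B)$), resp. exact (tail $\sigma$-algebra $\bigcap_k S^{-k}\mathcal B$ trivial). Markov graph: let $Q_0$ be the finite set of points of nondifferentiability of $s$ together with $0,1$, $Q_{i+1}=Q_i\cup s[Q_i]$; this chain stabilizes to a finite set $0=q_0<\dots<q_r=1$. Let $I_i=[q_{i-1},q_i]$. $G_s$ is the directed graph on vertices $I_1,\dots,I_r$ with an edge $I_i\to I_j$ iff $s[I_i]\supseteq I_j$. A digraph is strongly connected if any two vertices are joined by a directed path; its period is the gcd of the lengths of closed paths through a vertex; it is primitive if strongly connected with period $1$. *)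

theory Defs
  imports "HOL-Probability.Probability"
begin

record 'a mv_alg =
  univ :: "'a set"
  mconj :: "'a \<Rightarrow> 'a \<Rightarrow> 'a"
  mimp :: "'a \<Rightarrow> 'a \<Rightarrow> 'a"
  mzero :: "'a"
  mone :: "'a"

text \<open>The equations are those of Wajsberg algebras, i.e. of MV-algebras with implication as a
  primitive; the last one says that the conjunction is the one definable from implication and 0.\<close>

definition mv_algebra :: "'a mv_alg \<Rightarrow> bool" where
  "mv_algebra A \<longleftrightarrow>
     mzero A \<in> univ A \<and> mone A \<in> univ A \<and>
     (\<forall>x\<in>univ A. \<forall>y\<in>univ A. mconj A x y \<in> univ A \<and> mimp A x y \<in> univ A) \<and>
     (\<forall>x\<in>univ A. mimp A (mone A) x = x) \<and>
     (\<forall>x\<in>univ A. \<forall>y\<in>univ A. \<forall>z\<in>univ A.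
        mimp A (mimp A x y) (mimp A (mimp A y z) (mimp A x z)) = mone A) \<and>
     (\<forall>x\<in>univ A. \<forall>y\<in>univ A. mimp A (mimp A x y) y = mimp A (mimp A y x) x) \<and>
     (\<forall>x\<in>univ A. \<forall>y\<in>univ A.
        mimp A (mimp A (mimp A x (mzero A)) (mimp A y (mzero A))) (mimp A y x) = mone A) \<and>
     (\<forall>x\<in>univ A. \<forall>y\<in>univ A. mconj A x y = mimp A (mimp A x (mimp A y (mzero A))) (mzero A))"

definition mv_hom :: "'a mv_alg \<Rightarrow> 'b mv_alg \<Rightarrow> ('a \<Rightarrow> 'b) set" where
  "mv_hom A B = {h. h \<in> univ A \<rightarrow> univ B \<and>
     (\<forall>a\<in>univ A. \<forall>b\<in>univ A. h (mconj A a b) = mconj B (h a) (h b)) \<and>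
     (\<forall>a\<in>univ A. \<forall>b\<in>univ A. h (mimp A a b) = mimp B (h a) (h b)) \<and>
     h (mzero A) = mzero B \<and> h (mone A) = mone B}"

definition mv_aut :: "'a mv_alg \<Rightarrow> ('a \<Rightarrow> 'a) set" where
  "mv_aut A = {h \<in> mv_hom A A. bij_betw h (univ A) (univ A)}"

text \<open>Fixing the type of the target algebra to \<open>'a set\<close> loses no generality: every homomorphism
  factors through the quotient by its kernel, whose elements are subsets of the domain.\<close>

definition mv_filter :: "'a mv_alg \<Rightarrow> 'a set \<Rightarrow> bool" where
  "mv_filter A F \<longleftrightarrow> (\<exists>(B :: 'a set mv_alg) h. mv_algebra B \<and> h \<in> mv_hom A B \<and>
     F = {a \<in> univ A. h a = mone B})"

definition mv_join :: "'a mv_alg \<Rightarrow> 'a \<Rightarrow> 'a \<Rightarrow> 'a" where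
  "mv_join A a b = mimp A (mimp A a b) b"

definition mv_spec :: "'a mv_alg \<Rightarrow> 'a set set" where
  "mv_spec A = {F. mv_filter A F \<and> F \<noteq> univ A \<and>
     (\<forall>a\<in>univ A. \<forall>b\<in>univ A. mv_join A a b \<in> F \<longrightarrow> a \<in> F \<or> b \<in> F)}"

definition mv_spec_top :: "'a mv_alg \<Rightarrow> 'a set topology" where
  "mv_spec_top A = topology_generated_by ((\<lambda>a. {p \<in> mv_spec A. a \<notin> p}) ` univ A)"

definition mv_dual :: "'a mv_alg \<Rightarrow> ('a \<Rightarrow> 'a) \<Rightarrow> 'a set \<Rightarrow> 'a set" where
  "mv_dual A h p = {a \<in> univ A. h a \<in> p}"

text \<open>Functions on the unit interval are represented as elements of \<open>{0..1} \<rightarrow>\<^sub>E {0..1}\<close>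
  (value \<^term>\<open>undefined\<close> outside), so that HOL equality is equality on the unit interval.\<close>

definition mcnaughton :: "(real \<Rightarrow> real) set" where
  "mcnaughton = {t \<in> {0..1} \<rightarrow>\<^sub>E {0..1}. continuous_on {0..1} t \<and>
     (\<exists>(n::nat) (c::nat \<Rightarrow> real). c 0 = 0 \<and> c n = 1 \<and> (\<forall>i<n. c i < c (Suc i)) \<and>
        (\<forall>i<n. \<exists>a b :: int. \<forall>x\<in>{c i..c (Suc i)}. t x = of_int a * x + of_int b))}"

definition Free1 :: "(real \<Rightarrow> real) mv_alg" where
  "Free1 = \<lparr> univ = mcnaughton,
     mconj = (\<lambda>a b. \<lambda>x\<in>{0..1}. max 0 (a x + b x - 1)),
     mimp = (\<lambda>a b. \<lambda>x\<in>{0..1}. min 1 (1 - a x + b x)),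
     mzero = (\<lambda>x\<in>{0..1}. 0),
     mone = (\<lambda>x\<in>{0..1}. 1) \<rparr>"

definition x0 :: "real \<Rightarrow> real" where
  "x0 = (\<lambda>x\<in>{0..1}. x)"

definition preserves_measure :: "'a measure \<Rightarrow> ('a \<Rightarrow> 'a) \<Rightarrow> bool" where
  "preserves_measure M T \<longleftrightarrow> T \<in> measurable M M \<and>
     (\<forall>A\<in>sets M. emeasure M (T -` A \<inter> space M) = emeasure M A)"

definition ergodic_map :: "'a measure \<Rightarrow> ('a \<Rightarrow> 'a) \<Rightarrow> bool" where
  "ergodic_map M T \<longleftrightarrow>
     (\<forall>A\<in>sets M. T -` A \<inter> space M = A \<longrightarrow> measure M A = 0 \<or> measure M A = 1)"

definition mixing_map :: "'a measure \<Rightarrow> ('a \<Rightarrow> 'a) \<Rightarrow> bool" where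
  "mixing_map M T \<longleftrightarrow> (\<forall>A\<in>sets M. \<forall>B\<in>sets M.
     (\<lambda>k. measure M (A \<inter> ((T ^^ k) -` B \<inter> space M))) \<longlonglongrightarrow> measure M A * measure M B)"

definition exact_map :: "'a measure \<Rightarrow> ('a \<Rightarrow> 'a) \<Rightarrow> bool" where
  "exact_map M T \<longleftrightarrow>
     (\<forall>A \<in> (\<Inter>k. (\<lambda>B. (T ^^ k) -` B \<inter> space M) ` sets M). measure M A = 0 \<or> measure M A = 1)"

definition borel_spec :: "(real \<Rightarrow> real) set measure" where
  "borel_spec = sigma (mv_spec Free1) {U. openin (mv_spec_top Free1) U}"

definition point_filter :: "real \<Rightarrow> (real \<Rightarrow> real) set" where
  "point_filter p = {t \<in> mcnaughton. t p = 1}"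

definition leb01 :: "real measure" where
  "leb01 = restrict_space lborel {0..1}"

definition leb_spec :: "(real \<Rightarrow> real) set measure" where
  "leb_spec = distr leb01 borel_spec point_filter"

definition alg_equiv_leb :: "(real \<Rightarrow> real) set measure \<Rightarrow> bool" where
  "alg_equiv_leb \<mu> \<longleftrightarrow> prob_space \<mu> \<and> sets \<mu> = sets borel_spec \<and>
     (\<exists>\<rho>\<in>mv_aut Free1. \<forall>A\<in>sets borel_spec.
        emeasure \<mu> A = emeasure leb_spec (mv_dual Free1 \<rho> -` A \<inter> mv_spec Free1))"

definition generic_subst :: "((real \<Rightarrow> real) \<Rightarrow> (real \<Rightarrow> real)) \<Rightarrow> bool" where
  "generic_subst \<sigma> \<longleftrightarrow> (\<forall>\<mu>. alg_equiv_leb \<mu> \<longrightarrow>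
     (AE p in \<mu>. mv_spec_top Free1 closure_of (range (\<lambda>k. (mv_dual Free1 \<sigma> ^^ k) p)) = mv_spec Free1))"

text \<open>In the library, \<open>absolutely_continuous M N\<close> reads \<open>N \<lless> M\<close>.\<close>

definition invariant_dominating ::
    "((real \<Rightarrow> real) \<Rightarrow> (real \<Rightarrow> real)) \<Rightarrow> (real \<Rightarrow> real) set measure \<Rightarrow> bool" where
  "invariant_dominating \<sigma> \<mu> \<longleftrightarrow> prob_space \<mu> \<and> sets \<mu> = sets borel_spec \<and>
     (\<forall>\<nu>. alg_equiv_leb \<nu> \<longrightarrow> absolutely_continuous \<mu> \<nu>) \<and>
     preserves_measure \<mu> (mv_dual Free1 \<sigma>)"

definition ergodic_subst :: "((real \<Rightarrow> real) \<Rightarrow> (real \<Rightarrow> real)) \<Rightarrow> bool" where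
  "ergodic_subst \<sigma> \<longleftrightarrow> (\<exists>\<mu>. invariant_dominating \<sigma> \<mu> \<and> ergodic_map \<mu> (mv_dual Free1 \<sigma>))"

definition mixing_subst :: "((real \<Rightarrow> real) \<Rightarrow> (real \<Rightarrow> real)) \<Rightarrow> bool" where
  "mixing_subst \<sigma> \<longleftrightarrow> (\<exists>\<mu>. invariant_dominating \<sigma> \<mu> \<and> mixing_map \<mu> (mv_dual Free1 \<sigma>))"

definition exact_subst :: "((real \<Rightarrow> real) \<Rightarrow> (real \<Rightarrow> real)) \<Rightarrow> bool" where
  "exact_subst \<sigma> \<longleftrightarrow> (\<exists>\<mu>. invariant_dominating \<sigma> \<mu> \<and> exact_map \<mu> (mv_dual Free1 \<sigma>))"

fun break_chain :: "(real \<Rightarrow> real) \<Rightarrow> nat \<Rightarrow> real set" where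
  "break_chain s 0 = {x \<in> {0..1}. \<not> s differentiable (at x within {0..1})} \<union> {0, 1}"
| "break_chain s (Suc i) = break_chain s i \<union> s ` break_chain s i"

text \<open>For a McNaughton function the increasing chain is eventually constant, so its union is the
  finite set at which it stabilizes.\<close>

definition markov_points :: "(real \<Rightarrow> real) \<Rightarrow> real set" where
  "markov_points s = (\<Union>i. break_chain s i)"

definition markov_size :: "(real \<Rightarrow> real) \<Rightarrow> nat" where
  "markov_size s = card (markov_points s) - 1"

definition markov_point :: "(real \<Rightarrow> real) \<Rightarrow> nat \<Rightarrow> real" where
  "markov_point s i = sorted_list_of_set (markov_points s) ! i"

definition markov_interval :: "(real \<Rightarrow> real) \<Rightarrow> nat \<Rightarrow> real set" where
  "markov_interval s i = {markov_point s (i - 1)..markov_point s i}"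

definition markov_vertices :: "(real \<Rightarrow> real) \<Rightarrow> nat set" where
  "markov_vertices s = {1..markov_size s}"

definition markov_edges :: "(real \<Rightarrow> real) \<Rightarrow> (nat \<times> nat) set" where
  "markov_edges s = {(i, j). i \<in> markov_vertices s \<and> j \<in> markov_vertices s \<and>
     markov_interval s j \<subseteq> s ` markov_interval s i}"

text \<open>Directed paths have length at least 1. This matters only for one-vertex graphs: a single
  vertex without a loop (the graph of the constant functions 0 and 1) is not strongly connected.\<close>

definition strongly_connected_graph :: "'v set \<Rightarrow> ('v \<times> 'v) set \<Rightarrow> bool" where
  "strongly_connected_graph V E \<longleftrightarrow> (\<forall>u\<in>V. \<forall>v\<in>V. (u, v) \<in> E\<^sup>+)"

definition graph_period :: "('v \<times> 'v) set \<Rightarrow> 'v \<Rightarrow> nat" where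
  "graph_period E v = Gcd {n. 0 < n \<and> (v, v) \<in> E ^^ n}"

definition primitive_graph :: "'v set \<Rightarrow> ('v \<times> 'v) set \<Rightarrow> bool" where
  "primitive_graph V E \<longleftrightarrow> strongly_connected_graph V E \<and> (\<forall>v\<in>V. graph_period E v = 1)"

definition ergodic_dominating01 :: "(real \<Rightarrow> real) \<Rightarrow> real measure \<Rightarrow> bool" where
  "ergodic_dominating01 s \<mu> \<longleftrightarrow> prob_space \<mu> \<and> sets \<mu> = sets (restrict_space borel {0..1}) \<and>
     absolutely_continuous \<mu> leb01 \<and> preserves_measure \<mu> s \<and> ergodic_map \<mu> s"

end

theory Submission
  imports Defs
begin

text \<open>
  Sending a prime filter to the unique maximal filter above it is a map from the spectrum to
  the unit interval that has the point filters as a section. Both maps intertwine the dual of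
  \<open>\<sigma>\<close> with \<open>s\<close>, so all ergodic properties can be read off from \<open>s\<close>. An automorphism is
  given by an injective McNaughton function; its slopes are nonzero integers, so it is the identity or
  the reflection and preserves Lebesgue measure.

  For strongly connected \<open>G\<^sub>s\<close>, a rational stationary vector of the stochastic matrix attached to the
  graph gives an invariant density that is constant on the Markov intervals. For a Borel set \<open>B\<close>,
  the deviation of \<open>v \<mapsto> \<lambda>([0,v] \<inter> s\<^sup>-\<^sup>n B)\<close> from a linear function is controlled at the
  Markov points by the finite chain, and between them it is divided by the slope at each step. If \<open>s\<close> is not
  invertible, every orbit segment of bounded length meets a slope of modulus at least 2, so the
  deviation contracts. This gives ergodicity, and in the primitive case mixing that is uniform in \<open>B\<close>,
  hence also exactness.
\<close>

section \<open>Stochastic matrices\<close>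

text \<open>The obstacle is that slopes of modulus 1 are allowed, so no single step need contract;
  integrality of the slopes forces every other nonzero slope up to modulus 2. Sets are tested
  through their distribution function \<open>cum\<close>, because increments over an affine branch
  obey a recursion that a linear function \<theta> * v obeys as well. The only unknown is then the
  slope \<theta>, the share of the set in each Markov interval: for an invariant set this share is
  harmonic on the graph and therefore constant; for iterated preimages in the primitive case it
  becomes constant in the limit, at a rate that does not depend on the set. Necessity uses much
  less: an orbit running between interiors of Markov intervals traces a path in the graph, so dense
  orbits connect all vertices, and times of return to an interior are multiples of the period.
  Rationality of the density comes from solving the stationarity equations over the rationals from
  the start.\<close>

lemma homogeneous_system_nontrivial:
  fixes A :: "'i \<Rightarrow> 'j \<Rightarrow> 'a::field"
  assumes "finite J" "finite I" "card J < card I"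
  shows "\<exists>y. (\<exists>i\<in>I. y i \<noteq> 0) \<and> (\<forall>j\<in>J. (\<Sum>i\<in>I. y i * A i j) = 0)"
  using assms
proof (induction J arbitrary: I A rule: finite_induct)
  case empty
  then have "I \<noteq> {}" by auto
  then show ?case by (intro exI[of _ "\<lambda>_. 1"]) auto
next
  case (insert j J)
  show ?case
  proof (cases "\<forall>i\<in>I. A i j = 0")
    case True
    from insert.prems insert.hyps have "card J < card I" by simp
    from insert.IH[OF insert.prems(1) this, of A] obtain y where
      "\<exists>i\<in>I. y i \<noteq> 0" "\<forall>j\<in>J. (\<Sum>i\<in>I. y i * A i j) = 0" by blast
    with True show ?thesis by (intro exI[of _ y]) auto
  next
    case False
    then obtain k where k: "k \<in> I" "A k j \<noteq> 0" by blast
    \<comment> \<open>Gaussian elimination with pivot row \<open>k\<close>: subtracting the multiple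
      of it that clears column \<open>j\<close> disposes of one equation and one unknown.\<close>
    define A' where "A' i j' = A i j' - A i j / A k j * A k j'" for i j'
    have "card J < card (I - {k})" using insert.prems insert.hyps k by simp
    from insert.IH[OF _ this, of A'] insert.prems obtain y where
      y: "\<exists>i\<in>I - {k}. y i \<noteq> 0" "\<And>j'. j' \<in> J \<Longrightarrow> (\<Sum>i\<in>I - {k}. y i * A' i j') = 0" by auto
    \<comment> \<open>The value at \<open>k\<close> is forced by equation \<open>j\<close>; by the
      choice of \<open>A'\<close> the other equations then hold as well.\<close>
    define z where "z i = (if i = k then - (\<Sum>i\<in>I - {k}. y i * A i j) / A k j else y i)" for i
    have sum_z: "(\<Sum>i\<in>I. z i * A i j') =
        (\<Sum>i\<in>I - {k}. y i * A i j') - (\<Sum>i\<in>I - {k}. y i * A i j) / A k j * A k j'" for j'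
    proof -
      have "(\<Sum>i\<in>I. z i * A i j') = z k * A k j' + (\<Sum>i\<in>I - {k}. z i * A i j')"
        using insert.prems k by (simp add: sum.remove)
      also have "(\<Sum>i\<in>I - {k}. z i * A i j') = (\<Sum>i\<in>I - {k}. y i * A i j')"
        by (rule sum.cong) (auto simp: z_def)
      finally show ?thesis by (simp add: z_def)
    qed
    have "(\<Sum>i\<in>I. z i * A i j') = 0" if "j' \<in> insert j J" for j'
    proof (cases "j' = j")
      case True
      then show ?thesis using k by (simp add: sum_z)
    next
      case False
      with that have "j' \<in> J" by simp
      have "(\<Sum>i\<in>I. z i * A i j') = (\<Sum>i\<in>I - {k}. y i * A' i j')"
        unfolding sum_z A'_def
        by (simp add: sum_distrib_left sum_distrib_right sum_divide_distrib sum_subtractf algebra_simps)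
      then show ?thesis using y(2) \<open>j' \<in> J\<close> by simp
    qed
    moreover have "\<exists>i\<in>I. z i \<noteq> 0" using y(1) by (auto simp: z_def)
    ultimately show ?thesis by blast
  qed
qed

lemma stationary_vector_exists:
  fixes p :: "'v \<Rightarrow> 'v \<Rightarrow> 'a::linordered_field"
  assumes fin: "finite V" and ne: "V \<noteq> {}"
    and p0: "\<And>i j. i \<in> V \<Longrightarrow> j \<in> V \<Longrightarrow> p i j \<ge> 0"
    and p1: "\<And>i. i \<in> V \<Longrightarrow> (\<Sum>j\<in>V. p i j) = 1"
    and conn: "\<And>i j. i \<in> V \<Longrightarrow> j \<in> V \<Longrightarrow> (i, j) \<in> {(i, j). i \<in> V \<and> j \<in> V \<and> p i j > 0}\<^sup>+"
  shows "\<exists>m. (\<forall>i\<in>V. m i > 0) \<and> (\<forall>j\<in>V. m j = (\<Sum>i\<in>V. m i * p i j))"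
proof -
  obtain k where k: "k \<in> V" using ne by blast
  define A where "A i j = p i j - (if i = j then 1 else 0)" for i j
  have "card (V - {k}) < card V" using fin k by (meson card_Diff1_less)
  from homogeneous_system_nontrivial[OF _ fin this, of A] fin obtain y where
    y: "\<exists>i\<in>V. y i \<noteq> 0" "\<And>j. j \<in> V - {k} \<Longrightarrow> (\<Sum>i\<in>V. y i * A i j) = 0" by auto
  \<comment> \<open>The sum of all equations vanishes identically, which recovers the one dropped at
    \<open>k\<close>.\<close>
  have "(\<Sum>j\<in>V. \<Sum>i\<in>V. y i * A i j) = (\<Sum>i\<in>V. y i * (\<Sum>j\<in>V. A i j))"
    by (subst sum.swap) (simp add: sum_distrib_left)
  also have "\<dots> = 0" using fin p1 by (simp add: A_def sum_subtractf)
  finally have "(\<Sum>i\<in>V. y i * A i k) = 0" using y(2) fin k by (simp add: sum.remove[of V k])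
  with y(2) have "(\<Sum>i\<in>V. y i * A i j) = 0" if "j \<in> V" for j using that by (cases "j = k") auto
  then have y_stat: "y j = (\<Sum>i\<in>V. y i * p i j)" if "j \<in> V" for j
  proof -
    have "(\<Sum>i\<in>V. y i * A i j) = (\<Sum>i\<in>V. y i * p i j) - (\<Sum>i\<in>V. if i = j then y i else 0)"
      unfolding A_def right_diff_distrib sum_subtractf by (auto intro!: arg_cong2[of _ _ _ _ "(-)"] sum.cong)
    with \<open>j \<in> V \<Longrightarrow> (\<Sum>i\<in>V. y i * A i j) = 0\<close> that fin show ?thesis by simp
  qed
  \<comment> \<open>The triangle inequality puts \<open>m\<close> below its image; both have the
    same total, so equality holds at each vertex.\<close>
  define m where "m i = \<bar>y i\<bar>" for i
  have le: "m j \<le> (\<Sum>i\<in>V. m i * p i j)" if "j \<in> V" for j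
  proof -
    have "m j \<le> (\<Sum>i\<in>V. \<bar>y i * p i j\<bar>)"
      using y_stat[OF that] sum_abs[of "\<lambda>i. y i * p i j" V] by (simp add: m_def)
    also have "\<dots> = (\<Sum>i\<in>V. m i * p i j)"
      by (rule sum.cong) (auto simp: m_def abs_mult p0 that)
    finally show ?thesis .
  qed
  have "(\<Sum>j\<in>V. \<Sum>i\<in>V. m i * p i j) = (\<Sum>i\<in>V. m i * (\<Sum>j\<in>V. p i j))"
    by (subst sum.swap) (simp add: sum_distrib_left)
  also have "\<dots> = (\<Sum>i\<in>V. m i)" using p1 by simp
  finally have "(\<Sum>j\<in>V. (\<Sum>i\<in>V. m i * p i j) - m j) = 0" by (simp add: sum_subtractf)
  then have stat: "m j = (\<Sum>i\<in>V. m i * p i j)" if "j \<in> V" for j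
    using that le fin by (subst (asm) sum_nonneg_eq_0_iff) auto
  have step: "m j > 0" if "(i, j) \<in> {(i, j). i \<in> V \<and> j \<in> V \<and> p i j > 0}" "m i > 0" for i j
  proof -
    have "0 < m i * p i j" using that by simp
    also have "\<dots> \<le> (\<Sum>i\<in>V. m i * p i j)"
      using that p0 fin by (intro member_le_sum) (auto simp: m_def)
    finally show ?thesis using stat that by simp
  qed
  obtain i where i: "i \<in> V" "m i > 0" using y(1) by (auto simp: m_def)
  have "m j > 0" if "j \<in> V" for j
    using conn[OF i(1) that] by (induction rule: trancl_induct) (use i step in blast)+
  with stat show ?thesis by blast
qed

text \<open>The least positive difference \<open>d\<close> of two elements of
  \<open>insert 0 S\<close> divides all of \<open>S\<close>, hence is 1. The two consecutive numbers
  \<open>y\<close> and \<open>y + 1\<close> then generate every large number.\<close>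

lemma numerical_semigroup_cofinite:
  fixes S :: "nat set"
  assumes add: "\<And>x y. x \<in> S \<Longrightarrow> y \<in> S \<Longrightarrow> x + y \<in> S" and gcd: "Gcd S = 1"
  shows "\<exists>N. \<forall>n\<ge>N. n \<in> S"
proof -
  let ?S = "insert 0 S"
  have add0: "x + y \<in> ?S" if "x \<in> ?S" "y \<in> ?S" for x y using that add by auto
  have mult0: "n * x \<in> ?S" if "x \<in> ?S" for n x
    using that add0 by (induction n) (simp, metis mult_Suc)
  define D where "D d \<longleftrightarrow> d > 0 \<and> (\<exists>x\<in>?S. \<exists>y\<in>?S. x = y + d)" for d
  obtain z where z: "z \<in> S" "z > 0"
  proof (rule ccontr)
    assume "\<not> thesis"
    then have "S \<subseteq> {0}" using that by auto
    then have "Gcd S = 0" by (simp add: Gcd_0_iff)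
    with gcd show False by simp
  qed
  then have "D z" by (auto simp: D_def)
  define d where "d = (LEAST d. D d)"
  have "D d" unfolding d_def by (rule LeastI[of D, OF \<open>D z\<close>])
  then obtain x y where xy: "d > 0" "x \<in> ?S" "y \<in> ?S" "x = y + d" unfolding D_def by blast
  have "d dvd t" if "t \<in> S" for t
  proof (rule ccontr)
    assume "\<not> d dvd t"
    then have pos: "t mod d > 0" by (simp add: dvd_eq_mod_eq_0)
    \<comment> \<open>A nonzero remainder of \<open>t\<close> modulo \<open>d\<close> would be a
      smaller difference, namely that of \<open>t + (t div d) * y\<close> and
      \<open>(t div d) * x\<close>.\<close>
    have "(t div d) * x + t mod d = (t div d) * y + (t div d * d + t mod d)"
      by (simp only: xy(4) distrib_left add.assoc)
    then have "t + (t div d) * y = (t div d) * x + t mod d" by simp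
    moreover have "t + (t div d) * y \<in> ?S" "(t div d) * x \<in> ?S"
      by (intro add0 mult0 xy insertI2 that)+
    ultimately have "D (t mod d)" using pos unfolding D_def by metis
    then have "d \<le> t mod d" unfolding d_def by (rule Least_le)
    with xy show False by (metis mod_less_divisor not_less)
  qed
  then have "d dvd Gcd S" by (rule Gcd_greatest)
  then have d1: "d = 1" using gcd by simp
  \<comment> \<open>From the square of \<open>y\<close> on, the quotient \<open>n div y\<close> is
    at least the remainder, so \<open>n mod y\<close> of the summands \<open>y\<close> can be raised
    to \<open>y + 1\<close>. The extra 1 excludes \<open>n = 0\<close>, the only element of
    \<open>insert 0 S\<close> that may be missing in \<open>S\<close>.\<close>
  have "n \<in> S" if n: "n \<ge> y * y + 1" for n
  proof (cases "y = 0")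
    case True
    then have "1 \<in> ?S" using xy d1 by simp
    from mult0[OF this, of n] n show ?thesis by auto
  next
    case False
    have "n mod y < y" using False by simp
    have "y \<le> n div y" using n False by (simp add: less_eq_div_iff_mult_less_eq)
    then have le: "n mod y \<le> n div y" using \<open>n mod y < y\<close> by simp
    have "n = y * (n div y) + n mod y" by simp
    also have "\<dots> = y * (n div y - n mod y + n mod y) + n mod y" using le by simp
    also have "\<dots> = (n div y - n mod y) * y + (n mod y) * x"
    proof -
      have *: "y * (k + m) + m = k * y + m * (y + 1)" for k m by (simp add: algebra_simps)
      show ?thesis unfolding xy(4) d1 by (rule *)
    qed
    finally have n_eq: "n = (n div y - n mod y) * y + n mod y * x" .
    have "(n div y - n mod y) * y + n mod y * x \<in> ?S" by (intro add0 mult0 xy)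
    then have "n \<in> ?S" using n_eq by simp
    with n show ?thesis by auto
  qed
  then show ?thesis by blast
qed

text \<open>Closed paths at \<open>i\<close> can be concatenated, so their lengths form a semigroup
  with gcd 1. A loop of any large length is followed by a fixed path from \<open>i\<close> to
  \<open>j\<close>.\<close>

lemma primitive_graph_eventually:
  assumes fin: "finite V" and prim: "primitive_graph V E"
  shows "\<exists>N. \<forall>i\<in>V. \<forall>j\<in>V. (i, j) \<in> E ^^ N"
proof -
  have conn: "(i, j) \<in> E\<^sup>+" if "i \<in> V" "j \<in> V" for i j
    using prim that by (auto simp: primitive_graph_def strongly_connected_graph_def)
  have "\<forall>\<^sub>F n in sequentially. (i, j) \<in> E ^^ n" if ij: "i \<in> V" "j \<in> V" for i j
  proof -
    let ?S = "{n. 0 < n \<and> (i, i) \<in> E ^^ n}"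
    have "Gcd ?S = 1" using prim ij by (auto simp: primitive_graph_def graph_period_def)
    moreover have "x + y \<in> ?S" if "x \<in> ?S" "y \<in> ?S" for x y
      using that by (auto simp: relpow_add)
    ultimately obtain N where N: "\<And>n. n \<ge> N \<Longrightarrow> n \<in> ?S" using numerical_semigroup_cofinite[of ?S] by blast
    obtain k where k: "(i, j) \<in> E ^^ k" using conn[OF ij] by (meson trancl_power)
    have "(i, j) \<in> E ^^ n" if "n \<ge> N + k" for n
    proof -
      have "(i, i) \<in> E ^^ (n - k)" using N[of "n - k"] that by simp
      with k have "(i, j) \<in> E ^^ (n - k + k)" by (auto simp: relpow_add)
      with that show ?thesis by simp
    qed
    then show ?thesis unfolding eventually_sequentially by blast
  qed
  then have "\<forall>\<^sub>F n in sequentially. \<forall>i\<in>V. \<forall>j\<in>V. (i, j) \<in> E ^^ n"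
    using fin by (simp add: eventually_ball_finite_distrib)
  then show ?thesis unfolding eventually_sequentially by blast
qed

section \<open>Averaging operators of finite Markov chains\<close>

locale stochastic_matrix =
  fixes V :: "'v set" and p :: "'v \<Rightarrow> 'v \<Rightarrow> real"
  assumes finite_V: "finite V" and V_ne: "V \<noteq> {}"
    and p_nonneg: "\<And>i j. i \<in> V \<Longrightarrow> j \<in> V \<Longrightarrow> p i j \<ge> 0"
    and p_sum: "\<And>i. i \<in> V \<Longrightarrow> (\<Sum>j\<in>V. p i j) = 1"
begin

definition support :: "('v \<times> 'v) set" where
  "support = {(i, j). i \<in> V \<and> j \<in> V \<and> p i j > 0}"

definition avg :: "('v \<Rightarrow> real) \<Rightarrow> 'v \<Rightarrow> real" where
  "avg f i = (\<Sum>j\<in>V. p i j * f j)"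

lemma avg_mono:
  assumes "i \<in> V" "\<And>j. j \<in> V \<Longrightarrow> f j \<le> g j"
  shows "avg f i \<le> avg g i"
  unfolding avg_def using assms p_nonneg by (intro sum_mono mult_left_mono) auto

lemma avg_const: "i \<in> V \<Longrightarrow> avg (\<lambda>_. c) i = c"
  using p_sum by (simp add: avg_def flip: sum_distrib_right)

lemma avg_diff_const: "i \<in> V \<Longrightarrow> avg (\<lambda>j. f j - c) i = avg f i - c"
  using avg_const[of i c] by (simp add: avg_def right_diff_distrib sum_subtractf)

lemma avg_cong: "(\<And>j. j \<in> V \<Longrightarrow> f j = g j) \<Longrightarrow> avg f i = avg g i"
  by (simp add: avg_def)

text \<open>Maximum principle: at a vertex where \<open>\<theta>\<close> takes its maximum
  \<open>M\<close>, the average of the nonnegative function \<open>M - \<theta>\<close> vanishes, so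
  all successors take the maximum too.\<close>

lemma harmonic_constant:
  assumes conn: "strongly_connected_graph V support"
    and harm: "\<And>i. i \<in> V \<Longrightarrow> \<theta> i = avg \<theta> i"
    and ij: "i \<in> V" "j \<in> V"
  shows "\<theta> i = \<theta> j"
proof -
  define M where "M = Max (\<theta> ` V)"
  have le: "\<theta> j \<le> M" if "j \<in> V" for j unfolding M_def using finite_V that by simp
  have "M \<in> \<theta> ` V" unfolding M_def using finite_V V_ne by (intro Max_in) auto
  then obtain k where k: "k \<in> V" "\<theta> k = M" by auto
  have step: "\<theta> j = M" if "(i, j) \<in> support" "\<theta> i = M" for i j
  proof -
    from that have ij: "i \<in> V" "j \<in> V" "p i j > 0" by (auto simp: support_def)
    have "(\<Sum>j\<in>V. p i j * (M - \<theta> j)) = 0"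
      using harm[OF ij(1)] that p_sum[OF ij(1)]
      by (simp add: avg_def right_diff_distrib sum_subtractf flip: sum_distrib_right)
    then have "p i j * (M - \<theta> j) = 0"
      using ij finite_V le p_nonneg by (subst (asm) sum_nonneg_eq_0_iff) auto
    with ij show ?thesis by simp
  qed
  have "\<theta> j = M" if "j \<in> V" for j
  proof -
    have "(k, j) \<in> support\<^sup>+" using conn k that by (auto simp: strongly_connected_graph_def)
    then show ?thesis by (induction rule: trancl_induct) (use k step in blast)+
  qed
  with ij show ?thesis by simp
qed

lemma avg_pow_const_bounds:
  assumes "\<And>j. j \<in> V \<Longrightarrow> lo \<le> f j" "\<And>j. j \<in> V \<Longrightarrow> f j \<le> hi" "i \<in> V"
  shows "lo \<le> (avg ^^ n) f i \<and> (avg ^^ n) f i \<le> hi"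
  using assms(3)
proof (induction n arbitrary: i)
  case (Suc n)
  then show ?case
    using avg_mono[of i "\<lambda>_. lo" "(avg ^^ n) f"] avg_mono[of i "(avg ^^ n) f" "\<lambda>_. hi"]
    by (simp add: avg_const)
qed (use assms in simp)

lemma avg_pow_diff_const:
  "i \<in> V \<Longrightarrow> (avg ^^ n) (\<lambda>j. f j - c) i = (avg ^^ n) f i - c"
proof (induction n arbitrary: i)
  case (Suc n)
  have "(avg ^^ Suc n) (\<lambda>j. f j - c) i = avg (\<lambda>j. (avg ^^ n) f j - c) i"
    unfolding funpow.simps comp_def by (intro avg_cong) (use Suc.IH in \<open>simp add: comp_def\<close>)
  then show ?case using Suc.prems by (simp add: avg_diff_const)
qed simp

text \<open>A power of the smallest positive entry bounds the weight of every path from below. That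
  the constant does not depend on \<open>f\<close> is the origin of the uniformity that exactness
  needs.\<close>

lemma avg_pow_pos:
  "\<exists>\<delta>>0. \<forall>f i j. (\<forall>j\<in>V. f j \<ge> 0) \<longrightarrow> (i, j) \<in> support ^^ n \<longrightarrow> i \<in> V \<longrightarrow> (avg ^^ n) f i \<ge> \<delta> * f j"
proof -
  \<comment> \<open>The inserted 1 keeps the set nonempty when no entry is positive.\<close>
  define d where "d = Min (insert 1 ((\<lambda>(i, j). p i j) ` support))"
  have fin: "finite support"
    by (rule finite_subset[of _ "V \<times> V"]) (auto simp: support_def finite_V)
  have d: "d > 0" unfolding d_def using fin by (auto simp: support_def)
  have d_le: "d \<le> p i j" if "(i, j) \<in> support" for i j
    unfolding d_def using fin that by (intro Min_le) force+
  have "(avg ^^ n) f i \<ge> d ^ n * f j"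
    if "\<forall>j\<in>V. f j \<ge> 0" "(i, j) \<in> support ^^ n" "i \<in> V" for f i j
    using that(2,3)
  proof (induction n arbitrary: i)
    case (Suc n)
    then obtain k where k: "(i, k) \<in> support" "(k, j) \<in> support ^^ n" by (meson relpow_Suc_D2)
    then have kV: "k \<in> V" by (auto simp: support_def)
    have jV: "j \<in> V"
    proof (cases n)
      case 0
      with k kV show ?thesis by simp
    next
      case (Suc m)
      with k have "(k, j) \<in> support ^^ m O support" by simp
      then show ?thesis by (auto simp: support_def)
    qed
    have nn: "0 \<le> (avg ^^ n) f l" if "l \<in> V" for l
    proof -
      have "0 \<le> f j" if "j \<in> V" for j using \<open>\<forall>j\<in>V. f j \<ge> 0\<close> that by simp
      moreover have "f j \<le> Max (f ` V)" if "j \<in> V" for j using finite_V that by simp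
      ultimately show ?thesis using avg_pow_const_bounds[of 0 f] that by blast
    qed
    have "d ^ Suc n * f j \<le> p i k * (avg ^^ n) f k"
    proof -
      have "d * (d ^ n * f j) \<le> p i k * (avg ^^ n) f k"
        using Suc.IH[OF k(2) kV] d_le[OF k(1)] d jV \<open>\<forall>j\<in>V. f j \<ge> 0\<close>
        by (intro mult_mono) auto
      then show ?thesis by simp
    qed
    also have "\<dots> \<le> avg ((avg ^^ n) f) i"
      unfolding avg_def[of "(avg ^^ n) f"] using kV nn p_nonneg Suc.prems finite_V
      by (intro member_le_sum[of k V "\<lambda>j. p i j * (avg ^^ n) f j"]) auto
    finally show ?case by simp
  qed simp
  with d show ?thesis by (intro exI[of _ "d ^ n"]) auto
qed

text \<open>Doeblin's argument: after the \<open>N\<close> steps needed to connect everything, every entry of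
  the iterated matrix is at least \<open>\<delta>\<close>, hence the oscillation shrinks by the factor \<open>1 - \<delta>\<close>.\<close>

lemma uniform_oscillation_decay:
  assumes N: "\<And>i j. i \<in> V \<Longrightarrow> j \<in> V \<Longrightarrow> (i, j) \<in> support ^^ N" and e: "e > 0"
  shows "\<exists>n0. \<forall>n\<ge>n0. \<forall>f. (\<forall>j\<in>V. 0 \<le> f j \<and> f j \<le> 1) \<longrightarrow>
    (\<forall>i\<in>V. \<forall>j\<in>V. \<bar>(avg ^^ n) f i - (avg ^^ n) f j\<bar> \<le> e)"
proof -
  obtain \<delta> where \<delta>: "\<delta> > 0" and pos: "\<And>f i j. \<forall>j\<in>V. f j \<ge> 0 \<Longrightarrow> (i, j) \<in> support ^^ N \<Longrightarrow> i \<in> V \<Longrightarrow>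
      (avg ^^ N) f i \<ge> \<delta> * f j" using avg_pow_pos[of N] by blast
  \<comment> \<open>As far as \<open>avg_pow_pos\<close> tells, \<open>\<delta>\<close> may exceed
    1, hence the maximum with 0.\<close>
  define \<kappa> where "\<kappa> = max 0 (1 - \<delta>)"
  have \<kappa>: "0 \<le> \<kappa>" "\<kappa> < 1" using \<delta> by (auto simp: \<kappa>_def)
  have one: "\<exists>lo'. \<forall>i\<in>V. lo' \<le> (avg ^^ N) f i \<and> (avg ^^ N) f i \<le> lo' + \<kappa> * w"
    if f: "\<And>j. j \<in> V \<Longrightarrow> lo \<le> f j \<and> f j \<le> lo + w" for f lo w
  proof -
    define M where "M = Max (f ` V)"
    have "M \<in> f ` V" unfolding M_def using finite_V V_ne by (intro Max_in) auto
    then obtain k where k: "k \<in> V" "f k = M" by auto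
    have le: "f j \<le> M" if "j \<in> V" for j unfolding M_def using finite_V that by simp
    have M: "lo \<le> M" "M \<le> lo + w" using f[OF k(1)] k by auto
    \<comment> \<open>The maximum \<open>M\<close> is attained at \<open>k\<close>, and after
      \<open>N\<close> steps every vertex sees \<open>k\<close> with weight at least
      \<open>\<delta>\<close>: the lower bound rises while the upper bound \<open>M\<close>
      stays.\<close>
    have "lo + \<delta> * (M - lo) \<le> (avg ^^ N) f i \<and> (avg ^^ N) f i \<le> M" if i: "i \<in> V" for i
      using pos[of "\<lambda>j. f j - lo" i k] f N[OF i k(1)] i k
        avg_pow_diff_const[OF i, of N f lo] avg_pow_const_bounds[of lo f M i N] le by auto
    moreover have "M \<le> lo + \<delta> * (M - lo) + \<kappa> * w"
    proof -
      have "(1 - \<delta>) * (M - lo) \<le> \<kappa> * (M - lo)" using M by (intro mult_right_mono) (auto simp: \<kappa>_def)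
      also have "\<dots> \<le> \<kappa> * w" using M \<kappa> by (intro mult_left_mono) auto
      finally show ?thesis by (simp add: algebra_simps)
    qed
    ultimately show ?thesis by (intro exI[of _ "lo + \<delta> * (M - lo)"]) force
  qed
  have iter: "\<exists>lo'. \<forall>i\<in>V. lo' \<le> (avg ^^ (k * N)) f i \<and> (avg ^^ (k * N)) f i \<le> lo' + \<kappa> ^ k"
    if f: "\<And>j. j \<in> V \<Longrightarrow> 0 \<le> f j \<and> f j \<le> 1" for f k
  proof (induction k)
    case 0
    then show ?case using f by (intro exI[of _ 0]) auto
  next
    case (Suc k)
    then obtain lo where "\<And>i. i \<in> V \<Longrightarrow> lo \<le> (avg ^^ (k * N)) f i \<and> (avg ^^ (k * N)) f i \<le> lo + \<kappa> ^ k"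
      by blast
    from one[OF this] show ?case by (simp add: funpow_add)
  qed
  obtain k where k: "\<kappa> ^ k < e" using \<kappa> e real_arch_pow_inv[of e \<kappa>] by blast
  show ?thesis
  proof (intro exI[of _ "k * N"] allI impI ballI)
    fix n i j and f :: "'v \<Rightarrow> real"
    assume n: "k * N \<le> n" and f: "\<forall>j\<in>V. 0 \<le> f j \<and> f j \<le> 1" and ij: "i \<in> V" "j \<in> V"
    obtain lo where lo: "\<And>i. i \<in> V \<Longrightarrow> lo \<le> (avg ^^ (k * N)) f i"
      "\<And>i. i \<in> V \<Longrightarrow> (avg ^^ (k * N)) f i \<le> lo + \<kappa> ^ k" using iter[of f k] f by blast
    have "(avg ^^ n) f = (avg ^^ (n - k * N)) ((avg ^^ (k * N)) f)"
      using n by (metis comp_apply funpow_add le_add_diff_inverse2)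
    moreover have "lo \<le> (avg ^^ (n - k * N)) ((avg ^^ (k * N)) f) l \<and>
        (avg ^^ (n - k * N)) ((avg ^^ (k * N)) f) l \<le> lo + \<kappa> ^ k" if "l \<in> V" for l
      by (rule avg_pow_const_bounds) (use lo that in auto)
    ultimately have "lo \<le> (avg ^^ n) f l \<and> (avg ^^ n) f l \<le> lo + \<kappa> ^ k" if "l \<in> V" for l
      using that by simp
    from this[OF ij(1)] this[OF ij(2)] show "\<bar>(avg ^^ n) f i - (avg ^^ n) f j\<bar> \<le> e"
      using k by linarith
  qed
qed

end


section \<open>Invariant measures and factors\<close>

lemma preserves_measure_funpow:
  assumes "preserves_measure M T"
  shows "(T ^^ k) \<in> measurable M M"
    and "A \<in> sets M \<Longrightarrow> emeasure M ((T ^^ k) -` A \<inter> space M) = emeasure M A"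
    and "A \<in> sets M \<Longrightarrow> measure M ((T ^^ k) -` A \<inter> space M) = measure M A"
proof -
  have T: "T \<in> measurable M M" "\<And>A. A \<in> sets M \<Longrightarrow> emeasure M (T -` A \<inter> space M) = emeasure M A"
    using assms by (auto simp: preserves_measure_def)
  show meas: "(T ^^ k) \<in> measurable M M" for k
    by (induction k) (auto simp: comp_def intro: measurable_compose[OF _ T(1)])
  show *: "emeasure M ((T ^^ k) -` A \<inter> space M) = emeasure M A" if A: "A \<in> sets M" for A
  proof (induction k)
    case (Suc k)
    have "(T ^^ Suc k) -` A \<inter> space M = T -` ((T ^^ k) -` A \<inter> space M) \<inter> space M"
      using measurable_space[OF T(1)] by (auto simp: funpow_swap1)
    then show ?case using Suc T(2)[OF measurable_sets[OF meas A, of k]] by (simp only:)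
  qed (use sets.sets_into_space[OF A] in \<open>simp add: Int_absorb2\<close>)
  then show "A \<in> sets M \<Longrightarrow> measure M ((T ^^ k) -` A \<inter> space M) = measure M A"
    by (simp add: measure_def)
qed

lemma funpow_vimage_Suc:
  assumes "T \<in> space M \<rightarrow> space M"
  shows "(T ^^ Suc k) -` A \<inter> space M = T -` ((T ^^ k) -` A \<inter> space M) \<inter> space M"
  using assms by (auto simp: funpow_swap1)

text \<open>Iterated preimages of \<open>W\<close> decrease and keep their measure, so their
  intersection has this measure too. Thus \<open>ergodic_map\<close>, which speaks only of strictly
  invariant sets, applies to sets that merely contain their preimage.\<close>

lemma sub_invariant_imp_invariant:
  assumes prob: "prob_space M" and pres: "preserves_measure M T"
    and W: "W \<in> sets M" and sub: "T -` W \<inter> space M \<subseteq> W"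
  shows "\<exists>W'\<in>sets M. W' \<subseteq> W \<and> T -` W' \<inter> space M = W' \<and> measure M W' = measure M W"
proof -
  interpret prob_space M by fact
  have sp: "T \<in> space M \<rightarrow> space M" using pres by (auto simp: preserves_measure_def measurable_def)
  define F where "F k = (T ^^ k) -` W \<inter> space M" for k
  have F: "F k \<in> sets M" for k
    unfolding F_def using preserves_measure_funpow(1)[OF pres] W by (rule measurable_sets)
  have F_Suc: "F (Suc k) = T -` F k \<inter> space M" for k
    unfolding F_def by (rule funpow_vimage_Suc[OF sp])
  have F0: "F 0 = W" using sets.sets_into_space[OF W] by (auto simp: F_def)
  have dec: "F (Suc k) \<subseteq> F k" for k
    by (induction k) (use sub F_Suc F0 in auto)
  define W' where "W' = (\<Inter>k. F k)"
  have W': "W' \<in> sets M" unfolding W'_def using F by auto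
  have "(\<lambda>k. measure M (F k)) \<longlonglongrightarrow> measure M W'"
    unfolding W'_def using F dec by (intro finite_Lim_measure_decseq) (auto intro: decseq_SucI)
  moreover have "measure M (F k) = measure M W" for k
    unfolding F_def using preserves_measure_funpow(3)[OF pres W] .
  ultimately have "measure M W' = measure M W" by (simp add: LIMSEQ_const_iff)
  moreover have "T -` W' \<inter> space M = W'"
  proof -
    have "T -` W' \<inter> space M = (\<Inter>k. F (Suc k))" by (auto simp: W'_def F_Suc)
    also have "\<dots> = W'" using dec by (fastforce simp: W'_def)
    finally show ?thesis .
  qed
  moreover have "W' \<subseteq> W" using F0 by (auto simp: W'_def)
  ultimately show ?thesis using W' by blast
qed

lemma ergodic_sub_invariant:
  assumes "prob_space M" "preserves_measure M T" "ergodic_map M T"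
    and "W \<in> sets M" "T -` W \<inter> space M \<subseteq> W"
  shows "measure M W = 0 \<or> measure M W = 1"
  using sub_invariant_imp_invariant[OF assms(1,2,4,5)] assms(3) by (auto simp: ergodic_map_def)

text \<open>The points that ever enter \<open>A\<close> form a set that contains \<open>A\<close>
  and its own preimage; its measure is positive and therefore 1.\<close>

lemma ergodic_hitting_AE:
  assumes prob: "prob_space M" and pres: "preserves_measure M T" and erg: "ergodic_map M T"
    and A: "A \<in> sets M" and pos: "measure M A > 0"
  shows "AE x in M. \<exists>k. (T ^^ k) x \<in> A"
proof -
  interpret prob_space M by fact
  have sp: "T \<in> space M \<rightarrow> space M" using pres by (auto simp: preserves_measure_def measurable_def)
  define W where "W = (\<Union>k. (T ^^ k) -` A \<inter> space M)"
  have W: "W \<in> sets M"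
    unfolding W_def using measurable_sets[OF preserves_measure_funpow(1)[OF pres] A]
    by (intro sets.countable_UN) blast
  have "T -` W \<inter> space M \<subseteq> W"
  proof
    fix x assume x: "x \<in> T -` W \<inter> space M"
    then obtain k where "(T ^^ k) (T x) \<in> A" by (auto simp: W_def)
    then have "(T ^^ Suc k) x \<in> A" by (simp add: funpow_swap1)
    with x show "x \<in> W" unfolding W_def by blast
  qed
  moreover have "A \<subseteq> W"
  proof
    fix x assume "x \<in> A"
    then have "x \<in> (T ^^ 0) -` A \<inter> space M" using sets.sets_into_space[OF A] by auto
    then show "x \<in> W" unfolding W_def by blast
  qed
  then have "measure M A \<le> measure M W" using W by (intro finite_measure_mono)
  ultimately have "measure M W = 1"
    using ergodic_sub_invariant[OF prob pres erg W] pos by simp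
  then have "AE x in M. x \<in> W" using W by (simp add: AE_in_set_eq_1)
  then show ?thesis by (auto simp: W_def)
qed

lemma mixing_imp_ergodic:
  assumes "mixing_map M T"
  shows "ergodic_map M T"
  unfolding ergodic_map_def
proof (intro ballI impI)
  fix A assume A: "A \<in> sets M" "T -` A \<inter> space M = A"
  have "A \<inter> ((T ^^ k) -` A \<inter> space M) = A" for k
  proof (induction k)
    case 0
    then show ?case using A sets.sets_into_space by auto
  next
    case (Suc k)
    have "(T ^^ Suc k) x \<in> A" if "x \<in> A" for x
      using that Suc A(2) by (simp add: funpow_swap1) blast
    then show ?case using A sets.sets_into_space by auto
  qed
  moreover have "(\<lambda>k. measure M (A \<inter> ((T ^^ k) -` A \<inter> space M))) \<longlonglongrightarrow> measure M A * measure M A"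
    using assms A by (auto simp: mixing_map_def)
  ultimately have "measure M A = measure M A * measure M A" by (simp add: LIMSEQ_const_iff)
  then show "measure M A = 0 \<or> measure M A = 1" by simp
qed

lemma exact_imp_ergodic:
  assumes ex: "exact_map M T" and T: "T \<in> space M \<rightarrow> space M"
  shows "ergodic_map M T"
  unfolding ergodic_map_def
proof (intro ballI impI)
  fix A assume A: "A \<in> sets M" "T -` A \<inter> space M = A"
  have "(T ^^ k) -` A \<inter> space M = A" for k
  proof (induction k)
    case 0
    then show ?case using A sets.sets_into_space by auto
  next
    case (Suc k)
    then show ?case using A funpow_vimage_Suc[OF T, of k A] by (simp only:)
  qed
  then have "A \<in> (\<Inter>k. (\<lambda>B. (T ^^ k) -` B \<inter> space M) ` sets M)" using A by auto
  then show "measure M A = 0 \<or> measure M A = 1" using ex by (auto simp: exact_map_def)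
qed

text \<open>On \<open>A\<close> the function \<open>f - 1\<close> is positive and yet its integral
  is not; the finite measure of \<open>A\<close> makes the subtraction of extended reals
  legitimate.\<close>

lemma nn_integral_gt_one_imp_null:
  assumes A: "A \<in> sets M" and f: "f \<in> borel_measurable M" and gt: "\<And>x. x \<in> A \<Longrightarrow> f x > (1::ennreal)"
    and le: "(\<integral>\<^sup>+x. f x * indicator A x \<partial>M) \<le> emeasure M A" and fin: "emeasure M A < \<infinity>"
  shows "emeasure M A = 0"
proof -
  have "(\<integral>\<^sup>+x. f x * indicator A x - indicator A x \<partial>M)
      = (\<integral>\<^sup>+x. f x * indicator A x \<partial>M) - (\<integral>\<^sup>+x. indicator A x \<partial>M)"
  proof (intro nn_integral_diff)
    show "(\<integral>\<^sup>+x. indicator A x \<partial>M) \<noteq> \<infinity>" using A fin by simp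
  qed (use A f gt in \<open>auto simp: less_imp_le indicator_def\<close>)
  also have "\<dots> = 0"
    using le A le_less_trans[OF le fin] by (subst diff_eq_0_iff_ennreal) auto
  finally have "AE x in M. f x * indicator A x - indicator A x = 0"
    using A f by (subst (asm) nn_integral_0_iff_AE) auto
  then have "AE x in M. x \<notin> A"
  proof eventually_elim
    case (elim x)
    show ?case
    proof
      assume x: "x \<in> A"
      with elim have "f x \<le> 1" by (auto simp: diff_eq_0_iff_ennreal split: if_splits)
      with gt[OF x] show False by simp
    qed
  qed
  then show ?thesis using AE_iff_null_sets[OF A] by (simp add: null_sets_def)
qed

text \<open>With \<open>f\<close> the density of \<open>N\<close> with respect to \<open>M\<close>, invariance of both measures gives the sets
  \<open>D - T\<inverse>D\<close> and \<open>T\<inverse>D - D\<close> for \<open>D = {f > 1}\<close> equal masses under \<open>M\<close> and under \<open>N\<close>; as \<open>f > 1\<close> on the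
  first and \<open>f \<le> 1\<close> on the second, both are null and \<open>D\<close> is invariant modulo \<open>M\<close>.\<close>

lemma ergodic_measure_unique:
  assumes M: "prob_space M" and N: "prob_space N" and sets: "sets N = sets M"
    and ac: "absolutely_continuous M N"
    and presM: "preserves_measure M T" and presN: "preserves_measure N T" and erg: "ergodic_map M T"
  shows "N = M"
proof -
  interpret M: prob_space M by fact
  interpret N: prob_space N by fact
  have sp: "space N = space M" using sets by (rule sets_eq_imp_space_eq)
  have T: "T \<in> measurable M M" "T \<in> space M \<rightarrow> space M"
    using presM by (auto simp: preserves_measure_def measurable_def)
  define f where "f = RN_deriv M N"
  have f[measurable]: "f \<in> borel_measurable M" by (simp add: f_def)
  have Nf: "emeasure N A = (\<integral>\<^sup>+x. f x * indicator A x \<partial>M)" if "A \<in> sets M" for A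
    using M.density_RN_deriv[OF ac sets] that f emeasure_density[of f M A] by (simp add: f_def)
  define D where "D = {x \<in> space M. f x > 1}"
  have D[measurable]: "D \<in> sets M" unfolding D_def by measurable
  define TD where "TD = T -` D \<inter> space M"
  have TD[measurable]: "TD \<in> sets M" unfolding TD_def using T D by (auto intro: measurable_sets)
  have M_TD: "emeasure M TD = emeasure M D" using presM D by (auto simp: preserves_measure_def TD_def)
  have N_TD: "emeasure N TD = emeasure N D" using presN D sets sp by (auto simp: preserves_measure_def TD_def)
  have eq_diff: "emeasure K (D - TD) = emeasure K (TD - D)"
    if "prob_space K" "sets K = sets M" "emeasure K TD = emeasure K D" for K
  proof -
    interpret K: prob_space K by fact
    have "measure K TD = measure K D" using that by (simp add: measure_def)
    then have "measure K (D - TD) = measure K (TD - D)"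
      using K.finite_measure_Diff'[of D TD] K.finite_measure_Diff'[of TD D] that D TD by (simp add: Int_commute)
    then show ?thesis by (simp add: K.emeasure_eq_measure)
  qed
  have 1: "emeasure M (D - TD) = 0"
  proof (rule nn_integral_gt_one_imp_null[OF _ f])
    show "D - TD \<in> sets M" by measurable
    have "(\<integral>\<^sup>+x. f x * indicator (D - TD) x \<partial>M) = emeasure N (TD - D)"
      using Nf[of "D - TD"] eq_diff[OF N sets N_TD] by simp
    also have "\<dots> = (\<integral>\<^sup>+x. f x * indicator (TD - D) x \<partial>M)" by (rule Nf) measurable
    also have "\<dots> \<le> (\<integral>\<^sup>+x. indicator (TD - D) x \<partial>M)"
      by (rule nn_integral_mono) (auto simp: D_def TD_def indicator_def)
    also have "\<dots> = emeasure M (D - TD)" using eq_diff[OF M refl M_TD] by simp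
    finally show "(\<integral>\<^sup>+x. f x * indicator (D - TD) x \<partial>M) \<le> emeasure M (D - TD)" .
  qed (auto simp: D_def M.emeasure_eq_measure)
  then have 2: "emeasure M (TD - D) = 0" using eq_diff[OF M refl M_TD] by simp
  \<comment> \<open>\<open>D\<close> is invariant only up to null sets. The union of its iterated
    preimages contains its own preimage and exceeds \<open>D\<close> by a null set, so ergodicity is
    applied to this union.\<close>
  define F where "F k = (T ^^ k) -` D \<inter> space M" for k
  have F[measurable]: "F k \<in> sets M" for k
    unfolding F_def using preserves_measure_funpow(1)[OF presM] D by (rule measurable_sets)
  have F_Suc: "F (Suc k) = T -` F k \<inter> space M" for k
    unfolding F_def by (rule funpow_vimage_Suc[OF T(2)])
  have F0: "F 0 = D" by (auto simp: F_def D_def)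
  have F_null: "emeasure M (F k - D) = 0" for k
  proof (induction k)
    case (Suc k)
    have "emeasure M (F (Suc k) - D) \<le> emeasure M ((T -` (F k - D) \<inter> space M) \<union> (TD - D))"
      by (rule emeasure_mono) (auto simp: F_Suc TD_def intro!: sets.Un measurable_sets[OF T(1)])
    also have "\<dots> \<le> emeasure M (T -` (F k - D) \<inter> space M) + emeasure M (TD - D)"
      by (rule emeasure_subadditive) (auto intro!: measurable_sets[OF T(1)])
    also have "emeasure M (T -` (F k - D) \<inter> space M) = emeasure M (F k - D)"
      using presM by (auto simp: preserves_measure_def)
    finally show ?case using Suc 2 by simp
  qed (simp add: F0)
  define W where "W = (\<Union>k. F k)"
  have W: "W \<in> sets M" unfolding W_def by measurable
  have "T -` W \<inter> space M \<subseteq> W" using F_Suc by (force simp: W_def)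
  then have "measure M W = 0 \<or> measure M W = 1" by (rule ergodic_sub_invariant[OF M presM erg W])
  moreover have "measure M W = measure M D"
  proof -
    have "(\<Union>k. F k - D) \<in> null_sets M" using F_null by (intro null_sets_UN) (auto simp: null_sets_def)
    then have "emeasure M (D \<union> (\<Union>k. F k - D)) = emeasure M D" by (rule emeasure_Un_null_set[OF D])
    moreover have "D \<union> (\<Union>k. F k - D) = W" using F0 by (auto simp: W_def)
    ultimately show ?thesis by (simp add: measure_def)
  qed
  ultimately have "measure M D = 0 \<or> measure M D = 1" by simp
  \<comment> \<open>If \<open>D\<close> had full measure, \<open>f > 1\<close> almost everywhere
    would integrate to more than the total mass 1 of \<open>N\<close>.\<close>
  moreover have "emeasure M D = 0" if "measure M D = 1"
  proof (rule nn_integral_gt_one_imp_null[OF D f])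
    have "(\<integral>\<^sup>+x. f x * indicator D x \<partial>M) = emeasure N D" using Nf[OF D] by simp
    also have "\<dots> \<le> 1" by (rule N.emeasure_le_1)
    finally show "(\<integral>\<^sup>+x. f x * indicator D x \<partial>M) \<le> emeasure M D" using that by (simp add: M.emeasure_eq_measure)
  qed (auto simp: D_def M.emeasure_eq_measure)
  ultimately have "emeasure M D = 0" by (auto simp: M.emeasure_eq_measure)
  then have "AE x in M. x \<notin> D" using D by (intro AE_not_in) (simp add: null_sets_def)
  then have f1: "AE x in M. f x \<le> 1"
  proof (rule AE_mp, intro AE_I2 impI)
    fix x assume "x \<in> space M" "x \<notin> D"
    then show "f x \<le> 1" by (auto simp: D_def not_less)
  qed
  \<comment> \<open>A density of at most 1 gives domination on every set; for two probability
    measures, domination on the complement turns it into equality.\<close>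
  have le: "measure N A \<le> measure M A" if A: "A \<in> sets M" for A
  proof -
    have "emeasure N A \<le> (\<integral>\<^sup>+x. indicator A x \<partial>M)"
      unfolding Nf[OF A] by (rule nn_integral_mono_AE) (use f1 in \<open>eventually_elim, auto simp: indicator_def\<close>)
    with A show ?thesis by (simp add: N.emeasure_eq_measure M.emeasure_eq_measure)
  qed
  show "N = M"
  proof (rule measure_eqI[OF sets])
    fix A assume "A \<in> sets N"
    then have A: "A \<in> sets M" using sets by simp
    have "measure N (space M - A) = 1 - measure N A" using N.prob_compl[of A] A sets sp by simp
    moreover have "measure M (space M - A) = 1 - measure M A" using M.prob_compl[of A] A by simp
    ultimately have "measure N A = measure M A" using le[OF A] le[of "space M - A"] A by simp
    then show "emeasure N A = emeasure M A" by (simp add: N.emeasure_eq_measure M.emeasure_eq_measure)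
  qed
qed

text \<open>Instantiated in both directions, with \<open>retr\<close> and with
  \<open>point_filter\<close> as \<open>\<phi>\<close>, so that invariance and all three dynamical
  properties pass from either space to the other.\<close>

locale factor_map =
  fixes M :: "'a measure" and K :: "'b measure" and T :: "'a \<Rightarrow> 'a" and U :: "'b \<Rightarrow> 'b" and \<phi> :: "'a \<Rightarrow> 'b"
  assumes prob: "prob_space M" and pres: "preserves_measure M T"
    and U: "U \<in> measurable K K" and \<phi>: "\<phi> \<in> measurable M K"
    and semiconj: "\<And>x. x \<in> space M \<Longrightarrow> \<phi> (T x) = U (\<phi> x)"
begin

abbreviation img where "img \<equiv> distr M K \<phi>"

lemma T_space: "x \<in> space M \<Longrightarrow> T x \<in> space M"
  using pres by (auto simp: preserves_measure_def measurable_def)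

lemma semiconj_funpow: "x \<in> space M \<Longrightarrow> \<phi> ((T ^^ k) x) = (U ^^ k) (\<phi> x)"
proof (induction k arbitrary: x)
  case (Suc k)
  then show ?case using T_space semiconj by (simp add: funpow_swap1)
qed simp

lemma vimage_funpow:
  "\<phi> -` ((U ^^ k) -` A \<inter> space K) \<inter> space M = (T ^^ k) -` (\<phi> -` A \<inter> space M) \<inter> space M"
proof -
  have "(T ^^ k) x \<in> space M" if "x \<in> space M" for x
    using that T_space by (induction k) auto
  then show ?thesis using semiconj_funpow measurable_space[OF \<phi>] by auto
qed

lemma vimage_one: "\<phi> -` (U -` A \<inter> space K) \<inter> space M = T -` (\<phi> -` A \<inter> space M) \<inter> space M"
  using vimage_funpow[of 1] by simp

lemma vimage_sets: "A \<in> sets K \<Longrightarrow> \<phi> -` A \<inter> space M \<in> sets M"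
  using \<phi> by (rule measurable_sets)

lemma U_sets: "A \<in> sets K \<Longrightarrow> (U ^^ k) -` A \<inter> space K \<in> sets K"
proof -
  have "(U ^^ k) \<in> measurable K K"
    by (induction k) (auto simp: comp_def intro: measurable_compose[OF _ U])
  then show "A \<in> sets K \<Longrightarrow> ?thesis" by (rule measurable_sets)
qed

lemma img_prob: "prob_space img"
  using prob \<phi> by (rule prob_space.prob_space_distr)

lemma img_preserves: "preserves_measure img U"
  unfolding preserves_measure_def
proof (intro conjI ballI)
  show "U \<in> measurable img img" using U by simp
  fix A assume "A \<in> sets img"
  then have A: "A \<in> sets K" by simp
  have "emeasure img (U -` A \<inter> space img) = emeasure M (T -` (\<phi> -` A \<inter> space M) \<inter> space M)"
    using emeasure_distr[OF \<phi>, of "U -` A \<inter> space K"] U_sets[OF A, of 1] vimage_one by simp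
  also have "\<dots> = emeasure M (\<phi> -` A \<inter> space M)"
    using pres vimage_sets[OF A] by (simp only: preserves_measure_def)
  finally show "emeasure img (U -` A \<inter> space img) = emeasure img A" using emeasure_distr[OF \<phi> A] by simp
qed

lemma img_ergodic: "ergodic_map M T \<Longrightarrow> ergodic_map img U"
  unfolding ergodic_map_def
proof (intro ballI impI)
  fix A
  assume erg: "\<forall>A\<in>sets M. T -` A \<inter> space M = A \<longrightarrow> measure M A = 0 \<or> measure M A = 1"
    and "A \<in> sets img" "U -` A \<inter> space img = A"
  then have A: "A \<in> sets K" "U -` A \<inter> space K = A" by simp_all
  then show "measure img A = 0 \<or> measure img A = 1"
    using bspec[OF erg vimage_sets[OF A(1)]] vimage_one[of A] measure_distr[OF \<phi> A(1)] by metis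
qed

lemma img_mixing: "mixing_map M T \<Longrightarrow> mixing_map img U"
  unfolding mixing_map_def
proof (intro ballI)
  fix A B
  assume mix: "\<forall>A\<in>sets M. \<forall>B\<in>sets M. (\<lambda>k. measure M (A \<inter> ((T ^^ k) -` B \<inter> space M))) \<longlonglongrightarrow> measure M A * measure M B"
    and "A \<in> sets img" "B \<in> sets img"
  then have AB: "A \<in> sets K" "B \<in> sets K" by auto
  have "measure img (A \<inter> ((U ^^ k) -` B \<inter> space img)) =
      measure M ((\<phi> -` A \<inter> space M) \<inter> ((T ^^ k) -` (\<phi> -` B \<inter> space M) \<inter> space M))" for k
  proof -
    have "A \<inter> ((U ^^ k) -` B \<inter> space K) \<in> sets K" using AB U_sets by blast
    moreover have "\<phi> -` (A \<inter> ((U ^^ k) -` B \<inter> space K)) \<inter> space M =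
        (\<phi> -` A \<inter> space M) \<inter> ((T ^^ k) -` (\<phi> -` B \<inter> space M) \<inter> space M)"
      using vimage_funpow[of k B] by auto
    ultimately show ?thesis using measure_distr[OF \<phi>] by simp
  qed
  then show "(\<lambda>k. measure img (A \<inter> ((U ^^ k) -` B \<inter> space img))) \<longlonglongrightarrow> measure img A * measure img B"
    using mix vimage_sets[OF AB(1)] vimage_sets[OF AB(2)]
    by (simp only: measure_distr[OF \<phi> AB(1)] measure_distr[OF \<phi> AB(2)])
qed

lemma img_exact: "exact_map M T \<Longrightarrow> exact_map img U"
  unfolding exact_map_def
proof (intro ballI)
  fix A
  assume ex: "\<forall>A\<in>\<Inter>k. (\<lambda>B. (T ^^ k) -` B \<inter> space M) ` sets M. measure M A = 0 \<or> measure M A = 1"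
    and A: "A \<in> (\<Inter>k. (\<lambda>B. (U ^^ k) -` B \<inter> space img) ` sets img)"
  have tail: "\<phi> -` A \<inter> space M \<in> (\<lambda>B. (T ^^ k) -` B \<inter> space M) ` sets M" for k
  proof -
    have "A \<in> (\<lambda>B. (U ^^ k) -` B \<inter> space K) ` sets K" using A by simp
    then obtain B where "B \<in> sets K" "A = (U ^^ k) -` B \<inter> space K" by blast
    then show ?thesis using vimage_funpow[of k B] vimage_sets[of B] by blast
  qed
  have AK: "A \<in> sets K"
  proof -
    have "A \<in> (\<lambda>B. (U ^^ 0) -` B \<inter> space K) ` sets K" using A by (simp del: funpow.simps)
    then obtain B where "B \<in> sets K" "A = (U ^^ 0) -` B \<inter> space K" by blast
    then show ?thesis using U_sets[of B 0] by blast
  qed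
  have "measure M (\<phi> -` A \<inter> space M) = 0 \<or> measure M (\<phi> -` A \<inter> space M) = 1"
    by (rule bspec[OF ex]) (intro INT_I tail)
  then show "measure img A = 0 \<or> measure img A = 1"
    by (simp only: measure_distr[OF \<phi> AK])
qed

end


section \<open>Piecewise affine Markov maps\<close>

text \<open>Bounds on the slopes of a piecewise affine map become global by gluing monotone pieces
  of functions such as \<open>x - s x\<close>.\<close>

lemma mono_on_concat:
  fixes f :: "real \<Rightarrow> real" and c :: "nat \<Rightarrow> real"
  assumes c: "\<And>i. i < n \<Longrightarrow> c i < c (Suc i)" and f: "\<And>i. i < n \<Longrightarrow> mono_on {c i..c (Suc i)} f"
  shows "mono_on {c 0..c n} f"
  using assms
proof (induction n)
  case (Suc n)
  have IH: "mono_on {c 0..c n} f" using Suc by simp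
  have last: "mono_on {c n..c (Suc n)} f" using Suc by simp
  have c0n: "c 0 \<le> c n" using Suc.prems(1) by (induction n) (simp, metis less_Suc_eq less_imp_le order_trans)
  show ?case
  proof (rule mono_onI)
    fix x y assume xy: "x \<in> {c 0..c (Suc n)}" "y \<in> {c 0..c (Suc n)}" "x \<le> y"
    consider "y \<le> c n" | "x \<le> c n" "c n \<le> y" | "c n \<le> x" by linarith
    then show "f x \<le> f y"
    proof cases
      case 1
      then show ?thesis using xy by (intro mono_onD[OF IH]) auto
    next
      case 2
      have "f x \<le> f (c n)" using xy 2 c0n by (intro mono_onD[OF IH]) auto
      also have "\<dots> \<le> f y" using xy 2 Suc.prems(1)[of n] by (intro mono_onD[OF last]) auto
      finally show ?thesis .
    next
      case 3
      then show ?thesis using xy by (intro mono_onD[OF last]) auto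
    qed
  qed
qed (simp add: mono_on_def)

text \<open>Points are counted from 0, intervals and their slopes \<open>a\<close> from 1, so
  interval \<open>i\<close> runs from \<open>q (i - 1)\<close> to \<open>q i\<close>. Integrality of
  the slopes excludes moduli strictly between 0 and 1 and between 1 and 2; \<open>q_Rats\<close>
  leads to the rational density.\<close>

locale markov_map =
  fixes s :: "real \<Rightarrow> real" and q :: "nat \<Rightarrow> real" and r :: nat and a :: "nat \<Rightarrow> int"
  assumes r_pos: "0 < r" and q_0: "q 0 = 0" and q_r: "q r = 1"
    and q_less_Suc: "\<And>i. i < r \<Longrightarrow> q i < q (Suc i)"
    and q_Rats: "\<And>i. i \<le> r \<Longrightarrow> q i \<in> \<rat>"
    and s_maps: "s \<in> {0..1} \<rightarrow> {0..1}" and s_cont: "continuous_on {0..1} s"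
    and s_affine: "\<And>i x. i \<in> {1..r} \<Longrightarrow> x \<in> {q (i - 1)..q i} \<Longrightarrow>
      s x = s (q (i - 1)) + of_int (a i) * (x - q (i - 1))"
    and s_q: "\<And>i. i \<le> r \<Longrightarrow> s (q i) \<in> q ` {..r}"
begin

definition V :: "nat set" where "V = {1..r}"

definition I :: "nat \<Rightarrow> real set" where "I i = {q (i - 1)..q i}"

definition E :: "(nat \<times> nat) set" where
  "E = {(i, j). i \<in> V \<and> j \<in> V \<and> I j \<subseteq> s ` I i}"

definition len :: "nat \<Rightarrow> real" where "len i = q i - q (i - 1)"

lemma finite_V: "finite V" and V_ne: "V \<noteq> {}" using r_pos by (auto simp: V_def)

lemma q_less: "i < j \<Longrightarrow> j \<le> r \<Longrightarrow> q i < q j"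
proof (induction j)
  case (Suc j)
  then show ?case using q_less_Suc[of j] by (cases "i = j") auto
qed simp

lemma q_less_iff: "i \<le> r \<Longrightarrow> j \<le> r \<Longrightarrow> q i < q j \<longleftrightarrow> i < j"
  using q_less[of i j] q_less[of j i] by (cases i j rule: linorder_cases) auto

lemma q_le_iff: "i \<le> r \<Longrightarrow> j \<le> r \<Longrightarrow> q i \<le> q j \<longleftrightarrow> i \<le> j"
  using q_less_iff[of j i] by auto

lemma q_01: "i \<le> r \<Longrightarrow> q i \<in> {0..1}"
  using q_le_iff[of 0 i] q_le_iff[of i r] q_0 q_r by auto

lemma V_bounds: "i \<in> V \<Longrightarrow> i - 1 < i \<and> i \<le> r \<and> i - 1 \<le> r"
  by (auto simp: V_def)

lemma I_sub: "i \<in> V \<Longrightarrow> I i \<subseteq> {0..1}"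
  using q_01[of i] q_01[of "i - 1"] by (auto simp: I_def V_def)

lemma len_pos: "i \<in> V \<Longrightarrow> len i > 0"
  using q_less[of "i - 1" i] by (auto simp: V_def len_def)

lemma in_some_I: "x \<in> {0..1} \<Longrightarrow> \<exists>i\<in>V. x \<in> I i"
proof -
  assume x: "x \<in> {0..1}"
  define i where "i = (LEAST i. x \<le> q i)"
  have r: "x \<le> q r" using x q_r by simp
  then have i: "x \<le> q i" "i \<le> r" unfolding i_def by (auto intro: LeastI[of "\<lambda>i. x \<le> q i"] Least_le)
  show ?thesis
  proof (cases "i = 0")
    case True
    with i x q_0 have "x = 0" by simp
    then show ?thesis using r_pos q_0 q_less[of 0 1] by (intro bexI[of _ 1]) (auto simp: I_def V_def)
  next
    case False
    then have "\<not> x \<le> q (i - 1)" unfolding i_def by (intro not_less_Least) auto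
    with False i show ?thesis by (intro bexI[of _ i]) (auto simp: I_def V_def)
  qed
qed

lemma in_some_interior:
  assumes "x \<in> {0..1}" "x \<notin> q ` {..r}"
  shows "\<exists>i\<in>V. q (i - 1) < x \<and> x < q i"
proof -
  obtain i where i: "i \<in> V" "x \<in> I i" using in_some_I[OF assms(1)] by blast
  moreover have "x \<noteq> q i" "x \<noteq> q (i - 1)" using assms i V_bounds by auto
  ultimately show ?thesis by (intro bexI[of _ i]) (auto simp: I_def)
qed

lemma s_q_right: "i \<in> V \<Longrightarrow> s (q i) = s (q (i - 1)) + of_int (a i) * len i"
  using s_affine[of i "q i"] len_pos[of i] by (auto simp: V_def len_def)

lemma s_image_I: "i \<in> V \<Longrightarrow> s ` I i = {min (s (q (i - 1))) (s (q i))..max (s (q (i - 1))) (s (q i))}"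
proof -
  assume i: "i \<in> V"
  have "s ` I i = (\<lambda>x. of_int (a i) * x + (s (q (i - 1)) - of_int (a i) * q (i - 1))) ` {q (i - 1)..q i}"
    unfolding I_def
  proof (rule image_cong[OF refl])
    fix x assume "x \<in> {q (i - 1)..q i}"
    then show "s x = of_int (a i) * x + (s (q (i - 1)) - of_int (a i) * q (i - 1))"
      using i s_affine[of i x] by (simp add: V_def algebra_simps)
  qed
  also have "\<dots> = {min (s (q (i - 1))) (s (q i))..max (s (q (i - 1))) (s (q i))}"
  proof -
    let ?c = "s (q (i - 1)) - of_int (a i) * q (i - 1)"
    have lr: "of_int (a i) * q (i - 1) + ?c = s (q (i - 1))" "of_int (a i) * q i + ?c = s (q i)"
      using s_q_right[OF i] by (auto simp: len_def algebra_simps)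
    have ne: "{q (i - 1)..q i} \<noteq> {}" using len_pos[OF i] by (simp add: len_def)
    show ?thesis
    proof (cases "a i \<ge> 0")
      case True
      then have "s (q (i - 1)) \<le> s (q i)" using s_q_right[OF i] len_pos[OF i] by simp
      then show ?thesis using True ne unfolding image_affinity_atLeastAtMost lr by (simp add: min_def max_def)
    next
      case False
      then have "s (q i) \<le> s (q (i - 1))"
        using s_q_right[OF i] len_pos[OF i] by (simp add: mult_le_0_iff)
      then show ?thesis using False ne unfolding image_affinity_atLeastAtMost lr by (simp add: min_absorb2 max_absorb1)
    qed
  qed
  finally show ?thesis .
qed

lemma edge_iff:
  assumes "i \<in> V" "j \<in> V"
  shows "(i, j) \<in> E \<longleftrightarrow> min (s (q (i - 1))) (s (q i)) \<le> q (j - 1) \<and> q j \<le> max (s (q (i - 1))) (s (q i))"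
proof -
  have "q (j - 1) \<le> q j" using len_pos[OF assms(2)] by (simp add: len_def)
  then have "I j \<subseteq> {c..d} \<longleftrightarrow> c \<le> q (j - 1) \<and> q j \<le> d" for c d by (simp add: I_def)
  then show ?thesis using assms by (simp add: E_def s_image_I)
qed

text \<open>The image of a Markov interval ends at Markov points, hence never inside another
  interval: to touch the interior is to cover it.\<close>

lemma edge_of_interior_point:
  assumes i: "i \<in> V" and j: "j \<in> V" and x: "x \<in> I i" and sx: "q (j - 1) < s x" "s x < q j"
  shows "(i, j) \<in> E"
proof -
  obtain k l where kl: "k \<le> r" "l \<le> r" "s (q (i - 1)) = q k" "s (q i) = q l"
    using s_q[of i] s_q[of "i - 1"] V_bounds[OF i] by auto
  have "s x \<in> {min (q k) (q l)..max (q k) (q l)}"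
    using s_image_I[OF i] x kl by (metis imageI)
  moreover have q_mm: "q (min k l) = min (q k) (q l)" "q (max k l) = max (q k) (q l)"
    using q_le_iff[of k l] kl by (auto simp: min_def max_def)
  ultimately have "q (min k l) < q j" "q (j - 1) < q (max k l)"
    using sx by auto
  then have "min k l < j" "j - 1 < max k l"
    using q_less_iff[of "min k l" j] q_less_iff[of "j - 1" "max k l"] kl V_bounds[OF j] by auto
  then have "min k l \<le> j - 1" "j \<le> max k l" by auto
  then have "q (min k l) \<le> q (j - 1)" "q j \<le> q (max k l)"
    using q_le_iff[of "min k l" "j - 1"] q_le_iff[of j "max k l"] kl V_bounds[OF j] by auto
  then show ?thesis using edge_iff[OF i j] kl q_mm by simp
qed

text \<open>The targets of \<open>i\<close> are the consecutive intervals between the two end points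
  of the image, so the sum telescopes; the sign records the orientation. With \<open>G\<close> the
  identity it counts lengths, with \<open>G = cum B\<close> the parts of \<open>B\<close>.\<close>

lemma sum_over_edges:
  fixes G :: "real \<Rightarrow> real"
  assumes i: "i \<in> V"
  shows "(\<Sum>j\<in>V. if (i, j) \<in> E then G (q j) - G (q (j - 1)) else 0)
    = sgn (of_int (a i)) * (G (s (q i)) - G (s (q (i - 1))))"
proof -
  obtain k l where kl: "k \<le> r" "l \<le> r" "s (q (i - 1)) = q k" "s (q i) = q l"
    using s_q[of i] s_q[of "i - 1"] V_bounds[OF i] by auto
  have tele: "(\<Sum>j\<in>{Suc m..n}. G (q j) - G (q (j - 1))) = G (q n) - G (q m)" if "m \<le> n" for m n
    using that by (induction n rule: dec_induct) auto
  \<comment> \<open>Interval \<open>j\<close> runs from point \<open>j - 1\<close> to point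
    \<open>j\<close>, hence the \<open>Suc\<close> at the lower end only.\<close>
  have "{j \<in> V. (i, j) \<in> E} = {Suc (min k l)..max k l}"
  proof -
    have "q (min k l) = min (q k) (q l)" "q (max k l) = max (q k) (q l)"
      using q_le_iff[of k l] kl by (auto simp: min_def max_def)
    then have "(i, j) \<in> E \<longleftrightarrow> min k l \<le> j - 1 \<and> j \<le> max k l" if "j \<in> V" for j
      using edge_iff[OF i that] kl V_bounds[OF that]
        q_le_iff[of "min k l" "j - 1"] q_le_iff[of j "max k l"] by auto
    moreover have "j \<in> V \<and> min k l \<le> j - 1 \<and> j \<le> max k l \<longleftrightarrow> j \<in> {Suc (min k l)..max k l}" for j
      using kl by (auto simp: V_def)
    ultimately show ?thesis by blast
  qed
  then have "(\<Sum>j\<in>V. if (i, j) \<in> E then G (q j) - G (q (j - 1)) else 0) = G (q (max k l)) - G (q (min k l))"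
    using finite_V tele[of "min k l" "max k l"] by (simp add: sum.If_cases Int_def)
  also have "\<dots> = sgn (of_int (a i)) * (G (q l) - G (q k))"
  proof -
    have *: "q l = q k + of_int (a i) * len i" using s_q_right[OF i] kl by simp
    consider "a i > 0" | "a i = 0" | "a i < 0" by linarith
    then show ?thesis
    proof cases
      case 1
      then have "q k < q l" using * len_pos[OF i] by simp
      then have "k < l" using q_less_iff kl by simp
      then show ?thesis using 1 by (simp add: max_def min_def)
    next
      case 2
      then have "q k = q l" using * by simp
      then have "k = l" using q_less_iff[of k l] q_less_iff[of l k] kl(1,2) by (cases k l rule: linorder_cases) auto
      then show ?thesis using 2 by simp
    next
      case 3
      then have "q l < q k" using * len_pos[OF i] by (simp add: mult_neg_pos)
      then have "l < k" using q_less_iff kl by simp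
      then show ?thesis using 3 by (simp add: max_def min_def)
    qed
  qed
  finally show ?thesis using kl by simp
qed

lemma sum_len_edges:
  assumes i: "i \<in> V"
  shows "(\<Sum>j\<in>V. if (i, j) \<in> E then len j else 0) = \<bar>of_int (a i)\<bar> * len i"
proof -
  have "s (q i) - s (q (i - 1)) = of_int (a i) * len i" using s_q_right[OF i] by simp
  then have "(\<Sum>j\<in>V. if (i, j) \<in> E then len j else 0) = sgn (of_int (a i)) * (of_int (a i) * len i)"
    using sum_over_edges[OF i, of "\<lambda>x. x"] by (simp only: len_def)
  then show ?thesis by (simp only: abs_sgn ac_simps)
qed

end

text \<open>The two exclusions express, by \<open>mv_aut_iff\<close>, that the substitution is not
  invertible; stated for the map, they keep the dynamics free of algebra.\<close>

locale expanding_markov_map = markov_map +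
  assumes conn: "strongly_connected_graph V E"
    and not_id: "\<not> (\<forall>x\<in>{0..1}. s x = x)" and not_flip: "\<not> (\<forall>x\<in>{0..1}. s x = 1 - x)"
begin

lemma edge_path: "i \<in> V \<Longrightarrow> j \<in> V \<Longrightarrow> (i, j) \<in> E\<^sup>+"
  using conn by (auto simp: strongly_connected_graph_def)

lemma out_edge: "i \<in> V \<Longrightarrow> \<exists>j\<in>V. (i, j) \<in> E"
proof -
  assume "i \<in> V"
  then obtain j where "(i, j) \<in> E" using edge_path[of i i] by (meson tranclD)
  then show ?thesis by (auto simp: E_def)
qed

lemma in_edge: "j \<in> V \<Longrightarrow> \<exists>i\<in>V. (i, j) \<in> E"
proof -
  assume "j \<in> V"
  then obtain i where "(i, j) \<in> E" using edge_path[of j j] by (meson tranclD2)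
  then show ?thesis by (auto simp: E_def)
qed

text \<open>A constant piece has no outgoing edge, whereas connectedness by paths of positive length
  gives each vertex one, even in a graph with a single vertex.\<close>

lemma slope_nonzero: "i \<in> V \<Longrightarrow> a i \<noteq> 0"
proof
  assume i: "i \<in> V" "a i = 0"
  obtain j where j: "j \<in> V" "(i, j) \<in> E" using out_edge i by blast
  have "q j \<le> q (j - 1)" using edge_iff[OF i(1) j(1)] j(2) s_q_right[OF i(1)] i(2) by simp
  with len_pos[OF j(1)] show False by (simp add: len_def)
qed

lemma slope_ge_1: "i \<in> V \<Longrightarrow> \<bar>a i\<bar> \<ge> 1"
  using slope_nonzero by force

text \<open>If all slopes were \<open>\<plusminus> 1\<close>, then \<open>s\<close> would be a 1-Lipschitz surjection of the unit interval, hence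
  the identity or the reflection.\<close>

lemma ex_expanding: "\<exists>i\<in>V. \<bar>a i\<bar> \<ge> 2"
proof (rule ccontr)
  assume "\<not> ?thesis"
  then have "\<bar>a i\<bar> \<le> 1" if "i \<in> V" for i using that by force
  then have a1: "-1 \<le> real_of_int (a i)" "real_of_int (a i) \<le> 1" if "i \<in> V" for i
    using that by (force simp: abs_le_iff)+
  \<comment> \<open>Monotonicity of both \<open>x - s x\<close> and \<open>x + s x\<close> is the
    Lipschitz bound with constant 1.\<close>
  have piece: "mono_on {q i..q (Suc i)} (\<lambda>x. x - s x)" "mono_on {q i..q (Suc i)} (\<lambda>x. x + s x)" if "i < r" for i
  proof -
    have i: "Suc i \<in> V" using that by (auto simp: V_def)
    have *: "s x = s (q i) + of_int (a (Suc i)) * (x - q i)" if "x \<in> {q i..q (Suc i)}" for x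
      using s_affine[of "Suc i" x] that i by (auto simp: V_def)
    have **: "of_int (a (Suc i)) * (x - y) \<le> x - y" "- (x - y) \<le> of_int (a (Suc i)) * (x - y)"
      if "y \<le> x" for x y :: real
      using mult_right_mono[OF a1(1)[OF i], of "x - y"] mult_right_mono[OF a1(2)[OF i], of "x - y"] that by auto
    have diff: "s y - s x = of_int (a (Suc i)) * (y - x)"
      if "x \<in> {q i..q (Suc i)}" "y \<in> {q i..q (Suc i)}" for x y
      unfolding *[OF that(1)] *[OF that(2)] by (simp add: algebra_simps)
    show "mono_on {q i..q (Suc i)} (\<lambda>x. x - s x)"
    proof (rule mono_onI)
      fix x y assume "x \<in> {q i..q (Suc i)}" "y \<in> {q i..q (Suc i)}" "x \<le> y"
      then show "x - s x \<le> y - s y" using diff[of x y] **(1)[of x y] by linarith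
    qed
    show "mono_on {q i..q (Suc i)} (\<lambda>x. x + s x)"
    proof (rule mono_onI)
      fix x y assume "x \<in> {q i..q (Suc i)}" "y \<in> {q i..q (Suc i)}" "x \<le> y"
      then show "x + s x \<le> y + s y" using diff[of x y] **(2)[of x y] by linarith
    qed
  qed
  have "mono_on {q 0..q r} (\<lambda>x. x - s x)" "mono_on {q 0..q r} (\<lambda>x. x + s x)"
    using piece q_less_Suc by (auto intro!: mono_on_concat)
  then have lip: "\<bar>s y - s x\<bar> \<le> y - x" if "0 \<le> x" "x \<le> y" "y \<le> 1" for x y
  proof -
    have "x \<in> {q 0..q r}" "y \<in> {q 0..q r}" using that q_0 q_r by auto
    then have "x - s x \<le> y - s y" "x + s x \<le> y + s y"
      using \<open>mono_on {q 0..q r} (\<lambda>x. x - s x)\<close> \<open>mono_on {q 0..q r} (\<lambda>x. x + s x)\<close> that(2)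
      by (auto simp: mono_on_def)
    then show ?thesis by linarith
  qed
  have onto: "\<exists>x\<in>{0..1}. s x = y" if y: "y \<in> {0..1}" for y
  proof -
    obtain j where j: "j \<in> V" "y \<in> I j" using in_some_I[OF y] by blast
    obtain i where i: "i \<in> V" "(i, j) \<in> E" using in_edge[OF j(1)] by blast
    then have "y \<in> s ` I i" using j by (auto simp: E_def)
    then show ?thesis using I_sub[OF i(1)] by auto
  qed
  \<comment> \<open>A map with Lipschitz constant 1 can take the values 0 and 1 only at the two end
    points; the bounds from both ends then pin down every value.\<close>
  obtain x y where xy: "x \<in> {0..1}" "s x = 0" "y \<in> {0..1}" "s y = 1"
    using onto[of 0] onto[of 1] by auto
  have b: "s v \<in> {0..1}" if "v \<in> {0..1}" for v using s_maps that by auto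
  show False
  proof (cases "x \<le> y")
    case True
    then have "x = 0" "y = 1" using lip[of x y] xy by auto
    then have "s v = v" if "v \<in> {0..1}" for v
      using lip[of 0 v] lip[of v 1] xy that b[OF that] by auto
    then show False using not_id by blast
  next
    case False
    then have "x = 1" "y = 0" using lip[of y x] xy by auto
    then have "s v = 1 - v" if "v \<in> {0..1}" for v
      using lip[of 0 v] lip[of v 1] xy that b[OF that] by auto
    then show False using not_flip by blast
  qed
qed

text \<open>The targets of \<open>i\<close> have total length
  \<open>\<bar>of_int (a i)\<bar> * len i\<close>. A single target is no longer than this, and one
  that exhausts it leaves no room for another, lengths being positive.\<close>

lemma len_edge: "(i, j) \<in> E \<Longrightarrow> len j \<le> \<bar>of_int (a i)\<bar> * len i"
  and unique_edge: "(i, j) \<in> E \<Longrightarrow> (i, k) \<in> E \<Longrightarrow> len j = \<bar>of_int (a i)\<bar> * len i \<Longrightarrow> k = j"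
proof -
  assume ij: "(i, j) \<in> E"
  then have V: "i \<in> V" "j \<in> V" by (auto simp: E_def)
  let ?g = "\<lambda>j. if (i, j) \<in> E then len j else 0"
  have g0: "?g k \<ge> 0" if "k \<in> V" for k using len_pos[OF that] by simp
  have "?g j \<le> (\<Sum>j\<in>V. ?g j)"
    by (rule member_le_sum) (use V g0 finite_V in auto)
  then show "len j \<le> \<bar>of_int (a i)\<bar> * len i" using sum_len_edges[OF V(1)] ij by simp
  assume ik: "(i, k) \<in> E" and eq: "len j = \<bar>of_int (a i)\<bar> * len i"
  then have k: "k \<in> V" by (auto simp: E_def)
  show "k = j"
  proof (rule ccontr)
    assume "k \<noteq> j"
    then have "?g j + ?g k = (\<Sum>l\<in>{j, k}. ?g l)" by simp
    also have "\<dots> \<le> (\<Sum>l\<in>V. ?g l)"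
      by (rule sum_mono2) (use V k g0 finite_V in auto)
    finally show False using sum_len_edges[OF V(1)] ij ik eq len_pos[OF k] by simp
  qed
qed

text \<open>Along a path of non-expanding intervals lengths do not increase, so that a closed one has no exit;
  by connectedness it would contain all vertices.\<close>

lemma path_hits_expanding:
  assumes path: "\<And>k. k < r \<Longrightarrow> (p k, p (Suc k)) \<in> E"
  shows "\<exists>k<r. \<bar>a (p k)\<bar> \<ge> 2"
proof (rule ccontr)
  assume neg: "\<not> ?thesis"
  have pV: "p k \<in> V" if "k \<le> r" for k
  proof (cases k)
    case 0
    then show ?thesis using path[of 0] r_pos by (auto simp: E_def)
  next
    case (Suc m)
    then show ?thesis using path[of m] that by (auto simp: E_def)
  qed
  have a1: "\<bar>a (p k)\<bar> = 1" if "k < r" for k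
    using neg that slope_ge_1[OF pV, of k] by force
  have ra1: "\<bar>real_of_int (a (p k))\<bar> = 1" if "k < r" for k
    using a1[OF that] by linarith
  have dec: "len (p (Suc k)) \<le> len (p k)" if "k < r" for k
    using len_edge[OF path[OF that]] ra1[OF that] by simp
  \<comment> \<open>A path with \<open>r\<close> edges visits \<open>r + 1\<close> vertices out of
    \<open>r\<close>, so some vertex is repeated.\<close>
  have "\<not> inj_on p {..r}"
  proof
    assume "inj_on p {..r}"
    then have "card {..r} \<le> card V" using pV finite_V by (intro card_inj_on_le) auto
    then show False by (simp add: V_def)
  qed
  then obtain x y where xy: "x < y" "y \<le> r" "p x = p y"
    unfolding inj_on_def by (metis atMost_iff linorder_neqE_nat)
  have dec': "len (p n) \<le> len (p m)" if "m \<le> n" "n \<le> r" for m n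
    using that
  proof (induction n rule: dec_induct)
    case (step n)
    then show ?case using dec[of n] by simp
  qed simp
  \<comment> \<open>Lengths cannot increase and are back at their initial value at time
    \<open>y\<close>, so they are constant on the cycle. By \<open>unique_edge\<close> the only way
    out of a vertex of the cycle is its successor there.\<close>
  have step: "\<exists>k. x \<le> k \<and> k < y \<and> p k = j" if k: "x \<le> k" "k < y" and j: "(p k, j) \<in> E" for k j
  proof -
    have "len (p (Suc k)) = len (p k)"
      using dec'[of "Suc k" y] dec'[of x k] dec'[of k "Suc k"] k xy by auto
    then have "j = p (Suc k)"
      using unique_edge[OF path j] ra1[of k] k xy by auto
    then show ?thesis using k xy by (cases "Suc k = y") (auto intro: exI[of _ x] exI[of _ "Suc k"])
  qed
  have "\<exists>k. x \<le> k \<and> k < y \<and> p k = j" if "j \<in> V" for j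
  proof -
    have "(p x, j) \<in> E\<^sup>+" using edge_path pV[of x] that xy by auto
    then show ?thesis
    proof (induction rule: trancl_induct)
      case (base j)
      then show ?case using step[of x j] xy by auto
    next
      case (step j l)
      then show ?case using \<open>\<And>k j. x \<le> k \<Longrightarrow> k < y \<Longrightarrow> (p k, j) \<in> E \<Longrightarrow> \<exists>k. x \<le> k \<and> k < y \<and> p k = j\<close> by blast
    qed
  qed
  then have "\<bar>a j\<bar> = 1" if "j \<in> V" for j using a1 that xy by (metis less_le_trans)
  then show False using ex_expanding by force
qed

end


section \<open>Contraction of deviations\<close>

lemma measure_lborel_affine_vimage:
  assumes c: "(c::real) \<noteq> 0" and A: "A \<in> sets borel"
  shows "measure lborel A = \<bar>c\<bar> * measure lborel ((\<lambda>x. t + c * x) -` A)"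
proof -
  have "emeasure lborel A = ennreal \<bar>c\<bar> * emeasure lborel ((\<lambda>x. t + c * x) -` A)"
    using A by (subst lborel_real_affine[OF c, of t]) (simp add: emeasure_density_const emeasure_distr)
  then show ?thesis by (simp add: measure_def enn2real_mult)
qed

lemma fmeasurable_interval_Int: "B \<in> sets borel \<Longrightarrow> {u..v::real} \<inter> B \<in> fmeasurable lborel"
  by (rule fmeasurableI2[of "{u..v}"]) (auto simp: fmeasurable_def emeasure_lborel_Icc_eq)

lemma measure_lborel_interval_split:
  assumes "B \<in> sets borel" "u \<le> v" "v \<le> (w::real)"
  shows "measure lborel ({u..w} \<inter> B) = measure lborel ({u..v} \<inter> B) + measure lborel ({v..w} \<inter> B)"
proof -
  have "{u..w} \<inter> B = ({u..v} \<inter> B) \<union> ({v..w} \<inter> B)" using assms by auto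
  moreover have "AE x in lborel. x \<notin> {u..v} \<inter> B \<or> x \<notin> {v..w} \<inter> B"
    using AE_lborel_singleton[of v] by eventually_elim auto
  ultimately show ?thesis using assms(1) by (simp add: measure_Un_AE fmeasurable_interval_Int)
qed

text \<open>The distribution function of Lebesgue measure on \<open>B\<close>. It reduces sets to
  numbers: on an affine branch a preimage only rescales the increments, and the intervals
  \<open>{0..v}\<close> determine a measure.\<close>

definition cum :: "real set \<Rightarrow> real \<Rightarrow> real" where
  "cum B v = measure lborel ({0..v} \<inter> B)"

lemma cum_diff:
  assumes "B \<in> sets borel" "0 \<le> u" "u \<le> v"
  shows "cum B v - cum B u = measure lborel ({u..v} \<inter> B)"
  using measure_lborel_interval_split[OF assms(1), of 0 u v] assms by (simp add: cum_def)

lemma cum_0 [simp]: "cum B 0 = 0"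
proof -
  have "{0..0} \<inter> B = {} \<or> {0..0::real} \<inter> B = {0}" by auto
  then show ?thesis unfolding cum_def by (elim disjE) (simp_all only: measure_empty, simp)
qed

lemma cum_nonneg: "cum B v \<ge> 0" by (simp add: cum_def)

lemma cum_le: "B \<in> sets borel \<Longrightarrow> 0 \<le> v \<Longrightarrow> cum B v \<le> v"
  using measure_mono_fmeasurable[of "{0..v} \<inter> B" "{0..v}" lborel] by (auto simp: cum_def fmeasurable_def)

context markov_map
begin

definition preim :: "real set \<Rightarrow> real set" where "preim B = s -` B \<inter> {0..1}"

lemma borel_preim: "B \<in> sets borel \<Longrightarrow> preim B \<in> sets borel"
proof -
  assume B: "B \<in> sets borel"
  have "s \<in> borel_measurable (restrict_space borel {0..1})"
    using s_cont by (rule borel_measurable_continuous_on_restrict)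
  from measurable_sets[OF this B] show ?thesis
    by (simp add: preim_def space_restrict_space sets_restrict_space_iff)
qed

lemma borel_preim_funpow: "B \<in> sets borel \<Longrightarrow> (preim ^^ n) B \<in> sets borel"
  by (induction n) (auto intro: borel_preim)

text \<open>For \<open>n = 0\<close> nothing is intersected with the unit interval, hence the
  inclusion.\<close>

lemma preim_funpow: "B \<subseteq> {0..1} \<Longrightarrow> (preim ^^ n) B = (s ^^ n) -` B \<inter> {0..1}"
proof (induction n)
  case (Suc n)
  then show ?case using s_maps by (auto simp: preim_def funpow_swap1)
qed auto

lemma s_in_01: "x \<in> {0..1} \<Longrightarrow> s x \<in> {0..1}" using s_maps by auto

text \<open>Change of variables on one affine branch. Signed increments make the formula insensitive
  to the order of \<open>u\<close> and \<open>v\<close> and to the orientation: a negative slope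
  swaps the images and changes the sign.\<close>

lemma cum_preim:
  assumes B: "B \<in> sets borel" and i: "i \<in> V" and uv: "u \<in> I i" "v \<in> I i" and a: "a i \<noteq> 0"
  shows "cum (preim B) v - cum (preim B) u = (cum B (s v) - cum B (s u)) / of_int (a i)"
proof -
  have main: "cum (preim B) v - cum (preim B) u = (cum B (s v) - cum B (s u)) / of_int (a i)"
    if uv: "u \<in> I i" "v \<in> I i" "u \<le> v" for u v
  proof -
    define t where "t = s (q (i - 1)) - of_int (a i) * q (i - 1)"
    let ?c = "real_of_int (a i)"
    have sx: "s x = t + ?c * x" if "x \<in> I i" for x
      using s_affine[of i x] that i by (simp add: V_def I_def t_def algebra_simps)
    have uv': "x \<in> I i" if "x \<in> {u..v}" for x using uv that by (auto simp: I_def)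
    have uv01: "0 \<le> u" "v \<le> 1" using uv I_sub[OF i] by auto
    have "0 \<le> s u" "0 \<le> s v" using s_in_01[of u] s_in_01[of v] uv uv01 by auto
    have "{u..v} \<inter> preim B = (\<lambda>x. t + ?c * x) -` ({min (s u) (s v)..max (s u) (s v)} \<inter> B)"
    proof (rule set_eqI)
      fix x
      have "x \<in> {u..v} \<longleftrightarrow> t + ?c * x \<in> {min (s u) (s v)..max (s u) (s v)}"
      proof (cases "a i > 0")
        case True
        then have "s u \<le> s v" using sx uv by simp
        then show ?thesis using True sx uv by (simp add: min_def max_def)
      next
        case False
        then have *: "?c < 0" using a by simp
        then have "s v \<le> s u" using sx uv by simp
        then show ?thesis using * sx[OF uv(1)] sx[OF uv(2)] by (auto simp: min_absorb2 max_absorb1)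
      qed
      moreover have "x \<in> preim B \<longleftrightarrow> t + ?c * x \<in> B" if "x \<in> {u..v}"
        using sx[OF uv'[OF that]] that uv01 by (auto simp: preim_def)
      ultimately show "x \<in> {u..v} \<inter> preim B \<longleftrightarrow>
          x \<in> (\<lambda>x. t + ?c * x) -` ({min (s u) (s v)..max (s u) (s v)} \<inter> B)" by auto
    qed
    then have "measure lborel ({min (s u) (s v)..max (s u) (s v)} \<inter> B) = \<bar>?c\<bar> * measure lborel ({u..v} \<inter> preim B)"
      using measure_lborel_affine_vimage[of ?c "{min (s u) (s v)..max (s u) (s v)} \<inter> B" t] a B by simp
    also have "measure lborel ({u..v} \<inter> preim B) = cum (preim B) v - cum (preim B) u"
      using cum_diff[OF borel_preim[OF B]] uv uv01 by simp
    finally have eq: "measure lborel ({min (s u) (s v)..max (s u) (s v)} \<inter> B)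
        = \<bar>?c\<bar> * (cum (preim B) v - cum (preim B) u)" .
    show ?thesis
    proof (cases "a i > 0")
      case True
      then have "s u \<le> s v" using sx uv by simp
      then show ?thesis using eq cum_diff[OF B \<open>0 \<le> s u\<close>, of "s v"] True
        by (simp add: min_def max_def field_simps)
    next
      case False
      then have *: "?c < 0" using a by simp
      then have "s v \<le> s u" using sx uv by simp
      then show ?thesis using eq cum_diff[OF B \<open>0 \<le> s v\<close>, of "s u"] *
        by (simp add: min_absorb2 max_absorb1 field_simps)
    qed
  qed
  show ?thesis
  proof (cases "u \<le> v")
    case False
    then have "cum (preim B) u - cum (preim B) v = (cum B (s u) - cum B (s v)) / of_int (a i)"
      using main[of v u] uv by simp
    then show ?thesis by (simp add: diff_divide_distrib)
  qed (use main uv in simp)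
qed

definition mass :: "real set \<Rightarrow> nat \<Rightarrow> real" where
  "mass B i = cum B (q i) - cum B (q (i - 1))"

lemma mass_eq: "B \<in> sets borel \<Longrightarrow> i \<in> V \<Longrightarrow> mass B i = measure lborel (I i \<inter> B)"
  using cum_diff[of B "q (i - 1)" "q i"] q_01[of "i - 1"] V_bounds[of i] len_pos[of i]
  by (simp add: mass_def I_def len_def)

lemma mass_preim:
  assumes B: "B \<in> sets borel" and i: "i \<in> V" and a: "a i \<noteq> 0"
  shows "mass (preim B) i = (\<Sum>j\<in>V. if (i, j) \<in> E then mass B j else 0) / \<bar>of_int (a i)\<bar>"
proof -
  have "q (i - 1) \<in> I i" "q i \<in> I i" using len_pos[OF i] by (auto simp: I_def len_def)
  from cum_preim[OF B i this a] have "mass (preim B) i = (cum B (s (q i)) - cum B (s (q (i - 1)))) / of_int (a i)"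
    by (simp add: mass_def)
  moreover have "(\<Sum>j\<in>V. if (i, j) \<in> E then mass B j else 0)
      = sgn (of_int (a i)) * (cum B (s (q i)) - cum B (s (q (i - 1))))"
    using sum_over_edges[OF i, of "cum B"] by (simp only: mass_def)
  moreover have "x / of_int (a i) = sgn (of_int (a i)) * x / \<bar>of_int (a i)\<bar>" for x :: real
    using a by (auto simp: sgn_if)
  ultimately show ?thesis by (simp only:)
qed

lemma sum_mass_upto: "k \<le> r \<Longrightarrow> (\<Sum>i\<in>{1..k}. mass B i) = cum B (q k)"
  by (induction k) (auto simp: mass_def q_0)

lemma sum_len_upto: "k \<le> r \<Longrightarrow> (\<Sum>i\<in>{1..k}. len i) = q k"
  by (induction k) (auto simp: len_def q_0)

end

context expanding_markov_map
begin

text \<open>An orbit segment of \<open>r + 1\<close> points either meets the Markov points, where \<open>H\<close> is small, and stays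
  among them, or it meets an expanding interval, which halves \<open>H\<close>.\<close>

lemma contraction_step:
  fixes H :: "nat \<Rightarrow> real \<Rightarrow> real"
  assumes bound: "\<And>v. v \<in> {0..1} \<Longrightarrow> \<bar>H n v\<bar> \<le> C" and C: "0 \<le> C"
    and small: "\<And>m i. m \<ge> n \<Longrightarrow> i \<le> r \<Longrightarrow> \<bar>H m (q i)\<bar> \<le> \<epsilon>"
    and rec: "\<And>m i v. m \<ge> n \<Longrightarrow> i \<in> V \<Longrightarrow> v \<in> I i \<Longrightarrow>
      H (Suc m) v - H (Suc m) (q (i - 1)) = (H m (s v) - H m (s (q (i - 1)))) / of_int (a i)"
    and v: "v \<in> {0..1}"
  shows "\<bar>H (n + (r + 1)) v\<bar> \<le> C / 2 + (2 * real r + 3) * \<epsilon>"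
proof -
  \<comment> \<open>A Markov point may lie in two intervals; either choice will do, since
    \<open>rec\<close> holds on closed intervals.\<close>
  define idx where "idx x = (SOME i. i \<in> V \<and> x \<in> I i)" for x
  have idx: "idx x \<in> V" "x \<in> I (idx x)" if "x \<in> {0..1}" for x
    using someI_ex[of "\<lambda>i. i \<in> V \<and> x \<in> I i"] in_some_I[OF that] by (auto simp: idx_def)
  define w where "w x = 1 / \<bar>real_of_int (a (idx x))\<bar>" for x
  have w: "0 \<le> w x" "w x \<le> 1" if "x \<in> {0..1}" for x
    using slope_ge_1[OF idx(1)[OF that]] by (auto simp: w_def divide_le_eq)
  have \<epsilon>: "0 \<le> \<epsilon>" using small[of n 0] by fastforce
  have orb: "(s ^^ k) x \<in> {0..1}" if "x \<in> {0..1}" for k x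
    using that s_in_01 by (induction k) auto
  \<comment> \<open>The recursion is anchored at the left end point of the interval. This point and
    its image are Markov points, and each contributes at most \<open>\<epsilon>\<close>.\<close>
  have one: "\<bar>H (Suc m) x\<bar> \<le> w x * \<bar>H m (s x)\<bar> + 2 * \<epsilon>" if m: "m \<ge> n" and x: "x \<in> {0..1}" for m x
  proof -
    let ?i = "idx x"
    obtain l where l: "l \<le> r" "s (q (?i - 1)) = q l"
      using s_q[of "?i - 1"] V_bounds[OF idx(1)[OF x]] by auto
    have "H (Suc m) x = H (Suc m) (q (?i - 1)) + (H m (s x) - H m (q l)) / of_int (a ?i)"
      using rec[OF m idx[OF x]] l by simp
    then have "\<bar>H (Suc m) x\<bar> \<le> \<bar>H (Suc m) (q (?i - 1))\<bar> + \<bar>(H m (s x) - H m (q l)) / of_int (a ?i)\<bar>"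
      by linarith
    also have "\<bar>(H m (s x) - H m (q l)) / of_int (a ?i)\<bar> = w x * \<bar>H m (s x) - H m (q l)\<bar>"
      by (simp add: w_def)
    also have "\<dots> \<le> w x * (\<bar>H m (s x)\<bar> + \<bar>H m (q l)\<bar>)"
      using w[OF x] by (intro mult_left_mono) auto
    also have "\<dots> \<le> w x * \<bar>H m (s x)\<bar> + \<epsilon>"
      using w[OF x] small[OF m l(1)] mult_mono[of "w x" 1 "\<bar>H m (q l)\<bar>" \<epsilon>] by (simp add: distrib_left)
    also have "\<bar>H (Suc m) (q (?i - 1))\<bar> \<le> \<epsilon>"
      using small[of "Suc m" "?i - 1"] m V_bounds[OF idx(1)[OF x]] by simp
    finally show ?thesis by simp
  qed
  have many: "\<bar>H (n + k) x\<bar> \<le> (\<Prod>j<k. w ((s ^^ j) x)) * \<bar>H n ((s ^^ k) x)\<bar> + 2 * real k * \<epsilon>"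
    if x: "x \<in> {0..1}" for k x
    using x
  proof (induction k arbitrary: x)
    case (Suc k)
    let ?P = "\<Prod>j<k. w ((s ^^ j) (s x))"
    have "\<bar>H (n + Suc k) x\<bar> \<le> w x * \<bar>H (n + k) (s x)\<bar> + 2 * \<epsilon>" using one[of "n + k" x] Suc.prems by simp
    also have "w x * \<bar>H (n + k) (s x)\<bar> \<le> w x * (?P * \<bar>H n ((s ^^ k) (s x))\<bar> + 2 * real k * \<epsilon>)"
      using Suc.IH[OF s_in_01[OF Suc.prems]] w[OF Suc.prems] by (intro mult_left_mono)
    also have "\<dots> \<le> w x * ?P * \<bar>H n ((s ^^ k) (s x))\<bar> + 2 * real k * \<epsilon>"
      using w[OF Suc.prems] \<epsilon> mult_right_mono[of "w x" 1 "2 * real k * \<epsilon>"] by (simp add: distrib_left mult.assoc)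
    also have "w x * ?P = (\<Prod>j<Suc k. w ((s ^^ j) x))"
      by (simp add: prod.lessThan_Suc_shift funpow_swap1 del: prod.lessThan_Suc)
    finally show ?case by (simp add: funpow_swap1 algebra_simps)
  qed simp
  have prod01: "0 \<le> (\<Prod>j\<in>J. w ((s ^^ j) v)) \<and> (\<Prod>j\<in>J. w ((s ^^ j) v)) \<le> 1" for J
    using w[OF orb[OF v]] by (auto intro: prod_nonneg prod_le_1)
  let ?P = "\<Prod>j<r + 1. w ((s ^^ j) v)" and ?h = "\<bar>H n ((s ^^ (r + 1)) v)\<bar>"
  \<comment> \<open>The two cases below give \<open>\<epsilon>\<close> and \<open>C / 2\<close>.
    Together with the error of \<open>many\<close> after \<open>r + 1\<close> steps this adds up to
    the factor \<open>2 * r + 3\<close>.\<close>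
  have "?P * ?h \<le> C / 2 + \<epsilon>"
  proof (cases "\<exists>j\<le>r. (s ^^ j) v \<in> q ` {..r}")
    case True
    then obtain j where j: "j \<le> r" "(s ^^ j) v \<in> q ` {..r}" by blast
    have stay: "(s ^^ k) x \<in> q ` {..r}" if "x \<in> q ` {..r}" for k x
      using that s_q by (induction k) auto
    have "(s ^^ (r + 1)) v = (s ^^ (r + 1 - j)) ((s ^^ j) v)"
      using j by (metis add.commute comp_apply funpow_add le_SucI Suc_eq_plus1 le_add_diff_inverse)
    then have "(s ^^ (r + 1)) v \<in> q ` {..r}" using stay[OF j(2)] by simp
    then have "?h \<le> \<epsilon>" using small[of n] by auto
    then have "?P * ?h \<le> 1 * \<epsilon>" using prod01[of "{..<r + 1}"] by (intro mult_mono) auto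
    then show ?thesis using C by simp
  next
    case False
    have "(idx ((s ^^ k) v), idx ((s ^^ Suc k) v)) \<in> E" if k: "k < r" for k
    proof -
      have x: "(s ^^ k) v \<in> {0..1}" "(s ^^ Suc k) v \<in> {0..1}" using orb[OF v] by blast+
      have "(s ^^ Suc k) v \<notin> q ` {..r}" using False k by (meson Suc_leI)
      then have ne: "q i \<noteq> (s ^^ Suc k) v" if "i \<le> r" for i
        using that by (metis atMost_iff imageI)
      have "q (idx ((s ^^ Suc k) v) - 1) \<noteq> (s ^^ Suc k) v" "q (idx ((s ^^ Suc k) v)) \<noteq> (s ^^ Suc k) v"
        using V_bounds[OF idx(1)[OF x(2)]] by (auto simp del: funpow.simps intro!: ne)
      then have "q (idx ((s ^^ Suc k) v) - 1) < s ((s ^^ k) v)" "s ((s ^^ k) v) < q (idx ((s ^^ Suc k) v))"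
        using idx(2)[OF x(2)] by (auto simp: I_def less_le)
      then show ?thesis using idx(1)[OF x(1)] idx(1)[OF x(2)] idx(2)[OF x(1)] by (intro edge_of_interior_point)
    qed
    then obtain k where k: "k < r" "\<bar>a (idx ((s ^^ k) v))\<bar> \<ge> 2"
      using path_hits_expanding[of "\<lambda>k. idx ((s ^^ k) v)"] by blast
    have "w ((s ^^ k) v) \<le> 1 / 2"
    proof -
      have "2 \<le> \<bar>real_of_int (a (idx ((s ^^ k) v)))\<bar>" using k(2) by linarith
      then show ?thesis unfolding w_def by (intro divide_left_mono) auto
    qed
    moreover have "?P = w ((s ^^ k) v) * (\<Prod>j\<in>{..<r + 1} - {k}. w ((s ^^ j) v))"
      using k by (subst prod.remove[of _ k]) auto
    ultimately have "?P \<le> 1 / 2"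
      using prod01[of "{..<r + 1} - {k}"] mult_mono[of "w ((s ^^ k) v)" "1 / 2" "\<Prod>j\<in>{..<r + 1} - {k}. w ((s ^^ j) v)" 1]
      by simp
    then have "?P * ?h \<le> 1 / 2 * C"
      using prod01[of "{..<r + 1}"] bound[OF orb[OF v, of "r + 1"]] by (intro mult_mono) auto
    then show ?thesis using \<epsilon> by simp
  qed
  then show ?thesis using many[OF v, of "r + 1"] by (simp add: algebra_simps)
qed

text \<open>The factor \<open>4 * real r + 6\<close> is the K with K = K / 2 + (2 * r + 3), so the
  error from the Markov points does not accumulate when the step is iterated.\<close>

lemma contraction:
  fixes H :: "nat \<Rightarrow> real \<Rightarrow> real"
  assumes bound: "\<And>n v. n \<ge> N \<Longrightarrow> v \<in> {0..1} \<Longrightarrow> \<bar>H n v\<bar> \<le> C"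
    and small: "\<And>n i. n \<ge> N \<Longrightarrow> i \<le> r \<Longrightarrow> \<bar>H n (q i)\<bar> \<le> \<epsilon>"
    and rec: "\<And>n i v. n \<ge> N \<Longrightarrow> i \<in> V \<Longrightarrow> v \<in> I i \<Longrightarrow>
      H (Suc n) v - H (Suc n) (q (i - 1)) = (H n (s v) - H n (s (q (i - 1)))) / of_int (a i)"
    and "v \<in> {0..1}" "n \<ge> N + k * (r + 1)"
  shows "\<bar>H n v\<bar> \<le> C / 2 ^ k + (4 * real r + 6) * \<epsilon>"
  using assms(4,5)
proof (induction k arbitrary: n v)
  case 0
  have "0 \<le> \<epsilon>" using small[of N 0] by fastforce
  then have "0 \<le> (4 * real r + 6) * \<epsilon>" by simp
  then show ?case using bound[of n v] 0 by simp
next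
  case (Suc k)
  have "0 \<le> \<epsilon>" using small[of N 0] by fastforce
  have "0 \<le> C" using bound[of N 0] by fastforce
  define m where "m = n - (r + 1)"
  have m: "m \<ge> N + k * (r + 1)" "n = m + (r + 1)" using Suc.prems by (auto simp: m_def)
  have "m \<ge> N" using m by simp
  have "\<bar>H n v\<bar> \<le> (C / 2 ^ k + (4 * real r + 6) * \<epsilon>) / 2 + (2 * real r + 3) * \<epsilon>"
    unfolding m(2)
  proof (rule contraction_step[where H = H and n = m])
    show "\<bar>H m v\<bar> \<le> C / 2 ^ k + (4 * real r + 6) * \<epsilon>" if "v \<in> {0..1}" for v
      using Suc.IH[OF that m(1)] .
  qed (use small rec \<open>m \<ge> N\<close> \<open>0 \<le> \<epsilon>\<close> \<open>0 \<le> C\<close> Suc.prems in auto)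
  then show ?case by (simp add: field_simps)
qed

end


section \<open>The invariant density\<close>

lemma sets_leb01: "sets leb01 = sets (restrict_space borel {0..1})"
  by (simp add: leb01_def sets_restrict_space)

lemma space_leb01 [simp]: "space leb01 = {0..1}"
  by (simp add: leb01_def space_restrict_space)

lemma in_sets_leb01: "A \<in> sets leb01 \<longleftrightarrow> A \<in> sets borel \<and> A \<subseteq> {0..1}"
  by (auto simp: sets_leb01 sets_restrict_space_iff)

lemma measurable_leb01_continuous:
  assumes cont: "continuous_on {0..1} s" and maps: "s \<in> {0..1} \<rightarrow> {0..1}"
  shows "s \<in> measurable leb01 leb01"
proof -
  have "s \<in> borel_measurable (restrict_space borel {0..1})"
    using cont by (rule borel_measurable_continuous_on_restrict)
  then have "s \<in> measurable leb01 borel" by (simp cong: measurable_cong_sets add: sets_leb01)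
  then have "s \<in> measurable leb01 (restrict_space borel {0..1})"
    using maps by (intro measurable_restrict_space2) auto
  then show ?thesis by (simp cong: measurable_cong_sets add: sets_leb01)
qed

lemma emeasure_leb01: "A \<subseteq> {0..1} \<Longrightarrow> emeasure leb01 A = emeasure lborel A"
  by (simp add: leb01_def emeasure_restrict_space)

lemma measure_leb01: "A \<subseteq> {0..1} \<Longrightarrow> measure leb01 A = measure lborel A"
  by (simp add: measure_def emeasure_leb01)

lemma prob_space_leb01: "prob_space leb01"
  by (rule prob_spaceI) (simp add: emeasure_leb01)

text \<open>Dynkin induction over the rays \<open>{..a}\<close>, cut down to the unit interval. Rays
  to the left of 0 become empty, the others become intervals \<open>{0..v}\<close>, whose
  intersections with a set are measured by \<open>cum\<close>.\<close>

lemma borel_unit_interval_induct [consumes 1, case_names interval empty compl union]: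
  assumes D: "D \<in> sets borel"
    and interval: "\<And>v. v \<in> {0..1} \<Longrightarrow> P {0..v::real}" and empty: "P {}"
    and compl: "\<And>A. A \<in> sets borel \<Longrightarrow> A \<subseteq> {0..1} \<Longrightarrow> P A \<Longrightarrow> P ({0..1} - A)"
    and union: "\<And>A::nat \<Rightarrow> real set. disjoint_family A \<Longrightarrow> (\<And>i. A i \<in> sets borel) \<Longrightarrow> (\<And>i. A i \<subseteq> {0..1}) \<Longrightarrow>
      (\<And>i. P (A i)) \<Longrightarrow> P (\<Union>i. A i)"
  shows "P (D \<inter> {0..1})"
proof -
  let ?G = "range (\<lambda>a::real. {..a})"
  have sig: "A \<in> sigma_sets UNIV ?G \<longleftrightarrow> A \<in> sets borel" for A
    by (subst borel_eq_atMost) (simp add: sets_measure_of)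
  have "Int_stable ?G" by (auto simp: Int_stable_def)
  moreover have "?G \<subseteq> Pow UNIV" by simp
  moreover have "D \<in> sigma_sets UNIV ?G" using D sig by simp
  ultimately show ?thesis
  proof (induction rule: sigma_sets_induct_disjoint)
    case (basic A)
    then obtain v where A: "A = {..v}" by blast
    show ?case
    proof (cases "v < 0")
      case True
      then have "{..v} \<inter> {0..1} = {}" by auto
      then show ?thesis using empty A by simp
    next
      case False
      have "{..v} \<inter> {0..1} = {0..min v 1}" by auto
      then show ?thesis using interval[of "min v 1"] A False by simp
    qed
  next
    case (compl A)
    have "(UNIV - A) \<inter> {0..1} = {0..1} - (A \<inter> {0..1})" by auto
    then show ?case using assms(4)[of "A \<inter> {0..1}"] compl sig by auto
  next
    case (union A)
    have "(\<Union>i. A i) \<inter> {0..1} = (\<Union>i. A i \<inter> {0..1})" by auto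
    moreover have "A i \<in> sets borel" for i using union sig by blast
    ultimately show ?case
      using assms(5)[of "\<lambda>i. A i \<inter> {0..1}"] union by (auto simp: disjoint_family_on_def)
  qed (use empty in auto)
qed

lemma fmeasurable_unit: "A \<in> sets borel \<Longrightarrow> A \<subseteq> {0..1::real} \<Longrightarrow> A \<in> fmeasurable lborel"
  using fmeasurable_interval_Int[of A 0 1] by (simp add: Int_absorb1)

lemma measure_unit_UN:
  fixes A :: "nat \<Rightarrow> real set"
  assumes "disjoint_family A" "\<And>i. A i \<in> sets borel" "\<And>i. A i \<subseteq> {0..1}"
  shows "(\<lambda>i. measure lborel (A i)) sums measure lborel (\<Union>i. A i)"
proof -
  interpret prob_space leb01 by (rule prob_space_leb01)
  have "(\<lambda>i. measure leb01 (A i)) sums measure leb01 (\<Union>i. A i)"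
    using assms by (intro finite_measure_UNION) (auto simp: in_sets_leb01)
  then show ?thesis using assms(3) by (simp add: measure_leb01 UN_least)
qed

context expanding_markov_map
begin

text \<open>The proportion of \<open>I i\<close> that \<open>s\<close> sends into
  \<open>I j\<close>: the part mapped onto \<open>I j\<close> has length \<open>len j\<close>
  divided by the modulus of the slope.\<close>

definition tmat :: "nat \<Rightarrow> nat \<Rightarrow> real" where
  "tmat i j = (if (i, j) \<in> E then len j / (\<bar>of_int (a i)\<bar> * len i) else 0)"

sublocale chain: stochastic_matrix V tmat
proof
  show "0 \<le> tmat i j" if "i \<in> V" "j \<in> V" for i j
    using len_pos[OF that(1)] len_pos[OF that(2)] by (simp add: tmat_def)
  show "(\<Sum>j\<in>V. tmat i j) = 1" if i: "i \<in> V" for i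
  proof -
    have "(\<Sum>j\<in>V. tmat i j) = (\<Sum>j\<in>V. if (i, j) \<in> E then len j else 0) / (\<bar>of_int (a i)\<bar> * len i)"
      unfolding sum_divide_distrib by (rule sum.cong) (auto simp: tmat_def)
    then show ?thesis using sum_len_edges[OF i] len_pos[OF i] slope_nonzero[OF i] by simp
  qed
qed (use finite_V V_ne in auto)

lemma chain_support: "chain.support = E"
  using len_pos slope_nonzero by (auto simp: chain.support_def tmat_def E_def)

text \<open>Normalised by length, the share of \<open>B\<close> in an interval evolves under
  preimages by pure averaging.\<close>

definition ratio :: "real set \<Rightarrow> nat \<Rightarrow> real" where "ratio B i = mass B i / len i"

lemma ratio_preim: "B \<in> sets borel \<Longrightarrow> i \<in> V \<Longrightarrow> ratio (preim B) i = chain.avg (ratio B) i"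
proof -
  assume B: "B \<in> sets borel" and i: "i \<in> V"
  have "ratio (preim B) i = (\<Sum>j\<in>V. if (i, j) \<in> E then mass B j else 0) / (\<bar>of_int (a i)\<bar> * len i)"
    using mass_preim[OF B i slope_nonzero[OF i]] by (simp add: ratio_def)
  also have "\<dots> = chain.avg (ratio B) i"
    unfolding chain.avg_def sum_divide_distrib using len_pos
    by (intro sum.cong) (auto simp: tmat_def ratio_def less_imp_neq[symmetric])
  finally show ?thesis .
qed

lemma ratio_bounds: "B \<in> sets borel \<Longrightarrow> i \<in> V \<Longrightarrow> 0 \<le> ratio B i \<and> ratio B i \<le> 1"
proof -
  assume B: "B \<in> sets borel" and i: "i \<in> V"
  have "measure lborel (I i \<inter> B) \<le> measure lborel (I i)"
    unfolding I_def using fmeasurable_interval_Int[OF B] fmeasurable_interval_Int[of UNIV] B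
    by (intro measure_mono_fmeasurable) auto
  then show ?thesis
    using mass_eq[OF B i] len_pos[OF i] by (simp add: ratio_def I_def len_def)
qed

lemma ratio_preim_funpow:
  "B \<in> sets borel \<Longrightarrow> i \<in> V \<Longrightarrow> ratio ((preim ^^ n) B) i = (chain.avg ^^ n) (ratio B) i"
proof (induction n arbitrary: i)
  case (Suc n)
  have "ratio ((preim ^^ Suc n) B) i = chain.avg (ratio ((preim ^^ n) B)) i"
    using ratio_preim[OF borel_preim_funpow[OF Suc.prems(1)] Suc.prems(2)] by simp
  also have "\<dots> = chain.avg ((chain.avg ^^ n) (ratio B)) i"
    using Suc by (intro chain.avg_cong) auto
  finally show ?case by simp
qed simp

text \<open>Since \<open>s\<close> has slope \<open>a i\<close> on \<open>I i\<close>, the function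
  \<theta> * v itself satisfies the recursion of \<open>cum_preim\<close>; hence so does the
  difference, for any \<theta>.\<close>

lemma cum_deviation_rec:
  assumes B: "B \<in> sets borel" and i: "i \<in> V" and v: "v \<in> I i"
  shows "(cum (preim B) v - \<theta> * v) - (cum (preim B) (q (i - 1)) - \<theta> * q (i - 1))
    = ((cum B (s v) - \<theta> * s v) - (cum B (s (q (i - 1))) - \<theta> * s (q (i - 1)))) / of_int (a i)"
proof -
  have a: "real_of_int (a i) \<noteq> 0" using slope_nonzero[OF i] by simp
  have "q (i - 1) \<in> I i" using len_pos[OF i] by (simp add: I_def len_def)
  from cum_preim[OF B i this v slope_nonzero[OF i]]
  have "cum (preim B) v - cum (preim B) (q (i - 1)) = (cum B (s v) - cum B (s (q (i - 1)))) / of_int (a i)" .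
  moreover have "v - q (i - 1) = (s v - s (q (i - 1))) / of_int (a i)"
    using s_affine[of i v] v i a by (simp add: V_def I_def)
  then have "\<theta> * v - \<theta> * q (i - 1) = (\<theta> * s v - \<theta> * s (q (i - 1))) / of_int (a i)"
    by (metis right_diff_distrib times_divide_eq_right)
  ultimately show ?thesis by (simp add: diff_divide_distrib)
qed

text \<open>Invariance makes the share of \<open>A\<close> harmonic, hence the same number \<theta>
  on all Markov intervals. The deviation from \<theta> * v then vanishes at the Markov points and
  contracts to 0 everywhere, so \<open>A\<close> has share \<theta> in every Borel set, in
  particular in itself.\<close>

lemma invariant_set_trivial:
  assumes A: "A \<in> sets borel" "A \<subseteq> {0..1}" and inv: "preim A = A"
  shows "measure lborel A = 0 \<or> measure lborel A = 1"
proof -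
  have "ratio A i = chain.avg (ratio A) i" if "i \<in> V" for i using ratio_preim[OF A(1) that] inv by simp
  then have const: "ratio A i = ratio A 1" if "i \<in> V" for i
  proof -
    have "1 \<in> V" using r_pos by (simp add: V_def)
    then show ?thesis using chain.harmonic_constant[of "ratio A" i 1] conn that
      \<open>\<And>i. i \<in> V \<Longrightarrow> ratio A i = chain.avg (ratio A) i\<close> by (metis chain_support)
  qed
  define \<theta> where "\<theta> = ratio A 1"
  have \<theta>: "0 \<le> \<theta>" "\<theta> \<le> 1" using ratio_bounds[OF A(1), of 1] r_pos by (auto simp: \<theta>_def V_def)
  have "mass A i = \<theta> * len i" if "i \<in> V" for i
  proof -
    have "mass A i = ratio A i * len i" using len_pos[OF that] by (simp add: ratio_def)
    then show ?thesis using const[OF that] by (simp add: \<theta>_def)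
  qed
  then have cum_q: "cum A (q k) = \<theta> * q k" if "k \<le> r" for k
    using sum_mass_upto[OF that, of A] sum_len_upto[OF that] that
    by (simp add: V_def sum_distrib_left[symmetric])
  have "\<bar>cum A v - \<theta> * v\<bar> \<le> 0" if v: "v \<in> {0..1}" for v
  proof -
    have "\<bar>cum A v - \<theta> * v\<bar> \<le> 1 / 2 ^ k + (4 * real r + 6) * 0" for k
    \<comment> \<open>The deviation does not depend on the time, as \<open>A\<close> is its own
      preimage, so the bound holds for every \<open>k\<close>.\<close>
    proof (rule contraction[where N = 0 and n = "k * (r + 1)" and H = "\<lambda>_ v. cum A v - \<theta> * v"])
      show "\<bar>cum A v - \<theta> * v\<bar> \<le> 1" if "v \<in> {0..1}" for v
      proof -
        have "0 \<le> cum A v" "cum A v \<le> 1" using cum_nonneg cum_le[OF A(1), of v] that by auto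
        moreover have "0 \<le> \<theta> * v" "\<theta> * v \<le> 1" using \<theta> that mult_mono[of \<theta> 1 v 1] by auto
        ultimately show ?thesis by linarith
      qed
      show "\<bar>cum A (q i) - \<theta> * q i\<bar> \<le> 0" if "i \<le> r" for i using cum_q[OF that] by simp
    qed (use v cum_deviation_rec[OF A(1), of _ _ \<theta>] inv in auto)
    then have "\<bar>cum A v - \<theta> * v\<bar> \<le> 1 / 2 ^ k" for k by simp
    moreover have "(\<lambda>k. 1 / 2 ^ k :: real) \<longlonglongrightarrow> 0" by real_asymp
    ultimately show ?thesis by (intro LIMSEQ_le_const[of "\<lambda>k. 1 / 2 ^ k"]) auto
  qed
  then have cum: "cum A v = \<theta> * v" if "v \<in> {0..1}" for v using that by simp
  have split: "measure lborel (D \<inter> {0..1} \<inter> A) = \<theta> * measure lborel (D \<inter> {0..1})" if "D \<in> sets borel" for D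
    using that
  proof (induction rule: borel_unit_interval_induct)
    case (interval v)
    then show ?case using cum[of v] by (simp add: cum_def)
  next
    case (compl D)
    have "measure lborel (({0..1} - D) \<inter> A) = measure lborel ({0..1} \<inter> A - D \<inter> A)"
      by (rule arg_cong[where f = "measure lborel"]) auto
    also have "\<dots> = measure lborel ({0..1} \<inter> A) - measure lborel (D \<inter> A)"
      using compl A by (intro measurable_measure_Diff) (auto intro!: fmeasurable_unit)
    also have "\<dots> = \<theta> * 1 - \<theta> * measure lborel D" using cum[of 1] compl by (simp add: cum_def)
    also have "1 - measure lborel D = measure lborel ({0..1} - D)"
      using compl measurable_measure_Diff[of "{0..1}" lborel D] by (simp add: fmeasurable_unit)
    then have "\<theta> * 1 - \<theta> * measure lborel D = \<theta> * measure lborel ({0..1} - D)" by (metis right_diff_distrib)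
    finally show ?case .
  next
    case (union D)
    have "(\<lambda>i. measure lborel (D i \<inter> A)) sums measure lborel (\<Union>i. D i \<inter> A)"
      using union A by (intro measure_unit_UN) (auto simp: disjoint_family_on_def)
    moreover have "(\<lambda>i. \<theta> * measure lborel (D i)) sums (\<theta> * measure lborel (\<Union>i. D i))"
      using union by (intro sums_mult measure_unit_UN) auto
    ultimately show ?case using union(4) by (simp add: sums_unique2)
  qed simp
  \<comment> \<open>Testing \<open>A\<close> against itself yields \<theta> = \<theta> *
    \<theta>.\<close>
  have "measure lborel A = \<theta>" using cum[of 1] A(2) by (simp add: cum_def Int_absorb1)
  moreover have "measure lborel A = \<theta> * measure lborel A" using split[OF A(1)] A(2) by (simp add: Int_absorb2)
  ultimately show ?thesis by auto
qed

text \<open>The third condition is the fixed-point equation of the transfer operator for the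
  function with value \<open>c i\<close> on interval \<open>i\<close>. Multiplication by lengths
  turns it into stationarity for \<open>tmat\<close>, whose entries are rational because Markov
  points and slopes are.\<close>

lemma stationary_coefficients_exist:
  "\<exists>c::nat \<Rightarrow> rat. (\<forall>i\<in>V. c i > 0) \<and> (\<Sum>i\<in>V. of_rat (c i) * len i) = 1 \<and>
    (\<forall>j\<in>V. real_of_rat (c j) = (\<Sum>i\<in>V. if (i, j) \<in> E then of_rat (c i) / \<bar>of_int (a i)\<bar> else 0))"
proof -
  have "\<forall>i. \<exists>x. i \<le> r \<longrightarrow> q i = of_rat x" using q_Rats by (auto elim!: Rats_cases)
  then obtain qr where qr: "\<And>i. i \<le> r \<Longrightarrow> q i = of_rat (qr i)" by metis
  define lr where "lr i = qr i - qr (i - 1)" for i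
  have lr: "len i = of_rat (lr i)" if "i \<in> V" for i
    using qr[of i] qr[of "i - 1"] V_bounds[OF that] by (simp add: len_def lr_def of_rat_diff)
  have lr_pos: "lr i > 0" if "i \<in> V" for i using len_pos[OF that] lr[OF that] by simp
  \<comment> \<open>A copy of \<open>tmat\<close> with values in the rationals, to which the general
    lemma is applied.\<close>
  define p where "p i j = (if (i, j) \<in> E then lr j / (of_int \<bar>a i\<bar> * lr i) else 0)" for i j
  have p: "of_rat (p i j) = tmat i j" if "i \<in> V" "j \<in> V" for i j
    using lr that by (simp add: p_def tmat_def of_rat_divide of_rat_mult flip: of_int_abs)
  have "\<exists>m. (\<forall>i\<in>V. m i > 0) \<and> (\<forall>j\<in>V. m j = (\<Sum>i\<in>V. m i * p i j))"
  proof (rule stationary_vector_exists[OF finite_V V_ne])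
    show "p i j \<ge> 0" if "i \<in> V" "j \<in> V" for i j
      using chain.p_nonneg[OF that] p[OF that] by (metis zero_le_of_rat_iff)
    show "(\<Sum>j\<in>V. p i j) = 1" if "i \<in> V" for i
    proof -
      have "real_of_rat (\<Sum>j\<in>V. p i j) = 1" using chain.p_sum[OF that] p that by (simp add: of_rat_sum)
      then show ?thesis by simp
    qed
    have "{(i, j). i \<in> V \<and> j \<in> V \<and> p i j > 0} = E"
      using p unfolding chain_support[symmetric] chain.support_def by (metis (no_types, lifting) zero_less_of_rat_iff)
    then show "(i, j) \<in> {(i, j). i \<in> V \<and> j \<in> V \<and> p i j > 0}\<^sup>+" if "i \<in> V" "j \<in> V" for i j
      using edge_path[OF that] by simp
  qed
  then obtain m where m: "\<And>i. i \<in> V \<Longrightarrow> m i > 0" "\<And>j. j \<in> V \<Longrightarrow> m j = (\<Sum>i\<in>V. m i * p i j)" by blast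
  define M where "M = (\<Sum>i\<in>V. m i)"
  have M: "M > 0" unfolding M_def using m(1) finite_V V_ne by (intro sum_pos) auto
  \<comment> \<open>Stationary masses divided by lengths are densities; \<open>M\<close> normalises
    the total mass to 1.\<close>
  define c where "c i = m i / (lr i * M)" for i
  have "c j = (\<Sum>i\<in>V. if (i, j) \<in> E then c i / of_int \<bar>a i\<bar> else 0)" if j: "j \<in> V" for j
  proof -
    have "c j = (\<Sum>i\<in>V. m i * p i j / (lr j * M))" using m(2)[OF j] by (simp add: c_def sum_divide_distrib)
    also have "\<dots> = (\<Sum>i\<in>V. if (i, j) \<in> E then c i / of_int \<bar>a i\<bar> else 0)"
      using lr_pos[OF j] by (intro sum.cong) (auto simp: p_def c_def)
    finally show ?thesis .
  qed
  then have "real_of_rat (c j) = (\<Sum>i\<in>V. if (i, j) \<in> E then of_rat (c i) / \<bar>of_int (a i)\<bar> else 0)" if "j \<in> V" for j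
  proof -
    have "real_of_rat (c j) = (\<Sum>i\<in>V. of_rat (if (i, j) \<in> E then c i / of_int \<bar>a i\<bar> else 0))"
      unfolding of_rat_sum[symmetric] using \<open>j \<in> V \<Longrightarrow> c j = _\<close> that by simp
    also have "\<dots> = (\<Sum>i\<in>V. if (i, j) \<in> E then of_rat (c i) / \<bar>of_int (a i)\<bar> else 0)"
      by (intro sum.cong refl) (simp add: of_rat_divide del: of_int_abs, simp)
    finally show ?thesis .
  qed
  moreover have "(\<Sum>i\<in>V. of_rat (c i) * len i) = 1"
  proof -
    have "(\<Sum>i\<in>V. of_rat (c i) * len i) = (\<Sum>i\<in>V. real_of_rat (m i / M))"
      using lr lr_pos by (intro sum.cong) (auto simp: c_def of_rat_mult[symmetric] less_imp_neq[symmetric])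
    also have "\<dots> = of_rat (M / M)" by (simp add: of_rat_sum[symmetric] sum_divide_distrib[symmetric] M_def)
    finally show ?thesis using M by simp
  qed
  moreover have "c i > 0" if "i \<in> V" for i using m(1) lr_pos that M by (simp add: c_def)
  ultimately show ?thesis by blast
qed

definition coeff :: "nat \<Rightarrow> rat" where
  "coeff = (SOME c. (\<forall>i\<in>V. c i > 0) \<and> (\<Sum>i\<in>V. of_rat (c i) * len i) = 1 \<and>
    (\<forall>j\<in>V. real_of_rat (c j) = (\<Sum>i\<in>V. if (i, j) \<in> E then of_rat (c i) / \<bar>of_int (a i)\<bar> else 0)))"

abbreviation c where "c i \<equiv> real_of_rat (coeff i)"

lemma c_pos: "i \<in> V \<Longrightarrow> c i > 0"
  and c_sum: "(\<Sum>i\<in>V. c i * len i) = 1"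
  and c_stat: "j \<in> V \<Longrightarrow> c j = (\<Sum>i\<in>V. if (i, j) \<in> E then c i / \<bar>of_int (a i)\<bar> else 0)"
proof -
  note spec = someI_ex[OF stationary_coefficients_exist, folded coeff_def]
  show "i \<in> V \<Longrightarrow> c i > 0" using conjunct1[OF spec] by simp
  show "(\<Sum>i\<in>V. c i * len i) = 1" using conjunct1[OF conjunct2[OF spec]] .
  show "j \<in> V \<Longrightarrow> c j = (\<Sum>i\<in>V. if (i, j) \<in> E then c i / \<bar>of_int (a i)\<bar> else 0)"
    using conjunct2[OF conjunct2[OF spec]] by blast
qed

text \<open>The invariant measure of \<open>B\<close> in terms of finitely many masses: invariance
  becomes an exchange of finite sums, settled before any measure is built.\<close>

definition weight :: "real set \<Rightarrow> real" where "weight B = (\<Sum>i\<in>V. c i * mass B i)"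

lemma weight_preim: "B \<in> sets borel \<Longrightarrow> weight (preim B) = weight B"
proof -
  assume B: "B \<in> sets borel"
  have "weight (preim B) = (\<Sum>i\<in>V. \<Sum>j\<in>V. if (i, j) \<in> E then c i / \<bar>of_int (a i)\<bar> * mass B j else 0)"
    unfolding weight_def
    by (rule sum.cong) (auto simp: mass_preim[OF B _ slope_nonzero] sum_distrib_left sum_divide_distrib intro!: sum.cong)
  also have "\<dots> = (\<Sum>j\<in>V. \<Sum>i\<in>V. if (i, j) \<in> E then c i / \<bar>of_int (a i)\<bar> * mass B j else 0)"
    by (rule sum.swap)
  also have "\<dots> = (\<Sum>j\<in>V. (\<Sum>i\<in>V. if (i, j) \<in> E then c i / \<bar>of_int (a i)\<bar> else 0) * mass B j)"
    unfolding sum_distrib_right by (intro sum.cong) auto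
  also have "\<dots> = weight B"
    unfolding weight_def by (intro sum.cong refl) (simp add: c_stat[symmetric])
  finally show ?thesis .
qed

text \<open>Half-open intervals count no Markov point twice. They omit 0, where the density is 0; a
  single point does not matter.\<close>

definition dens :: "real \<Rightarrow> real" where
  "dens x = (\<Sum>i\<in>V. c i * indicator {q (i - 1)<..q i} x)"

definition \<mu> :: "real measure" where "\<mu> = density leb01 (\<lambda>x. ennreal (dens x))"

lemma dens_meas [measurable]: "dens \<in> borel_measurable borel"
  unfolding dens_def by measurable

lemma dens_meas01 [measurable]: "dens \<in> borel_measurable leb01"
  using dens_meas unfolding leb01_def by (intro measurable_restrict_space1) simp

lemma dens_nonneg: "0 \<le> dens x"
  unfolding dens_def using c_pos by (intro sum_nonneg) (auto simp: less_imp_le)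

lemma sets_\<mu>: "sets \<mu> = sets leb01" and space_\<mu> [simp]: "space \<mu> = {0..1}"
  by (auto simp: \<mu>_def)

lemma measure_half_open:
  assumes B: "B \<in> sets borel" and i: "i \<in> V"
  shows "emeasure lborel ({q (i - 1)<..q i} \<inter> B) = ennreal (mass B i)"
proof -
  have "AE x in lborel. (x \<in> {q (i - 1)<..q i} \<inter> B) = (x \<in> I i \<inter> B)"
    using AE_lborel_singleton[of "q (i - 1)"] by eventually_elim (auto simp: I_def)
  then have "emeasure lborel ({q (i - 1)<..q i} \<inter> B) = emeasure lborel (I i \<inter> B)"
    using B by (intro emeasure_eq_AE) (auto simp: I_def)
  also have "\<dots> = ennreal (measure lborel (I i \<inter> B))"
    using fmeasurable_interval_Int[OF B] unfolding I_def
    by (intro emeasure_eq_ennreal_measure) (auto simp: fmeasurable_def less_top)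
  finally show ?thesis using mass_eq[OF B i] by simp
qed

lemma mass_nonneg: "B \<in> sets borel \<Longrightarrow> i \<in> V \<Longrightarrow> mass B i \<ge> 0"
  using mass_eq by simp

lemma emeasure_\<mu>:
  assumes B: "B \<in> sets borel" "B \<subseteq> {0..1}"
  shows "emeasure \<mu> B = ennreal (weight B)"
proof -
  have [measurable]: "B \<in> sets leb01" using B by (simp add: in_sets_leb01)
  have I': "{q (i - 1)<..q i} \<inter> {0..1} \<in> sets leb01" for i by (simp add: in_sets_leb01)
  have "emeasure \<mu> B = (\<integral>\<^sup>+x. ennreal (dens x) * indicator B x \<partial>leb01)"
    unfolding \<mu>_def by (rule emeasure_density) measurable
  also have "\<dots> = (\<integral>\<^sup>+x. (\<Sum>i\<in>V. ennreal (c i) * indicator ({q (i - 1)<..q i} \<inter> B) x) \<partial>leb01)"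
  proof (rule nn_integral_cong)
    fix x
    have "ennreal (dens x) = (\<Sum>i\<in>V. ennreal (c i * indicator {q (i - 1)<..q i} x))"
      unfolding dens_def using c_pos by (intro sum_ennreal[symmetric]) (auto simp: less_imp_le)
    then show "ennreal (dens x) * indicator B x = (\<Sum>i\<in>V. ennreal (c i) * indicator ({q (i - 1)<..q i} \<inter> B) x)"
      unfolding sum_distrib_right using c_pos
      by (auto intro!: sum.cong simp: indicator_def)
  qed
  also have "\<dots> = (\<Sum>i\<in>V. ennreal (c i) * emeasure leb01 ({q (i - 1)<..q i} \<inter> B))"
  proof -
    have "{q (i - 1)<..q i} \<inter> B \<in> sets leb01" for i using B by (auto simp: in_sets_leb01)
    then show ?thesis by (subst nn_integral_sum) (auto simp: nn_integral_cmult_indicator)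
  qed
  also have "\<dots> = (\<Sum>i\<in>V. ennreal (c i * mass B i))"
  proof (rule sum.cong[OF refl])
    fix i assume i: "i \<in> V"
    have "emeasure leb01 ({q (i - 1)<..q i} \<inter> B) = ennreal (mass B i)"
      using measure_half_open[OF B(1) i] B(2) by (subst emeasure_leb01) auto
    then show "ennreal (c i) * emeasure leb01 ({q (i - 1)<..q i} \<inter> B) = ennreal (c i * mass B i)"
      using c_pos[OF i] by (simp add: ennreal_mult')
  qed
  also have "\<dots> = ennreal (weight B)"
    unfolding weight_def using c_pos mass_nonneg[OF B(1)] by (intro sum_ennreal) (auto simp: less_imp_le)
  finally show ?thesis .
qed

lemma weight_nonneg: "B \<in> sets borel \<Longrightarrow> 0 \<le> weight B"
  unfolding weight_def using c_pos mass_nonneg by (intro sum_nonneg) (auto simp: less_imp_le)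

lemma measure_\<mu>: "B \<in> sets borel \<Longrightarrow> B \<subseteq> {0..1} \<Longrightarrow> measure \<mu> B = weight B"
  using emeasure_\<mu> weight_nonneg by (simp add: measure_def)

lemma mass_unit: "i \<in> V \<Longrightarrow> mass {0..1} i = len i"
  using I_sub[of i] len_pos[of i] by (simp add: mass_eq Int_absorb2) (simp add: I_def len_def)

lemma prob_space_\<mu>: "prob_space \<mu>"
  by (rule prob_spaceI) (simp add: emeasure_\<mu> weight_def mass_unit c_sum)

lemma \<mu>_ac_leb: "absolutely_continuous leb01 \<mu>"
  unfolding \<mu>_def by (rule absolutely_continuousI_density) measurable

lemma leb_ac_\<mu>: "absolutely_continuous \<mu> leb01"
  unfolding absolutely_continuous_def
proof
  fix B assume "B \<in> null_sets \<mu>"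
  then have B: "B \<in> sets borel" "B \<subseteq> {0..1}" "emeasure \<mu> B = 0" by (auto simp: null_sets_def sets_\<mu> in_sets_leb01)
  then have "weight B = 0" using weight_nonneg[OF B(1)] by (simp add: emeasure_\<mu>)
  then have "c i * mass B i = 0" if "i \<in> V" for i
    unfolding weight_def using that finite_V c_pos mass_nonneg[OF B(1)]
    by (subst (asm) sum_nonneg_eq_0_iff) (auto simp: less_imp_le)
  then have "mass B i = 0" if "i \<in> V" for i using c_pos[OF that] that by force
  then have "cum B 1 = 0" using sum_mass_upto[of r B] q_r by (simp add: V_def)
  then have "measure lborel B = 0" using B by (simp add: cum_def Int_absorb1)
  moreover have "emeasure lborel B = ennreal (measure lborel B)"
    using fmeasurable_unit[OF B(1,2)] by (intro emeasure_eq_ennreal_measure) (auto simp: fmeasurable_def less_top)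
  ultimately show "B \<in> null_sets leb01" using B by (simp add: null_sets_def in_sets_leb01 emeasure_leb01)
qed

lemma vimage_eq_preim: "s -` A \<inter> space \<mu> = preim A"
  by (simp add: preim_def)

lemma \<mu>_preserved: "preserves_measure \<mu> s"
  unfolding preserves_measure_def
proof (intro conjI ballI)
  show "s \<in> measurable \<mu> \<mu>" using measurable_leb01_continuous[OF s_cont s_maps]
    by (simp cong: measurable_cong_sets add: sets_\<mu>)
  fix A assume "A \<in> sets \<mu>"
  then have A: "A \<in> sets borel" "A \<subseteq> {0..1}" by (auto simp: sets_\<mu> in_sets_leb01)
  then show "emeasure \<mu> (s -` A \<inter> space \<mu>) = emeasure \<mu> A"
    unfolding vimage_eq_preim using emeasure_\<mu>[OF borel_preim[OF A(1)]] weight_preim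
    by (simp add: emeasure_\<mu> preim_def)
qed

lemma \<mu>_ergodic: "ergodic_map \<mu> s"
  unfolding ergodic_map_def vimage_eq_preim
proof (intro ballI impI)
  interpret P: prob_space \<mu> by (rule prob_space_\<mu>)
  interpret L: prob_space leb01 by (rule prob_space_leb01)
  fix A assume "A \<in> sets \<mu>" and inv: "preim A = A"
  then have A: "A \<in> sets leb01" "A \<in> sets borel" "A \<subseteq> {0..1}" by (auto simp: sets_\<mu> in_sets_leb01)
  have null: "measure \<mu> B = 0" if "B \<in> sets leb01" "measure leb01 B = 0" for B
  proof -
    have "B \<in> null_sets leb01" using that by (simp add: null_sets_def L.emeasure_eq_measure)
    then have "B \<in> null_sets \<mu>" using \<mu>_ac_leb by (auto simp: absolutely_continuous_def)
    then show ?thesis by (simp add: measure_eq_0_null_sets)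
  qed
  have "measure leb01 A = 0 \<or> measure leb01 A = 1"
    using invariant_set_trivial[OF A(2,3) inv] by (simp add: measure_leb01[OF A(3)])
  then show "measure \<mu> A = 0 \<or> measure \<mu> A = 1"
  proof
    assume "measure leb01 A = 1"
    then have "measure leb01 (space leb01 - A) = 0" using L.prob_compl[OF A(1)] by simp
    then have "measure \<mu> (space \<mu> - A) = 0" using null[of "{0..1} - A"] A by (simp add: in_sets_leb01)
    then show ?thesis using P.prob_compl[of A] A by (simp add: sets_\<mu>)
  qed (use null A in auto)
qed

lemma ergodic_dominating_\<mu>: "ergodic_dominating01 s \<mu>"
  using prob_space_\<mu> sets_\<mu> sets_leb01 leb_ac_\<mu> \<mu>_preserved \<mu>_ergodic by (simp add: ergodic_dominating01_def)

text \<open>A competitor \<open>N\<close> dominates Lebesgue measure and hence \<open>\<mu>\<close>,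
  so uniqueness rests on the ergodicity of \<open>N\<close>.\<close>

lemma ergodic_dominating_unique:
  assumes "ergodic_dominating01 s N"
  shows "N = \<mu>"
proof -
  have "absolutely_continuous N \<mu>"
    using assms \<mu>_ac_leb by (auto simp: ergodic_dominating01_def absolutely_continuous_def)
  moreover have "sets \<mu> = sets N" using assms by (simp add: ergodic_dominating01_def sets_\<mu> sets_leb01)
  ultimately show ?thesis
    using ergodic_measure_unique[of N \<mu> s] assms prob_space_\<mu> \<mu>_preserved by (simp add: ergodic_dominating01_def)
qed

lemma RN_deriv_\<mu>: "AE x in leb01. RN_deriv leb01 \<mu> x = ennreal (dens x)"
proof -
  interpret prob_space leb01 by (rule prob_space_leb01)
  have "AE x in leb01. ennreal (dens x) = RN_deriv leb01 \<mu> x"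
    by (rule RN_deriv_unique) (auto simp: \<mu>_def)
  then show ?thesis by eventually_elim simp
qed

lemma dens_on_I: "i \<in> V \<Longrightarrow> x \<in> {q (i - 1)<..q i} \<Longrightarrow> dens x = c i"
proof -
  assume i: "i \<in> V" and x: "x \<in> {q (i - 1)<..q i}"
  have "x \<notin> {q (j - 1)<..q j}" if j: "j \<in> V" "j \<noteq> i" for j
  proof (cases "j < i")
    case True
    then have "q j \<le> q (i - 1)" using q_le_iff[of j "i - 1"] V_bounds[OF i] V_bounds[OF j(1)] by auto
    then show ?thesis using x by auto
  next
    case False
    then have "q i \<le> q (j - 1)" using q_le_iff[of i "j - 1"] V_bounds[OF i] V_bounds[OF j(1)] j(2) by auto
    then show ?thesis using x by auto
  qed
  then have "(\<Sum>j\<in>V - {i}. c j * indicator {q (j - 1)<..q j} x) = 0" by (intro sum.neutral) auto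
  then show ?thesis unfolding dens_def using i x finite_V by (subst sum.remove[of _ i]) auto
qed

lemma RN_deriv_\<mu>_on_I:
  assumes "i \<in> V"
  shows "AE x in leb01. x \<in> I i \<longrightarrow> RN_deriv leb01 \<mu> x = ennreal (c i)"
proof -
  have "AE x in lborel. x \<in> {0..1} \<longrightarrow> x \<noteq> q (i - 1)"
    using AE_lborel_singleton[of "q (i - 1)"] by eventually_elim auto
  then have "AE x in leb01. x \<noteq> q (i - 1)" unfolding leb01_def by (subst AE_restrict_space_iff) auto
  with RN_deriv_\<mu> show ?thesis by eventually_elim (use dens_on_I[OF assms] in \<open>auto simp: I_def\<close>)
qed

lemma RN_deriv_\<mu>_integrable: "integrable leb01 (\<lambda>x. enn2real (RN_deriv leb01 \<mu> x))"
proof -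
  interpret prob_space leb01 by (rule prob_space_leb01)
  have "integrable leb01 dens"
  proof (rule integrable_const_bound[where B = "\<Sum>i\<in>V. c i"])
    have "dens x \<le> (\<Sum>i\<in>V. c i)" for x
      unfolding dens_def using c_pos by (intro sum_mono) (auto simp: indicator_def less_imp_le)
    then show "AE x in leb01. norm (dens x) \<le> (\<Sum>i\<in>V. c i)" using dens_nonneg by simp
  qed measurable
  moreover have "AE x in leb01. dens x = enn2real (RN_deriv leb01 \<mu> x)"
    using RN_deriv_\<mu> by eventually_elim (simp add: dens_nonneg)
  ultimately show ?thesis
    by (subst integrable_cong_AE[of _ _ dens]) (auto elim: AE_mp)
qed

end


section \<open>Mixing, exactness and necessity\<close>

text \<open>The counterpart of \<open>invariant_dominating\<close> on the unit interval, with the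
  dynamical property kept apart so that ergodicity, mixing and exactness share one transfer.\<close>

definition dominating01 :: "(real \<Rightarrow> real) \<Rightarrow> real measure \<Rightarrow> bool" where
  "dominating01 s M \<longleftrightarrow> prob_space M \<and> sets M = sets leb01 \<and>
     absolutely_continuous M leb01 \<and> preserves_measure M s"

lemma dominating01_space: "dominating01 s M \<Longrightarrow> space M = {0..1}"
  by (auto simp: dominating01_def dest: sets_eq_imp_space_eq)

lemma dominating01_interval_pos:
  assumes dom: "dominating01 s M" and uv: "0 \<le> u" "u < v" "v \<le> 1"
  shows "{u<..<v} \<in> sets M" "measure M {u<..<v} > 0"
proof -
  interpret prob_space M using dom by (simp add: dominating01_def)
  show sets: "{u<..<v} \<in> sets M" using dom uv by (auto simp: dominating01_def in_sets_leb01)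
  show "measure M {u<..<v} > 0"
  proof (rule ccontr)
    assume "\<not> ?thesis"
    then have "measure M {u<..<v} = 0" using measure_nonneg[of M] by (simp add: not_less antisym)
    then have "{u<..<v} \<in> null_sets M" using sets by (simp add: null_sets_def emeasure_eq_measure)
    then have "{u<..<v} \<in> null_sets leb01" using dom by (auto simp: dominating01_def absolutely_continuous_def)
    moreover have "{u<..<v} \<subseteq> {0..1}" using uv by auto
    ultimately show False using uv by (simp add: null_sets_def emeasure_leb01)
  qed
qed

definition dense_orbit :: "(real \<Rightarrow> real) \<Rightarrow> real \<Rightarrow> bool" where
  "dense_orbit s x \<longleftrightarrow> (\<forall>u v. 0 \<le> u \<longrightarrow> u < v \<longrightarrow> v \<le> 1 \<longrightarrow> (\<exists>k. (s ^^ k) x \<in> {u<..<v}))"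

text \<open>Countably many rational intervals suffice, and almost every orbit enters each of them.
  Domination of Lebesgue measure turns almost everywhere for \<open>M\<close> into almost everywhere
  for \<open>leb01\<close>.\<close>

lemma ergodic_imp_dense_orbits:
  assumes dom: "dominating01 s M" and erg: "ergodic_map M s"
  shows "AE x in leb01. dense_orbit s x"
proof -
  have "AE x in M. \<exists>k. (s ^^ k) x \<in> {u<..<v}" if uv: "0 \<le> u" "u < v" "v \<le> 1" for u v
    using dominating01_interval_pos[OF dom uv] dom erg
    by (intro ergodic_hitting_AE) (auto simp: dominating01_def)
  then have "AE x in M. 0 \<le> u \<longrightarrow> u < v \<longrightarrow> v \<le> 1 \<longrightarrow> (\<exists>k. (s ^^ k) x \<in> {u<..<v})" for u v
    by (cases "0 \<le> u \<and> u < v \<and> v \<le> 1") auto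
  then have "AE x in M. \<forall>u v::rat. 0 \<le> real_of_rat u \<longrightarrow> real_of_rat u < of_rat v \<longrightarrow> of_rat v \<le> (1::real) \<longrightarrow>
      (\<exists>k. (s ^^ k) x \<in> {of_rat u<..<of_rat v})"
    by (simp only: AE_all_countable) blast
  then have "AE x in leb01. \<forall>u v::rat. 0 \<le> real_of_rat u \<longrightarrow> real_of_rat u < of_rat v \<longrightarrow> of_rat v \<le> (1::real) \<longrightarrow>
      (\<exists>k. (s ^^ k) x \<in> {of_rat u<..<of_rat v})"
    using absolutely_continuous_AE[of leb01 M] dom by (auto simp: dominating01_def)
  then show ?thesis
  proof eventually_elim
    case (elim x)
    show ?case
      unfolding dense_orbit_def
    proof (intro allI impI)
      fix u v :: real assume uv: "0 \<le> u" "u < v" "v \<le> 1"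
      obtain u' where u': "u < of_rat u'" "of_rat u' < v" using of_rat_dense[OF uv(2)] by blast
      obtain v' where v': "of_rat u' < real_of_rat v'" "of_rat v' < v" using of_rat_dense[OF u'(2)] by blast
      from elim u' v' uv obtain k where "(s ^^ k) x \<in> {of_rat u'<..<of_rat v'}" by (smt (verit))
      then show "\<exists>k. (s ^^ k) x \<in> {u<..<v}" using u' v' by (intro exI[of _ k]) auto
    qed
  qed
qed

text \<open>An orbit confined to two points symmetric about 1/2 cannot visit both (0, 1/4) and (1/4,
  1/2).\<close>

lemma dense_orbit_infinite:
  assumes "dense_orbit s x" "\<And>k. (s ^^ k) x = x \<or> (s ^^ k) x = 1 - x"
  shows False
proof -
  note dense = assms(1)[unfolded dense_orbit_def, rule_format]
  obtain k1 where "(s ^^ k1) x \<in> {0<..<1/4}" using dense[of 0 "1/4"] by auto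
  moreover obtain k2 where "(s ^^ k2) x \<in> {1/4<..<1/2}" using dense[of "1/4" "1/2"] by auto
  ultimately show False using assms(2)[of k1] assms(2)[of k2] by auto
qed

section \<open>Necessity of connectedness and of period 1\<close>

context markov_map
begin

definition J :: "nat \<Rightarrow> real set" where "J i = {q (i - 1)<..<q i}"

lemma J_sub: "i \<in> V \<Longrightarrow> J i \<subseteq> {0..1}"
  using I_sub[of i] by (auto simp: J_def I_def)

lemma J_disjoint:
  assumes "i \<in> V" "j \<in> V" "x \<in> J i" "x \<in> J j"
  shows "i = j"
proof (cases i j rule: linorder_cases)
  case less
  then have "q i \<le> q (j - 1)" using q_le_iff[of i "j - 1"] V_bounds[OF assms(1)] V_bounds[OF assms(2)] by auto
  then show ?thesis using assms by (auto simp: J_def)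
next
  case greater
  then have "q j \<le> q (i - 1)" using q_le_iff[of j "i - 1"] V_bounds[OF assms(1)] V_bounds[OF assms(2)] by auto
  then show ?thesis using assms by (auto simp: J_def)
qed

lemma J_no_markov_point: "i \<in> V \<Longrightarrow> x \<in> J i \<Longrightarrow> x \<notin> q ` {..r}"
proof
  assume i: "i \<in> V" and x: "x \<in> J i" and "x \<in> q ` {..r}"
  then obtain k where k: "k \<le> r" "x = q k" by auto
  then have "i - 1 < k" "k < i" using x q_less_iff[of "i - 1" k] q_less_iff[of k i] V_bounds[OF i] by (auto simp: J_def)
  then show False by simp
qed

text \<open>Markov points are mapped to Markov points, so an orbit that is inside an open interval
  at time \<open>k\<close> has met none before; each step runs between interiors and therefore
  follows an edge.\<close>

lemma orbit_path: "i \<in> V \<Longrightarrow> j \<in> V \<Longrightarrow> x \<in> J i \<Longrightarrow> (s ^^ k) x \<in> J j \<Longrightarrow> (i, j) \<in> E ^^ k"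
proof (induction k arbitrary: x i)
  case 0
  then show ?case using J_disjoint[of i j x] by simp
next
  case (Suc k)
  have x: "x \<in> {0..1}" using Suc.prems J_sub by blast
  have stay: "(s ^^ k) y \<in> q ` {..r}" if "y \<in> q ` {..r}" for y
    using that s_q by (induction k) auto
  have kx: "(s ^^ k) (s x) \<in> J j" using Suc.prems by (simp add: funpow_swap1)
  then have "s x \<notin> q ` {..r}" using stay J_no_markov_point Suc.prems by blast
  then obtain l where l: "l \<in> V" "q (l - 1) < s x" "s x < q l" using in_some_interior s_in_01[OF x] by blast
  have "(i, l) \<in> E"
    using Suc.prems l by (intro edge_of_interior_point[of i l x]) (auto simp: J_def I_def)
  moreover have "(l, j) \<in> E ^^ k" using Suc.IH[of l "s x"] Suc.prems l kx by (simp add: J_def)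
  ultimately show ?case by (rule relpow_Suc_I2)
qed

lemma dense_orbits_imp_connected:
  assumes "AE x in leb01. dense_orbit s x"
  shows "strongly_connected_graph V E"
  unfolding strongly_connected_graph_def
proof (intro ballI)
  fix i j assume ij: "i \<in> V" "j \<in> V"
  interpret L: prob_space leb01 by (rule prob_space_leb01)
  have "\<exists>x\<in>J i. dense_orbit s x"
  proof (rule ccontr)
    assume *: "\<not> ?thesis"
    have "AE x in leb01. x \<notin> J i" using assms by eventually_elim (use * in auto)
    moreover have "J i \<in> sets leb01" using J_sub[OF ij(1)] by (simp add: in_sets_leb01 J_def)
    ultimately have "emeasure leb01 (J i) = 0" using AE_iff_null_sets[of "J i" leb01] by (simp add: null_sets_def)
    then show False using J_sub[OF ij(1)] len_pos[OF ij(1)] by (simp add: emeasure_leb01) (simp add: J_def len_def)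
  qed
  then obtain x where x: "x \<in> J i" "dense_orbit s x" by blast
  \<comment> \<open>The target inside \<open>J j\<close> must avoid \<open>x\<close>: paths have
    positive length, so time 0 must not count as a visit.\<close>
  obtain u v where uv: "q (j - 1) \<le> u" "u < v" "v \<le> q j" "x \<notin> {u<..<v}"
  proof (cases "x \<in> J j")
    case True
    then show ?thesis using that[of "q (j - 1)" x] by (auto simp: J_def)
  next
    case False
    then show ?thesis using that[of "q (j - 1)" "q j"] len_pos[OF ij(2)] by (auto simp: J_def len_def)
  qed
  have "0 \<le> u" "v \<le> 1" using uv q_01[of j] q_01[of "j - 1"] V_bounds[OF ij(2)] by auto
  with x(2) uv obtain k where k: "(s ^^ k) x \<in> {u<..<v}" unfolding dense_orbit_def by blast
  then have "k \<noteq> 0" using uv by (intro notI) simp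
  moreover have "(s ^^ k) x \<in> J j" using k uv by (auto simp: J_def)
  then have "(i, j) \<in> E ^^ k" using orbit_path[OF ij x(1)] by blast
  ultimately show "(i, j) \<in> E\<^sup>+" by (auto simp: trancl_power)
qed

lemma dense_orbits_imp_not_isometry:
  assumes "AE x in leb01. dense_orbit s x"
  shows "\<not> (\<forall>x\<in>{0..1}. s x = x)" "\<not> (\<forall>x\<in>{0..1}. s x = 1 - x)"
proof -
  interpret L: prob_space leb01 by (rule prob_space_leb01)
  have "\<exists>x\<in>{0..1}. dense_orbit s x"
  proof (rule ccontr)
    assume *: "\<not> ?thesis"
    have "AE x in leb01. x \<in> {0..1}" by (rule AE_I2) simp
    then have "AE x in leb01. False" using assms by eventually_elim (use * in auto)
    then show False by simp
  qed
  then obtain x where x: "x \<in> {0..1}" "dense_orbit s x" by blast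
  show "\<not> (\<forall>x\<in>{0..1}. s x = x)"
  proof
    assume id: "\<forall>x\<in>{0..1}. s x = x"
    have "(s ^^ k) x = x" for k using id x(1) by (induction k) auto
    then show False using dense_orbit_infinite[OF x(2)] by blast
  qed
  show "\<not> (\<forall>x\<in>{0..1}. s x = 1 - x)"
  proof
    assume flip: "\<forall>x\<in>{0..1}. s x = 1 - x"
    have "(s ^^ k) x = x \<or> (s ^^ k) x = 1 - x" for k using flip x(1) by (induction k) auto
    then show False using dense_orbit_infinite[OF x(2)] by blast
  qed
qed

lemma return_time_dvd:
  assumes "v \<in> V" "x \<in> J v" "(s ^^ k) x \<in> J v"
  shows "graph_period E v dvd k"
proof (cases "k = 0")
  case False
  then show ?thesis unfolding graph_period_def using orbit_path[OF assms(1,1,2,3)] by (intro Gcd_dvd) simp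
qed simp

text \<open>Mixing makes returns to the open interval possible at all large times; the period
  divides two consecutive ones.\<close>

lemma mixing_imp_aperiodic:
  assumes dom: "dominating01 s M" and mix: "mixing_map M s" and v: "v \<in> V"
  shows "graph_period E v = 1"
proof (rule ccontr)
  assume d: "graph_period E v \<noteq> 1"
  have J: "J v \<in> sets M" "measure M (J v) > 0"
    using dominating01_interval_pos[OF dom, of "q (v - 1)" "q v"] q_01[of v] q_01[of "v - 1"] V_bounds[OF v] len_pos[OF v]
    by (auto simp: J_def len_def)
  then have "(\<lambda>k. measure M (J v \<inter> ((s ^^ k) -` J v \<inter> space M))) \<longlonglongrightarrow> measure M (J v) * measure M (J v)"
    using mix by (auto simp: mixing_map_def)
  then have "\<forall>\<^sub>F k in sequentially. measure M (J v \<inter> ((s ^^ k) -` J v \<inter> space M)) > 0"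
    by (rule order_tendstoD(1)) (use J in simp)
  then obtain N where N: "\<And>k. k \<ge> N \<Longrightarrow> measure M (J v \<inter> ((s ^^ k) -` J v \<inter> space M)) > 0"
    by (auto simp: eventually_sequentially)
  have dvd: "graph_period E v dvd k" if "k \<ge> N" for k
  proof -
    have "J v \<inter> ((s ^^ k) -` J v \<inter> space M) \<noteq> {}" using N[OF that] by auto
    then show ?thesis using return_time_dvd[OF v] by blast
  qed
  have "graph_period E v dvd Suc N - N" using dvd[of N] dvd[of "Suc N"] by (intro dvd_diff_nat) auto
  then show False using d by simp
qed

text \<open>With \<open>d\<close> the period, consider the points that reach \<open>J v\<close> at a
  time divisible by \<open>d\<close>. The part of this set invariant under the \<open>d\<close>-th
  iterate is a tail set of positive measure, so it is almost everything and contains some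
  \<open>x\<close> together with \<open>s x\<close>. Hence \<open>J v\<close> is visited at times
  congruent to 0 and to 1 modulo \<open>d\<close>, while differences of visiting times are multiples
  of \<open>d\<close>.\<close>

lemma exact_imp_aperiodic:
  assumes dom: "dominating01 s M" and ex: "exact_map M s" and v: "v \<in> V" and vv: "(v, v) \<in> E\<^sup>+"
  shows "graph_period E v = 1"
proof (rule ccontr)
  assume d1: "graph_period E v \<noteq> 1"
  interpret P: prob_space M using dom by (simp add: dominating01_def)
  have prob: "prob_space M" and pres: "preserves_measure M s" using dom by (auto simp: dominating01_def)
  define d where "d = graph_period E v"
  obtain n where n: "0 < n" "(v, v) \<in> E ^^ n" using vv by (auto simp: trancl_power)
  then have "d dvd n" unfolding d_def graph_period_def by (intro Gcd_dvd) simp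
  \<comment> \<open>A closed path exists, so the gcd is not the 0 of an empty set.\<close>
  then have d0: "d > 0" using n by (auto intro: Nat.gr0I)
  have sp: "s \<in> space M \<rightarrow> space M" using pres by (auto simp: preserves_measure_def measurable_def)
  have sp': "(s ^^ k) \<in> space M \<rightarrow> space M" for k using sp by (induction k) auto
  have J: "J v \<in> sets M" "measure M (J v) > 0"
    using dominating01_interval_pos[OF dom, of "q (v - 1)" "q v"] q_01[of v] q_01[of "v - 1"] V_bounds[OF v] len_pos[OF v]
    by (auto simp: J_def len_def)
  define T where "T = s ^^ d"
  have presT: "preserves_measure M T"
    unfolding preserves_measure_def T_def using preserves_measure_funpow[OF pres] by blast
  have T_pow: "T ^^ k = s ^^ (d * k)" for k by (simp add: T_def funpow_mult)
  define W where "W = (\<Union>k. (T ^^ k) -` J v \<inter> space M)"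
  have W: "W \<in> sets M"
    unfolding W_def using measurable_sets[OF preserves_measure_funpow(1)[OF presT] J(1)]
    by (intro sets.countable_UN) blast
  have "T -` W \<inter> space M \<subseteq> W"
  proof
    fix x assume x: "x \<in> T -` W \<inter> space M"
    then obtain k where "(T ^^ k) (T x) \<in> J v" by (auto simp: W_def)
    then have "(T ^^ Suc k) x \<in> J v" by (simp add: funpow_swap1)
    with x show "x \<in> W" unfolding W_def by blast
  qed
  from sub_invariant_imp_invariant[OF prob presT W this] obtain W' where
    W': "W' \<in> sets M" "W' \<subseteq> W" "T -` W' \<inter> space M = W'" "measure M W' = measure M W" by blast
  have TW': "(T ^^ k) -` W' \<inter> space M = W'" for k
  proof (induction k)
    case (Suc k)
    have "T \<in> space M \<rightarrow> space M" unfolding T_def by (rule sp')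
    from funpow_vimage_Suc[OF this, of k W'] show ?case using Suc W'(3) by (simp only:)
  qed (use sets.sets_into_space[OF W'(1)] in auto)
  \<comment> \<open>Using the invariance under the \<open>d\<close>-th iterate \<open>k\<close>
    times covers at least \<open>k\<close> steps of \<open>s\<close>.\<close>
  have "W' \<in> (\<lambda>B. (s ^^ k) -` B \<inter> space M) ` sets M" for k
  proof
    have "k \<le> d * k" using d0 by simp
    then have eq: "(T ^^ k) x = (s ^^ (d * k - k)) ((s ^^ k) x)" for x
      by (metis T_pow comp_apply funpow_add le_add_diff_inverse2)
    have "(T ^^ k) -` W' \<inter> space M = (s ^^ k) -` ((s ^^ (d * k - k)) -` W' \<inter> space M) \<inter> space M"
      using sp'[of k] by (auto simp: eq)
    then show "W' = (s ^^ k) -` ((s ^^ (d * k - k)) -` W' \<inter> space M) \<inter> space M" using TW'[of k] by (simp only:)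
    show "(s ^^ (d * k - k)) -` W' \<inter> space M \<in> sets M"
      using preserves_measure_funpow(1)[OF pres] W'(1) by (rule measurable_sets)
  qed
  then have "W' \<in> (\<Inter>k. (\<lambda>B. (s ^^ k) -` B \<inter> space M) ` sets M)" by (intro INT_I)
  then have "measure M W' = 0 \<or> measure M W' = 1" using ex unfolding exact_map_def by (rule bspec[rotated])
  moreover have "J v \<subseteq> W"
  proof
    fix x assume x: "x \<in> J v"
    then have "x \<in> (T ^^ 0) -` J v \<inter> space M" using sets.sets_into_space[OF J(1)] by auto
    then show "x \<in> W" unfolding W_def by blast
  qed
  then have "measure M W' > 0" using P.finite_measure_mono[OF _ W, of "J v"] J(2) W'(4) by simp
  ultimately have "measure M W' = 1" by simp
  moreover have sW': "s -` W' \<inter> space M \<in> sets M" "measure M (s -` W' \<inter> space M) = measure M W'"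
    using pres W'(1) by (auto simp: preserves_measure_def measure_def intro: measurable_sets)
  ultimately have "AE x in M. x \<in> W'" "AE x in M. x \<in> s -` W' \<inter> space M"
    using W'(1) by (simp_all only: P.AE_in_set_eq_1)
  then have "AE x in M. \<exists>x. x \<in> W' \<and> s x \<in> W'" by eventually_elim auto
  then obtain x where "x \<in> W'" "s x \<in> W'" by auto
  then have "x \<in> W" "s x \<in> W" using W'(2) by auto
  then obtain k l where kl: "(s ^^ (d * k)) x \<in> J v" "(s ^^ (d * l)) (s x) \<in> J v"
    by (auto simp: W_def T_pow)
  have kl': "(s ^^ (d * l + 1)) x \<in> J v" using kl(2) by (simp add: funpow_swap1)
  have key: "d dvd m - n" if "(s ^^ n) x \<in> J v" "(s ^^ m) x \<in> J v" "n \<le> m" for n m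
  proof -
    have "(s ^^ m) x = (s ^^ (m - n)) ((s ^^ n) x)"
      using that(3) by (metis comp_apply funpow_add le_add_diff_inverse2)
    then show ?thesis unfolding d_def using return_time_dvd[OF v that(1)] that(2) by simp
  qed
  have "d dvd 1"
  proof (cases "d * k \<le> d * l + 1")
    case True
    then have "d dvd d * l + 1 - d * k" using key[OF kl(1) kl'] by simp
    then have "d dvd (d * l + 1 - d * k) + d * k" by (intro dvd_add) auto
    then have "d dvd d * l + 1" using True by simp
    then show ?thesis by (metis dvd_add_right_iff dvd_triv_left)
  next
    case False
    then have "d dvd d * k - (d * l + 1)" using key[OF kl' kl(1)] by simp
    then have "d dvd d * k - (d * k - (d * l + 1))" by (rule dvd_diff_nat[OF dvd_triv_left])
    moreover have "d * k - (d * k - (d * l + 1)) = d * l + 1" using False by (intro diff_diff_cancel) simp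
    ultimately have "d dvd d * l + 1" by (simp only:)
    then show ?thesis by (metis dvd_add_right_iff dvd_triv_left)
  qed
  then show False using d1 by (simp add: d_def)
qed

end

section \<open>Uniform mixing for primitive graphs\<close>

context expanding_markov_map
begin

lemma weight_bounds: "B \<in> sets borel \<Longrightarrow> 0 \<le> weight B \<and> weight B \<le> 1"
proof -
  assume B: "B \<in> sets borel"
  have "weight B \<le> (\<Sum>i\<in>V. c i * len i)"
    unfolding weight_def
  proof (rule sum_mono)
    fix i assume i: "i \<in> V"
    have "mass B i \<le> len i" using ratio_bounds[OF B i] len_pos[OF i] by (simp add: ratio_def)
    then show "c i * mass B i \<le> c i * len i" using c_pos[OF i] by simp
  qed
  then show ?thesis using c_sum weight_nonneg[OF B] by simp
qed

lemma weight_preim_funpow: "B \<in> sets borel \<Longrightarrow> weight ((preim ^^ n) B) = weight B"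
  by (induction n) (auto simp: weight_preim borel_preim_funpow)

text \<open>\<open>weight B\<close> is a convex combination of the ratios, with coefficients
  \<open>c j * len j\<close>, so it is as close to each ratio as they are to one another.\<close>

lemma ratio_deviation:
  assumes B: "B \<in> sets borel" and osc: "\<And>i j. i \<in> V \<Longrightarrow> j \<in> V \<Longrightarrow> \<bar>ratio B i - ratio B j\<bar> \<le> e" and i: "i \<in> V"
  shows "\<bar>ratio B i - weight B\<bar> \<le> e"
proof -
  have "weight B = (\<Sum>j\<in>V. c j * len j * ratio B j)"
    unfolding weight_def using len_pos by (intro sum.cong) (auto simp: ratio_def less_imp_neq[symmetric])
  then have "ratio B i - weight B = (\<Sum>j\<in>V. c j * len j * (ratio B i - ratio B j))"
    using c_sum by (simp add: right_diff_distrib sum_subtractf flip: sum_distrib_right)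
  then have "\<bar>ratio B i - weight B\<bar> \<le> (\<Sum>j\<in>V. \<bar>c j * len j * (ratio B i - ratio B j)\<bar>)"
    using sum_abs[of "\<lambda>j. c j * len j * (ratio B i - ratio B j)" V] by simp
  also have "\<dots> \<le> (\<Sum>j\<in>V. c j * len j * e)"
    using osc[OF i] c_pos len_pos
    by (intro sum_mono) (auto simp: abs_mult less_imp_le intro!: mult_left_mono)
  finally show ?thesis using c_sum by (simp flip: sum_distrib_right)
qed

text \<open>The convergence is uniform in \<open>B\<close>; this is what yields exactness along with mixing.\<close>

lemma uniform_mixing_intervals:
  assumes prim: "primitive_graph V E" and e: "e > 0"
  shows "\<forall>\<^sub>F n in sequentially. \<forall>B\<in>sets borel. \<forall>v\<in>{0..1}. \<bar>cum ((preim ^^ n) B) v - weight B * v\<bar> \<le> e"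
proof -
  define K where "K = 4 * real r + 6"
  have K: "K > 0" by (simp add: K_def)
  \<comment> \<open>\<open>K\<close> is the factor in \<open>contraction\<close>: half of
    \<open>e\<close> pays for the Markov points, the other half for the term
    \<open>1 / 2 ^ k\<close>.\<close>
  define \<epsilon> where "\<epsilon> = e / (2 * K)"
  have \<epsilon>: "\<epsilon> > 0" using e K by (simp add: \<epsilon>_def)
  obtain N0 where N0: "\<And>i j. i \<in> V \<Longrightarrow> j \<in> V \<Longrightarrow> (i, j) \<in> chain.support ^^ N0"
    using primitive_graph_eventually[OF finite_V prim] by (auto simp: chain_support)
  obtain N where N: "\<And>n f i j. n \<ge> N \<Longrightarrow> \<forall>j\<in>V. 0 \<le> f j \<and> f j \<le> 1 \<Longrightarrow> i \<in> V \<Longrightarrow> j \<in> V \<Longrightarrow>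
      \<bar>(chain.avg ^^ n) f i - (chain.avg ^^ n) f j\<bar> \<le> \<epsilon>"
    using chain.uniform_oscillation_decay[OF N0 \<epsilon>] by blast
  have "(\<lambda>k. 1 / 2 ^ k :: real) \<longlonglongrightarrow> 0" by real_asymp
  then have "\<forall>\<^sub>F k in sequentially. 1 / 2 ^ k < e / 2" using e by (intro order_tendstoD) auto
  then obtain k where k: "1 / 2 ^ k < e / 2" by (auto simp: eventually_sequentially)
  have "\<bar>cum ((preim ^^ n) B) v - weight B * v\<bar> \<le> e"
    if n: "n \<ge> N + k * (r + 1)" and B: "B \<in> sets borel" and v: "v \<in> {0..1}" for n B v
  proof -
    let ?B = "\<lambda>n. (preim ^^ n) B"
    have Bn: "?B n \<in> sets borel" for n by (rule borel_preim_funpow[OF B])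
    have dev: "\<bar>ratio (?B n) i - weight B\<bar> \<le> \<epsilon>" if "n \<ge> N" "i \<in> V" for n i
    proof -
      have "\<bar>ratio (?B n) i - ratio (?B n) j\<bar> \<le> \<epsilon>" if "i \<in> V" "j \<in> V" for i j
        using N[OF \<open>n \<ge> N\<close> _ that, of "ratio B"] ratio_bounds[OF B] ratio_preim_funpow[OF B] that by simp
      from ratio_deviation[OF Bn this \<open>i \<in> V\<close>] show ?thesis by (simp add: weight_preim_funpow[OF B])
    qed
    have "\<bar>cum (?B n) v - weight B * v\<bar> \<le> 1 / 2 ^ k + (4 * real r + 6) * \<epsilon>"
    proof (rule contraction[where N = N and n = n and H = "\<lambda>n v. cum (?B n) v - weight B * v"])
      show "\<bar>cum (?B n) v - weight B * v\<bar> \<le> 1" if "v \<in> {0..1}" for n v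
      proof -
        have "0 \<le> cum (?B n) v" "cum (?B n) v \<le> 1" using cum_nonneg cum_le[OF Bn, of v n] that by auto
        moreover have "0 \<le> weight B * v" "weight B * v \<le> 1"
          using weight_bounds[OF B] that mult_mono[of "weight B" 1 v 1] by auto
        ultimately show ?thesis by linarith
      qed
      \<comment> \<open>The deviation at a Markov point is a sum of deviations of ratios weighted by
        lengths, and these lengths total at most 1.\<close>
      show "\<bar>cum (?B n) (q i) - weight B * q i\<bar> \<le> \<epsilon>" if "n \<ge> N" "i \<le> r" for n i
      proof -
        have sub: "{1..i} \<subseteq> V" using that by (auto simp: V_def)
        have "cum (?B n) (q i) - weight B * q i = (\<Sum>j\<in>{1..i}. mass (?B n) j) - weight B * (\<Sum>j\<in>{1..i}. len j)"
          using sum_mass_upto[OF that(2)] sum_len_upto[OF that(2)] by simp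
        also have "\<dots> = (\<Sum>j\<in>{1..i}. len j * (ratio (?B n) j - weight B))"
          unfolding sum_distrib_left sum_subtractf[symmetric] using len_pos sub
          by (intro sum.cong) (auto simp: ratio_def field_simps less_imp_neq[symmetric])
        finally have "\<bar>cum (?B n) (q i) - weight B * q i\<bar> \<le> (\<Sum>j\<in>{1..i}. \<bar>len j * (ratio (?B n) j - weight B)\<bar>)"
          using sum_abs[of "\<lambda>j. len j * (ratio (?B n) j - weight B)" "{1..i}"] by simp
        also have "\<dots> \<le> (\<Sum>j\<in>{1..i}. len j * \<epsilon>)"
          using dev[OF that(1)] len_pos sub
          by (intro sum_mono) (auto simp: abs_mult less_imp_le subset_iff intro!: mult_left_mono)
        also have "\<dots> = q i * \<epsilon>" using sum_len_upto[OF that(2)] by (simp flip: sum_distrib_right)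
        also have "\<dots> \<le> 1 * \<epsilon>" using q_01[OF that(2)] \<epsilon> by (intro mult_right_mono) auto
        finally show ?thesis by simp
      qed
    qed (use v n cum_deviation_rec[OF Bn, where \<theta> = "weight B"] in \<open>auto simp: K_def\<close>)
    also have "(4 * real r + 6) * \<epsilon> = e / 2" unfolding K_def[symmetric] using K by (simp add: \<epsilon>_def)
    finally show ?thesis using k by linarith
  qed
  then show ?thesis unfolding eventually_sequentially by blast
qed

text \<open>Dynkin induction passes from intervals to all Borel sets \<open>D\<close>. The
  quantifier over \<open>B\<close> stays inside the limit, so that uniformity is kept.\<close>

lemma uniform_mixing_lebesgue:
  assumes prim: "primitive_graph V E" and D: "D \<in> sets borel" "D \<subseteq> {0..1}" and e: "e > 0"
  shows "\<forall>\<^sub>F n in sequentially. \<forall>B\<in>sets borel. \<bar>measure lborel (D \<inter> (preim ^^ n) B) - weight B * measure lborel D\<bar> \<le> e"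
proof -
  define Q where "Q D \<longleftrightarrow> (\<forall>e>0. \<forall>\<^sub>F n in sequentially. \<forall>B\<in>sets borel.
      \<bar>measure lborel (D \<inter> (preim ^^ n) B) - weight B * measure lborel D\<bar> \<le> e)" for D
  have fm: "A \<inter> X \<in> fmeasurable lborel" if "A \<in> sets borel" "A \<subseteq> {0..1::real}" "X \<in> sets borel" for A X
    using that by (intro fmeasurable_unit) auto
  have "Q (D \<inter> {0..1})"
    using D(1)
  proof (induction rule: borel_unit_interval_induct)
    case (interval v)
    show ?case
      unfolding Q_def
    proof (intro allI impI)
      fix e :: real assume "e > 0"
      from uniform_mixing_intervals[OF prim this]
      show "\<forall>\<^sub>F n in sequentially. \<forall>B\<in>sets borel.
          \<bar>measure lborel ({0..v} \<inter> (preim ^^ n) B) - weight B * measure lborel {0..v}\<bar> \<le> e"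
        by eventually_elim (use interval in \<open>auto simp: cum_def\<close>)
    qed
  next
    case (compl A)
    show ?case
      unfolding Q_def
    proof (intro allI impI)
      fix e :: real assume e: "e > 0"
      from uniform_mixing_intervals[OF prim, of "e / 2"] e
      have "\<forall>\<^sub>F n in sequentially. \<forall>B\<in>sets borel. \<forall>v\<in>{0..1}. \<bar>cum ((preim ^^ n) B) v - weight B * v\<bar> \<le> e / 2" by simp
      moreover have "\<forall>\<^sub>F n in sequentially. \<forall>B\<in>sets borel.
          \<bar>measure lborel (A \<inter> (preim ^^ n) B) - weight B * measure lborel A\<bar> \<le> e / 2"
        using compl(3)[unfolded Q_def, rule_format, of "e / 2"] e by simp
      ultimately show "\<forall>\<^sub>F n in sequentially. \<forall>B\<in>sets borel.
          \<bar>measure lborel (({0..1} - A) \<inter> (preim ^^ n) B) - weight B * measure lborel ({0..1} - A)\<bar> \<le> e"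
      proof eventually_elim
        case (elim n)
        show ?case
        proof
          fix B :: "real set" assume B: "B \<in> sets borel"
          let ?X = "(preim ^^ n) B"
          have X: "?X \<in> sets borel" by (rule borel_preim_funpow[OF B])
          have "({0..1} - A) \<inter> ?X = {0..1} \<inter> ?X - A \<inter> ?X" by auto
          then have "measure lborel (({0..1} - A) \<inter> ?X) = cum ?X 1 - measure lborel (A \<inter> ?X)"
            using compl X unfolding cum_def by (simp only:) (intro measurable_measure_Diff, auto intro!: fm)
          moreover have "measure lborel ({0..1} - A) = 1 - measure lborel A"
            using compl measurable_measure_Diff[of "{0..1}" lborel A] by (simp add: fmeasurable_unit)
          moreover have "\<bar>cum ?X 1 - weight B * 1\<bar> \<le> e / 2" by (rule bspec[OF bspec[OF elim(1) B]]) simp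
          moreover have "\<bar>measure lborel (A \<inter> ?X) - weight B * measure lborel A\<bar> \<le> e / 2" by (rule bspec[OF elim(2) B])
          ultimately show "\<bar>measure lborel (({0..1} - A) \<inter> ?X) - weight B * measure lborel ({0..1} - A)\<bar> \<le> e"
            by (simp only: right_diff_distrib mult_1_right)
        qed
      qed
    qed
  next
    case (union A)
    show ?case
      unfolding Q_def
    proof (intro allI impI)
      fix e :: real assume e: "e > 0"
      let ?U = "\<Union>i. A i"
      have AX: "disjoint_family (\<lambda>i. A i \<inter> X)" for X using union(1) by (auto simp: disjoint_family_on_def)
      have sA: "(\<lambda>i. measure lborel (A i)) sums measure lborel ?U"
        using union by (intro measure_unit_UN) auto
      then have "(\<lambda>K. \<Sum>i<K. measure lborel (A i)) \<longlonglongrightarrow> measure lborel ?U" by (simp add: sums_def)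
      then have "\<forall>\<^sub>F K in sequentially. measure lborel ?U - e / 4 < (\<Sum>i<K. measure lborel (A i))"
        using e by (intro order_tendstoD) auto
      \<comment> \<open>The tail beyond \<open>K\<close> has small Lebesgue measure, which also
        bounds its intersection with any preimage; so the cut does not depend on
        \<open>B\<close>.\<close>
      then obtain K where K: "measure lborel ?U - e / 4 < (\<Sum>i<K. measure lborel (A i))"
        by (auto simp: eventually_sequentially)
      have "\<forall>\<^sub>F n in sequentially. \<forall>i\<in>{..<K}. \<forall>B\<in>sets borel.
          \<bar>measure lborel (A i \<inter> (preim ^^ n) B) - weight B * measure lborel (A i)\<bar> \<le> e / (4 * (real K + 1))"
        unfolding eventually_ball_finite_distrib[OF finite_lessThan] using union(4) e by (auto simp: Q_def)
      then show "\<forall>\<^sub>F n in sequentially. \<forall>B\<in>sets borel.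
          \<bar>measure lborel (?U \<inter> (preim ^^ n) B) - weight B * measure lborel ?U\<bar> \<le> e"
      proof eventually_elim
        case (elim n)
        show ?case
        proof
          fix B :: "real set" assume B: "B \<in> sets borel"
          let ?X = "(preim ^^ n) B"
          have X: "?X \<in> sets borel" by (rule borel_preim_funpow[OF B])
          have sX: "(\<lambda>i. measure lborel (A i \<inter> ?X)) sums measure lborel (?U \<inter> ?X)"
          proof -
            have "(\<lambda>i. measure lborel (A i \<inter> ?X)) sums measure lborel (\<Union>i. A i \<inter> ?X)"
              using union X by (intro measure_unit_UN AX) auto
            then show ?thesis by (simp add: Int_commute Int_UN_distrib)
          qed
          have le: "measure lborel (A i \<inter> ?X) \<le> measure lborel (A i)" for i
            using union X by (intro measure_mono_fmeasurable fmeasurable_unit) auto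
          define a1 where "a1 = (\<Sum>i<K. measure lborel (A i))"
          define x1 where "x1 = (\<Sum>i<K. measure lborel (A i \<inter> ?X))"
          have tail: "x1 \<le> measure lborel (?U \<inter> ?X)" "a1 \<le> measure lborel ?U"
            "measure lborel (?U \<inter> ?X) - x1 \<le> measure lborel ?U - a1"
          proof -
            show "x1 \<le> measure lborel (?U \<inter> ?X)"
              unfolding x1_def sums_unique[OF sX] by (rule sum_le_suminf) (use sX in \<open>auto simp: sums_iff\<close>)
            show "a1 \<le> measure lborel ?U"
              unfolding a1_def sums_unique[OF sA] by (rule sum_le_suminf) (use sA in \<open>auto simp: sums_iff\<close>)
            have "measure lborel (?U \<inter> ?X) - x1 = (\<Sum>i. measure lborel (A (i + K) \<inter> ?X))"
              unfolding x1_def sums_unique[OF sX] using sX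
              by (subst suminf_minus_initial_segment[symmetric]) (auto simp: sums_iff)
            also have "\<dots> \<le> (\<Sum>i. measure lborel (A (i + K)))"
              using le sX sA by (intro suminf_le) (auto simp: sums_iff intro: summable_ignore_initial_segment)
            also have "\<dots> = measure lborel ?U - a1"
              unfolding a1_def sums_unique[OF sA] using sA
              by (subst suminf_minus_initial_segment[symmetric]) (auto simp: sums_iff)
            finally show "measure lborel (?U \<inter> ?X) - x1 \<le> measure lborel ?U - a1" .
          qed
          have "\<bar>x1 - weight B * a1\<bar> \<le> (\<Sum>i<K. \<bar>measure lborel (A i \<inter> ?X) - weight B * measure lborel (A i)\<bar>)"
            unfolding x1_def a1_def sum_distrib_left sum_subtractf[symmetric] by (rule sum_abs)
          \<comment> \<open>The \<open>K\<close> tolerances add up to at most \<open>e / 4\<close>;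
            the added 1 keeps each of them positive when \<open>K = 0\<close>.\<close>
          also have "\<dots> \<le> (\<Sum>i<K. e / (4 * (real K + 1)))" using elim B by (intro sum_mono) auto
          also have "\<dots> \<le> e / 4" using e by (simp add: field_simps)
          finally have 1: "\<bar>x1 - weight B * a1\<bar> \<le> e / 4" .
          have "weight B * (measure lborel ?U - a1) \<le> 1 * (e / 4)"
            using weight_bounds[OF B] tail K by (intro mult_mono) (auto simp: a1_def)
          moreover have "0 \<le> weight B * (measure lborel ?U - a1)" using weight_bounds[OF B] tail by simp
          ultimately show "\<bar>measure lborel (?U \<inter> ?X) - weight B * measure lborel ?U\<bar> \<le> e"
            using 1 tail K e unfolding a1_def[symmetric] right_diff_distrib by linarith
        qed
      qed
    qed
  qed (simp add: Q_def)
  then show ?thesis using D(2) e by (simp add: Q_def Int_absorb2)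
qed

lemma uniform_mixing_\<mu>:
  assumes prim: "primitive_graph V E" and A: "A \<in> sets \<mu>" and e: "e > 0"
  shows "\<forall>\<^sub>F n in sequentially. \<forall>B\<in>sets \<mu>.
    \<bar>measure \<mu> (A \<inter> ((s ^^ n) -` B \<inter> space \<mu>)) - measure \<mu> A * measure \<mu> B\<bar> \<le> e"
proof -
  have A': "A \<in> sets borel" "A \<subseteq> {0..1}" using A by (auto simp: sets_\<mu> in_sets_leb01)
  define C where "C = (\<Sum>i\<in>V. c i)"
  have C: "C > 0" unfolding C_def using c_pos finite_V V_ne by (intro sum_pos) auto
  have IA: "I i \<inter> A \<in> sets borel" "I i \<inter> A \<subseteq> {0..1}" for i using A' by (auto simp: I_def)
  have "\<forall>\<^sub>F n in sequentially. \<forall>i\<in>V. \<forall>B\<in>sets borel.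
      \<bar>measure lborel (I i \<inter> A \<inter> (preim ^^ n) B) - weight B * measure lborel (I i \<inter> A)\<bar> \<le> e / C"
    unfolding eventually_ball_finite_distrib[OF finite_V]
    using uniform_mixing_lebesgue[OF prim IA] e C by auto
  then show ?thesis
  proof eventually_elim
    case (elim n)
    show ?case
    proof
      fix B assume "B \<in> sets \<mu>"
      then have B: "B \<in> sets borel" "B \<subseteq> {0..1}" by (auto simp: sets_\<mu> in_sets_leb01)
      let ?X = "(preim ^^ n) B"
      have X: "A \<inter> ?X \<in> sets borel" "A \<inter> ?X \<subseteq> {0..1}" using A' borel_preim_funpow[OF B(1)] by auto
      have eq: "measure \<mu> (A \<inter> ((s ^^ n) -` B \<inter> space \<mu>)) - measure \<mu> A * measure \<mu> B
          = (\<Sum>i\<in>V. c i * (measure lborel (I i \<inter> A \<inter> ?X) - weight B * measure lborel (I i \<inter> A)))"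
      proof -
        have "measure \<mu> (A \<inter> ((s ^^ n) -` B \<inter> space \<mu>)) = weight (A \<inter> ?X)"
          using measure_\<mu>[OF X] preim_funpow[OF B(2)] by simp
        also have "\<dots> = (\<Sum>i\<in>V. c i * measure lborel (I i \<inter> A \<inter> ?X))"
          unfolding weight_def by (intro sum.cong) (auto simp: mass_eq[OF X(1)] Int_assoc)
        moreover have "measure \<mu> A = (\<Sum>i\<in>V. c i * measure lborel (I i \<inter> A))"
          unfolding measure_\<mu>[OF A'] weight_def by (intro sum.cong) (auto simp: mass_eq[OF A'(1)])
        moreover have "(\<Sum>i\<in>V. c i * measure lborel (I i \<inter> A \<inter> ?X)) - (\<Sum>i\<in>V. c i * measure lborel (I i \<inter> A)) * weight B
            = (\<Sum>i\<in>V. c i * (measure lborel (I i \<inter> A \<inter> ?X) - weight B * measure lborel (I i \<inter> A)))"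
          unfolding sum_distrib_right sum_subtractf[symmetric]
          by (intro sum.cong refl) (simp add: algebra_simps)
        ultimately show ?thesis unfolding measure_\<mu>[OF B] by (simp only:)
      qed
      have "\<bar>measure \<mu> (A \<inter> ((s ^^ n) -` B \<inter> space \<mu>)) - measure \<mu> A * measure \<mu> B\<bar>
          \<le> (\<Sum>i\<in>V. \<bar>c i * (measure lborel (I i \<inter> A \<inter> ?X) - weight B * measure lborel (I i \<inter> A))\<bar>)"
        unfolding eq by (rule sum_abs)
      also have "\<dots> \<le> (\<Sum>i\<in>V. c i * (e / C))"
      proof (rule sum_mono)
        fix i assume i: "i \<in> V"
        from bspec[OF bspec[OF elim i] B(1)] c_pos[OF i]
        show "\<bar>c i * (measure lborel (I i \<inter> A \<inter> ?X) - weight B * measure lborel (I i \<inter> A))\<bar> \<le> c i * (e / C)"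
          unfolding abs_mult by (intro mult_mono) simp_all
      qed
      also have "\<dots> = C * (e / C)" unfolding C_def sum_distrib_right ..
      also have "\<dots> = e" using C by simp
      finally show "\<bar>measure \<mu> (A \<inter> ((s ^^ n) -` B \<inter> space \<mu>)) - measure \<mu> A * measure \<mu> B\<bar> \<le> e" .
    qed
  qed
qed

lemma \<mu>_mixing: "primitive_graph V E \<Longrightarrow> mixing_map \<mu> s"
  unfolding mixing_map_def
proof (intro ballI)
  fix A B assume prim: "primitive_graph V E" and AB: "A \<in> sets \<mu>" "B \<in> sets \<mu>"
  show "(\<lambda>k. measure \<mu> (A \<inter> ((s ^^ k) -` B \<inter> space \<mu>))) \<longlonglongrightarrow> measure \<mu> A * measure \<mu> B"
  proof (rule tendstoI)
    fix e :: real assume "e > 0"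
    then have "e / 2 > 0" by simp
    from uniform_mixing_\<mu>[OF prim AB(1) this]
    show "\<forall>\<^sub>F k in sequentially. dist (measure \<mu> (A \<inter> ((s ^^ k) -` B \<inter> space \<mu>))) (measure \<mu> A * measure \<mu> B) < e"
    proof eventually_elim
      case (elim k)
      from bspec[OF this AB(2)] \<open>e > 0\<close> show ?case unfolding dist_real_def by linarith
    qed
  qed
qed

text \<open>A tail set \<open>A\<close> is the preimage under the \<open>k\<close>-th iterate of
  some \<open>B\<close> of the same measure, so the quantity in \<open>uniform_mixing_\<mu>\<close>
  is the measure of \<open>A\<close> minus its square. As \<open>B\<close> changes with
  \<open>k\<close>, the estimate has to be uniform in \<open>B\<close>.\<close>

lemma \<mu>_exact: "primitive_graph V E \<Longrightarrow> exact_map \<mu> s"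
  unfolding exact_map_def
proof (intro ballI)
  fix A assume prim: "primitive_graph V E"
    and A: "A \<in> (\<Inter>k. (\<lambda>B. (s ^^ k) -` B \<inter> space \<mu>) ` sets \<mu>)"
  have A_eq: "\<exists>B\<in>sets \<mu>. A = (s ^^ k) -` B \<inter> space \<mu>" for k
    using INT_D[OF A UNIV_I, of k] by (rule imageE) blast
  have A_sets: "A \<in> sets \<mu>"
  proof -
    obtain B where B: "B \<in> sets \<mu>" "A = (s ^^ 0) -` B \<inter> space \<mu>" using A_eq by blast
    then have "A = B" using sets.sets_into_space[OF B(1)] by (simp only: funpow.simps vimage_id id_apply Int_absorb2)
    then show ?thesis using B by simp
  qed
  have small: "\<bar>measure \<mu> A - measure \<mu> A * measure \<mu> A\<bar> \<le> e" if "e > 0" for e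
  proof -
    obtain k where k: "\<forall>B\<in>sets \<mu>. \<bar>measure \<mu> (A \<inter> ((s ^^ k) -` B \<inter> space \<mu>)) - measure \<mu> A * measure \<mu> B\<bar> \<le> e"
      by (rule exE[OF eventually_happens'[OF sequentially_bot uniform_mixing_\<mu>[OF prim A_sets \<open>e > 0\<close>]]])
    obtain B where B: "B \<in> sets \<mu>" "A = (s ^^ k) -` B \<inter> space \<mu>" using A_eq by blast
    have "measure \<mu> A = measure \<mu> B"
      unfolding B(2) by (rule preserves_measure_funpow(3)[OF \<mu>_preserved B(1)])
    then show ?thesis using bspec[OF k B(1)] B(2)[symmetric] by simp
  qed
  have "\<bar>measure \<mu> A - measure \<mu> A * measure \<mu> A\<bar> \<le> 0"
    by (rule field_le_epsilon) (simp only: add_0 small)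
  then have "measure \<mu> A * (1 - measure \<mu> A) = 0" by (simp add: right_diff_distrib)
  then show "measure \<mu> A = 0 \<or> measure \<mu> A = 1" by simp
qed

lemma dominating_\<mu>: "dominating01 s \<mu>"
  using prob_space_\<mu> sets_\<mu> leb_ac_\<mu> \<mu>_preserved by (simp add: dominating01_def)

end


section \<open>McNaughton functions\<close>

text \<open>For continuous functions from the unit interval to itself this amounts to membership in
  \<open>mcnaughton\<close>, but it names no subdivision; closure under the operations then requires
  no common refinement.\<close>

definition selection :: "(int \<times> int) set \<Rightarrow> (real \<Rightarrow> real) \<Rightarrow> bool" where
  "selection F t \<longleftrightarrow> (\<forall>x\<in>{0..1}. \<exists>(a, b)\<in>F. t x = of_int a * x + of_int b)"

text \<open>The sets where \<open>t\<close> follows one of the finitely many lines are relatively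
  closed and, as the lines do not cross, disjoint; by connectedness one of them is the whole
  interval. Parallel lines never cross, so \<open>cross\<close> concerns different slopes
  only.\<close>

lemma selection_piece:
  assumes F: "finite F" and t: "continuous_on {0..1} t" "selection F t"
    and uv: "0 \<le> u" "u < v" "v \<le> 1"
    and cross: "\<And>a b a' b' x. (a, b) \<in> F \<Longrightarrow> (a', b') \<in> F \<Longrightarrow> a \<noteq> a' \<Longrightarrow> x \<in> {u<..<v} \<Longrightarrow>
      of_int a * x + of_int b \<noteq> of_int a' * x + of_int b'"
  shows "\<exists>(a, b)\<in>F. \<forall>x\<in>{u..v}. t x = of_int a * x + of_int b"
proof -
  let ?U = "{u<..<v}"
  define Z where "Z p = {x \<in> ?U. t x - (of_int (fst p) * x + of_int (snd p)) = 0}" for p :: "int \<times> int"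
  have cont: "continuous_on {u..v} t" by (rule continuous_on_subset[OF t(1)]) (use uv in auto)
  then have contU: "continuous_on ?U t" by (rule continuous_on_subset) auto
  have closed: "closedin (top_of_set ?U) (Z p)" for p
    unfolding Z_def by (intro continuous_closedin_preimage_constant continuous_intros contU)
  have mid: "(u + v) / 2 \<in> ?U" using uv by auto
  have "(u + v) / 2 \<in> {0..1}" using uv by auto
  then obtain p where p: "p \<in> F" "(u + v) / 2 \<in> Z p"
    using t(2) mid unfolding selection_def Z_def by (fastforce simp: case_prod_beta)
  define R where "R = (\<Union>p'\<in>F - {p}. Z p')"
  have "closedin (top_of_set ?U) R" unfolding R_def using F closed by (intro closedin_Union) auto
  moreover have "?U \<subseteq> Z p \<union> R"
  proof
    fix x assume x: "x \<in> ?U"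
    then have "x \<in> {0..1}" using uv by auto
    then obtain p' where "p' \<in> F" "x \<in> Z p'"
      using t(2) x unfolding selection_def Z_def by (fastforce simp: case_prod_beta)
    then show "x \<in> Z p \<union> R" by (cases "p' = p") (auto simp: R_def)
  qed
  moreover have "Z p \<inter> R = {}"
  proof (rule ccontr)
    assume "Z p \<inter> R \<noteq> {}"
    then obtain x p' where x: "x \<in> Z p" "p' \<in> F" "p' \<noteq> p" "x \<in> Z p'" by (auto simp: R_def)
    then have eq: "of_int (fst p) * x + of_int (snd p) = of_int (fst p') * x + of_int (snd p')"
      and xU: "x \<in> ?U" by (auto simp: Z_def)
    show False
    proof (cases "fst p = fst p'")
      case True
      with eq have "snd p = snd p'" by simp
      with True x show False by (simp add: prod_eq_iff)
    next
      case False
      then show False using cross[of "fst p" "snd p" "fst p'" "snd p'" x] p(1) x(2) xU eq by simp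
    qed
  qed
  moreover have "connected ?U" by simp
  ultimately have "R = {}" using closed[of p] p(2) unfolding connected_closedin by blast
  then have "?U \<subseteq> Z p" using \<open>?U \<subseteq> Z p \<union> R\<close> by simp
  \<comment> \<open>Continuity carries the identity over to the two end points.\<close>
  have "t x - (of_int (fst p) * x + of_int (snd p)) = 0" if x: "x \<in> {u..v}" for x
  proof (rule continuous_constant_on_closure[where S = ?U and x = x and a = 0 and
      f = "\<lambda>x. t x - (of_int (fst p) * x + of_int (snd p))"])
    have cl: "closure ?U = {u..v}" using uv by simp
    show "continuous_on (closure ?U) (\<lambda>x. t x - (of_int (fst p) * x + of_int (snd p)))"
      unfolding cl by (intro continuous_intros cont)
    show "x \<in> closure ?U" unfolding cl by (rule x)
  qed (use \<open>?U \<subseteq> Z p\<close> in \<open>auto simp: Z_def\<close>)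
  then show ?thesis using p(1) by (intro bexI[of _ p]) (auto simp: case_prod_beta)
qed

lemma selection_pieces:
  assumes F: "finite F" and t: "continuous_on {0..1} t" "selection F t"
  shows "\<exists>C. finite C \<and> {0, 1} \<subseteq> C \<and> C \<subseteq> {0..1} \<inter> \<rat> \<and>
    (\<forall>u v. 0 \<le> u \<longrightarrow> u < v \<longrightarrow> v \<le> 1 \<longrightarrow> {u<..<v} \<inter> C = {} \<longrightarrow>
      (\<exists>a b :: int. \<forall>x\<in>{u..v}. t x = of_int a * x + of_int b))"
proof -
  \<comment> \<open>Abscissas of the crossings of two lines, rational because the coefficients are
    integers. For parallel lines the quotient by 0 is 0, which belongs to \<open>C\<close>
    anyway.\<close>
  define X where "X = (\<lambda>((a, b), (a', b')). real_of_int (b' - b) / of_int (a - a')) ` (F \<times> F)"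
  define C where "C = {0, 1} \<union> (X \<inter> {0..1})"
  have "finite C" using F by (simp add: C_def X_def)
  moreover have "C \<subseteq> {0..1} \<inter> \<rat>" by (auto simp: C_def X_def)
  moreover have "\<exists>a b :: int. \<forall>x\<in>{u..v}. t x = of_int a * x + of_int b"
    if uv: "0 \<le> u" "u < v" "v \<le> 1" and C: "{u<..<v} \<inter> C = {}" for u v
  proof -
    have "\<exists>(a, b)\<in>F. \<forall>x\<in>{u..v}. t x = of_int a * x + of_int b"
    proof (rule selection_piece[OF F t uv])
      fix a b a' b' x
      assume ab: "(a, b) \<in> F" "(a', b') \<in> F" "a \<noteq> a'" and x: "x \<in> {u<..<v}"
      show "of_int a * x + of_int b \<noteq> of_int a' * x + of_int b'"
      proof
        assume "of_int a * x + of_int b = of_int a' * x + of_int b'"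
        then have "x = real_of_int (b' - b) / of_int (a - a')" using ab(3) by (simp add: field_simps)
        then have "x \<in> X" using ab(1,2) by (force simp: X_def)
        then have "x \<in> C" using x uv by (auto simp: C_def)
        with C x show False by blast
      qed
    qed
    then show ?thesis by blast
  qed
  ultimately show ?thesis by (intro exI[of _ C]) (auto simp: C_def)
qed

text \<open>\<open>n\<close> and \<open>c\<close> are shaped like \<open>markov_size\<close> and
  \<open>markov_point\<close>, so that these facts can be folded into them.\<close>

lemma enumerate_finite_set:
  fixes C :: "real set"
  assumes C: "finite C" "{0, 1} \<subseteq> C" "C \<subseteq> {0..1}"
  defines "n \<equiv> card C - 1" and "c \<equiv> \<lambda>i. sorted_list_of_set C ! i"
  shows "0 < n" "c 0 = 0" "c n = 1" "\<And>i. i < n \<Longrightarrow> c i < c (Suc i)" "c ` {..n} = C"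
    "\<And>i. i < n \<Longrightarrow> {c i<..<c (Suc i)} \<inter> C = {}"
proof -
  define xs where "xs = sorted_list_of_set C"
  have xs: "set xs = C" "length xs = card C" "sorted_wrt (<) xs"
    using C(1) by (auto simp: xs_def strict_sorted_list_of_set)
  have "card {0, 1::real} \<le> card C" using C by (intro card_mono)
  then have card: "card C \<ge> 2" by simp
  then show n: "0 < n" by (simp add: n_def)
  have c: "c i = xs ! i" for i by (simp add: c_def xs_def)
  have mono: "c i < c j" if "i < j" "j \<le> n" for i j
    using sorted_wrt_nth_less[OF xs(3) that(1)] that card xs(2) by (simp add: c n_def)
  then show "\<And>i. i < n \<Longrightarrow> c i < c (Suc i)" by simp
  have "{..n} = {0..<length xs}" using card by (auto simp: n_def xs(2))
  then show im: "c ` {..n} = C" using nth_image[of "length xs" xs] xs(1) by (simp add: c cong: image_cong)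
  have mono_le: "c i \<le> c j" if "i \<le> j" "j \<le> n" for i j
    using mono[of i j] that by (cases "i = j") auto
  show "c 0 = 0"
  proof -
    obtain i where i: "i \<le> n" "c i = 0" using im C(2) by (metis atMost_iff imageE insert_subset)
    moreover have "c 0 \<in> {0..1}" using im C(3) by blast
    ultimately show ?thesis using mono_le[of 0 i] by auto
  qed
  show "c n = 1"
  proof -
    obtain i where i: "i \<le> n" "c i = 1" using im C(2) by (metis atMost_iff imageE insert_subset)
    moreover have "c n \<in> {0..1}" using im C(3) by blast
    ultimately show ?thesis using mono_le[of i n] by auto
  qed
  show "{c i<..<c (Suc i)} \<inter> C = {}" if i: "i < n" for i
  proof (rule ccontr)
    assume "\<not> ?thesis"
    then obtain j where j: "j \<le> n" "c i < c j" "c j < c (Suc i)" using im by auto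
    then have "\<not> j \<le> i" "\<not> Suc i \<le> j" using mono_le[of j i] mono_le[of "Suc i" j] i by auto
    then show False by simp
  qed
qed

lemma interval_in_piece:
  fixes c :: "nat \<Rightarrow> real"
  assumes "c 0 \<le> x" "x \<le> c n" "0 < n"
  shows "\<exists>i<n. x \<in> {c i..c (Suc i)}"
  using assms
proof (induction n)
  case (Suc n)
  show ?case
  proof (cases "n = 0 \<or> c n \<le> x")
    case True
    then show ?thesis using Suc.prems by (intro exI[of _ n]) auto
  next
    case False
    then obtain i where "i < n" "x \<in> {c i..c (Suc i)}" using Suc by fastforce
    then show ?thesis by (intro exI[of _ i]) auto
  qed
qed simp

lemma mcnaughton_iff_selection:
  "t \<in> mcnaughton \<longleftrightarrow> t \<in> {0..1} \<rightarrow>\<^sub>E {0..1} \<and> continuous_on {0..1} t \<and> (\<exists>F. finite F \<and> selection F t)"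
proof
  assume t: "t \<in> mcnaughton"
  then obtain n c where c: "c 0 = 0" "c n = (1::real)" "\<forall>i<n. c i < c (Suc i)"
      "\<forall>i<n. \<exists>a b :: int. \<forall>x\<in>{c i..c (Suc i)}. t x = of_int a * x + of_int b"
    by (auto simp: mcnaughton_def)
  then obtain a b where ab: "\<And>i x. i < n \<Longrightarrow> x \<in> {c i..c (Suc i)} \<Longrightarrow> t x = of_int (a i) * x + of_int (b i)" by metis
  have n: "0 < n" using c by (cases n) auto
  have "selection ((\<lambda>i. (a i, b i)) ` {..<n}) t"
    unfolding selection_def
  proof
    fix x :: real assume "x \<in> {0..1}"
    then obtain i where "i < n" "x \<in> {c i..c (Suc i)}" using interval_in_piece[of c x n] c n by auto
    then show "\<exists>(a, b)\<in>(\<lambda>i. (a i, b i)) ` {..<n}. t x = of_int a * x + of_int b" using ab by auto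
  qed
  moreover have "finite ((\<lambda>i. (a i, b i)) ` {..<n})" by simp
  ultimately show "t \<in> {0..1} \<rightarrow>\<^sub>E {0..1} \<and> continuous_on {0..1} t \<and> (\<exists>F. finite F \<and> selection F t)"
    using t unfolding mcnaughton_def by blast
next
  assume t: "t \<in> {0..1} \<rightarrow>\<^sub>E {0..1} \<and> continuous_on {0..1} t \<and> (\<exists>F. finite F \<and> selection F t)"
  then obtain F where F: "finite F" "selection F t" by blast
  obtain C where C: "finite C" "{0, 1} \<subseteq> C" "C \<subseteq> {0..1} \<inter> \<rat>" and
    pieces: "\<And>u v. 0 \<le> u \<Longrightarrow> u < v \<Longrightarrow> v \<le> 1 \<Longrightarrow> {u<..<v} \<inter> C = {} \<Longrightarrow>
      \<exists>a b :: int. \<forall>x\<in>{u..v}. t x = of_int a * x + of_int b"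
    using selection_pieces[OF F(1) _ F(2)] t by blast
  have C': "C \<subseteq> {0..1}" using C by blast
  note enum = enumerate_finite_set[OF C(1,2) C']
  let ?c = "\<lambda>i. sorted_list_of_set C ! i" and ?n = "card C - 1"
  have c01: "?c i \<in> {0..1}" if "i \<le> ?n" for i using enum(5) C' that by blast
  have "\<exists>a b :: int. \<forall>x\<in>{?c i..?c (Suc i)}. t x = of_int a * x + of_int b" if "i < ?n" for i
    using pieces[OF _ enum(4)[OF that] _ enum(6)[OF that]] c01[of i] c01[of "Suc i"] that by auto
  then show "t \<in> mcnaughton"
    unfolding mcnaughton_def using t enum(2,3,4) by (auto intro!: exI[of _ ?n] exI[of _ ?c])
qed

lemma mcnaughtonI:
  assumes "t \<in> {0..1} \<rightarrow>\<^sub>E {0..1}" "continuous_on {0..1} t" "finite F" "selection F t"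
  shows "t \<in> mcnaughton"
  using assms mcnaughton_iff_selection by blast

lemma mcnaughtonD:
  assumes "t \<in> mcnaughton"
  shows "\<And>x. x \<in> {0..1} \<Longrightarrow> t x \<in> {0..1}" "continuous_on {0..1} t" "t \<in> extensional {0..1}"
  using assms by (auto simp: mcnaughton_def PiE_iff)

lemma mcnaughton_bounds:
  assumes "t \<in> mcnaughton" "0 \<le> x" "x \<le> 1"
  shows "0 \<le> t x" "t x \<le> 1"
  using mcnaughtonD(1)[OF assms(1), of x] assms by auto

lemma mcnaughton_eqI:
  "t \<in> mcnaughton \<Longrightarrow> u \<in> mcnaughton \<Longrightarrow> (\<And>x. x \<in> {0..1} \<Longrightarrow> t x = u x) \<Longrightarrow> t = u"
  by (rule extensionalityI[of _ "{0..1}"]) (auto dest: mcnaughtonD(3))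

lemma mcnaughton_selection:
  assumes "t \<in> mcnaughton"
  shows "\<exists>F. finite F \<and> (\<forall>x\<in>{0..1}. \<exists>(a, b)\<in>F. t x = of_int a * x + of_int b)"
  using assms mcnaughton_iff_selection by (auto simp: selection_def)

lemma continuous_on_restrict: "continuous_on A (\<lambda>x\<in>A. f x) = continuous_on A f"
  by (rule continuous_on_cong) auto

lemma mcnaughton_affine_clip:
  "(\<lambda>x\<in>{0..1}. max 0 (min 1 (of_int k * x + of_int m))) \<in> mcnaughton"
proof (rule mcnaughtonI)
  show "continuous_on {0..1} (\<lambda>x\<in>{0..1}. max 0 (min 1 (of_int k * x + of_int m)) :: real)"
    unfolding continuous_on_restrict by (intro continuous_intros)
  show "selection {(0, 0), (0, 1), (k, m)} (\<lambda>x\<in>{0..1}. max 0 (min 1 (of_int k * x + of_int m)))"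
    by (auto simp: selection_def max_def min_def)
qed auto

lemma mcnaughton_const: "(\<lambda>x\<in>{0..1}. 0) \<in> mcnaughton" "(\<lambda>x\<in>{0..1}. 1) \<in> mcnaughton"
  using mcnaughton_affine_clip[of 0 0] mcnaughton_affine_clip[of 0 1] by auto

text \<open>Each operation is an integer affine combination cut off at 0 or at 1, so the result
  follows combinations of the lines of its arguments, or a constant.\<close>

lemma mcnaughton_combine:
  fixes h :: "real \<Rightarrow> real \<Rightarrow> real" and k l m :: int
  assumes "t \<in> mcnaughton" "s \<in> mcnaughton"
    and h: "\<And>x y. h x y \<in> {0, 1, of_int k * x + of_int l * y + of_int m}"
    and h01: "\<And>x y. x \<in> {0..1} \<Longrightarrow> y \<in> {0..1} \<Longrightarrow> h x y \<in> {0..1}"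
    and hc: "continuous_on {0..1} (\<lambda>x. h (t x) (s x))"
  shows "(\<lambda>x\<in>{0..1}. h (t x) (s x)) \<in> mcnaughton"
proof -
  obtain F where F: "finite F" "\<And>x. x \<in> {0..1} \<Longrightarrow> \<exists>(a, b)\<in>F. t x = of_int a * x + of_int b"
    using mcnaughton_selection[OF assms(1)] by blast
  obtain G where G: "finite G" "\<And>x. x \<in> {0..1} \<Longrightarrow> \<exists>(a, b)\<in>G. s x = of_int a * x + of_int b"
    using mcnaughton_selection[OF assms(2)] by blast
  let ?H = "{(0, 0), (0, 1)} \<union> (\<lambda>((a, b), (a', b')). (k * a + l * a', k * b + l * b' + m)) ` (F \<times> G)"
  show ?thesis
  proof (rule mcnaughtonI)
    show "(\<lambda>x\<in>{0..1}. h (t x) (s x)) \<in> {0..1} \<rightarrow>\<^sub>E {0..1}"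
      using h01 mcnaughtonD(1)[OF assms(1)] mcnaughtonD(1)[OF assms(2)] by (intro restrict_PiE_iff[THEN iffD2]) blast
    show "finite ?H" using F G by simp
    show "selection ?H (\<lambda>x\<in>{0..1}. h (t x) (s x))"
      unfolding selection_def
    proof
      fix x :: real assume x: "x \<in> {0..1}"
      obtain a' b' where g: "(a', b') \<in> G" "s x = of_int a' * x + of_int b'" using G(2)[OF x] by blast
      obtain a b where f: "(a, b) \<in> F" "t x = of_int a * x + of_int b" using F(2)[OF x] by blast
      have "of_int k * t x + of_int l * s x + of_int m
          = of_int (k * a + l * a') * x + of_int (k * b + l * b' + m)"
        unfolding f(2) g(2) by (simp add: algebra_simps)
      then have hin: "h (t x) (s x) \<in> {0, 1, of_int (k * a + l * a') * x + of_int (k * b + l * b' + m)}"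
        using h[of "t x" "s x"] by (simp only:)
      moreover have "(k * a + l * a', k * b + l * b' + m) \<in> ?H" using f(1) g(1) by force
      ultimately show "\<exists>(a, b)\<in>?H. (\<lambda>x\<in>{0..1}. h (t x) (s x)) x = of_int a * x + of_int b"
      proof -
        let ?p = "(k * a + l * a', k * b + l * b' + m)"
        from hin consider "h (t x) (s x) = 0" | "h (t x) (s x) = 1"
          | "h (t x) (s x) = of_int (fst ?p) * x + of_int (snd ?p)"
          unfolding fst_conv snd_conv by blast
        then show ?thesis
        proof cases
          case 3
          then show ?thesis using x \<open>?p \<in> ?H\<close> by (intro bexI[of _ ?p]) (simp_all only: restrict_apply' case_prod_beta)
        qed (use x in auto)
      qed
    qed
  qed (use hc in \<open>simp only: continuous_on_restrict\<close>)
qed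

lemma univ_Free1 [simp]: "univ Free1 = mcnaughton"
  and mzero_Free1 [simp]: "mzero Free1 = (\<lambda>x\<in>{0..1}. 0)"
  and mone_Free1 [simp]: "mone Free1 = (\<lambda>x\<in>{0..1}. 1)"
  and mconj_Free1: "mconj Free1 a b = (\<lambda>x\<in>{0..1}. max 0 (a x + b x - 1))"
  and mimp_Free1: "mimp Free1 a b = (\<lambda>x\<in>{0..1}. min 1 (1 - a x + b x))"
  by (simp_all add: Free1_def)

lemma mconj_closed:
  assumes "a \<in> mcnaughton" "b \<in> mcnaughton"
  shows "mconj Free1 a b \<in> mcnaughton"
  unfolding mconj_Free1
proof (rule mcnaughton_combine[OF assms, where h = "\<lambda>x y. max 0 (x + y - 1)"])
  show "max 0 (x + y - 1) \<in> {0, 1, of_int 1 * x + of_int 1 * y + of_int (-1)}" for x y :: real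
    by (auto simp: max_def)
  show "continuous_on {0..1} (\<lambda>x. max 0 (a x + b x - 1))"
    using assms by (intro continuous_intros mcnaughtonD(2))
qed auto

lemma mimp_closed:
  assumes "a \<in> mcnaughton" "b \<in> mcnaughton"
  shows "mimp Free1 a b \<in> mcnaughton"
  unfolding mimp_Free1
proof (rule mcnaughton_combine[OF assms, where h = "\<lambda>x y. min 1 (1 - x + y)"])
  show "min 1 (1 - x + y) \<in> {0, 1, of_int (-1) * x + of_int 1 * y + of_int 1}" for x y :: real
    by (auto simp: min_def)
  show "continuous_on {0..1} (\<lambda>x. min 1 (1 - a x + b x))"
    using assms by (intro continuous_intros mcnaughtonD(2))
qed auto

lemma mv_join_Free1:
  assumes "a \<in> mcnaughton" "b \<in> mcnaughton"
  shows "mv_join Free1 a b = (\<lambda>x\<in>{0..1}. max (a x) (b x))"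
  unfolding mv_join_def mimp_Free1
proof (rule restrict_ext)
  fix x :: real assume x: "x \<in> {0..1}"
  then show "min 1 (1 - (\<lambda>x\<in>{0..1}. min 1 (1 - a x + b x)) x + b x) = max (a x) (b x)"
    using mcnaughton_bounds[OF assms(1), of x] mcnaughton_bounds[OF assms(2), of x] by (auto simp: min_def max_def)
qed

text \<open>The one-sided derivatives at \<open>m\<close> both equal \<open>D\<close>, so the slopes
  agree, and by the common value at \<open>m\<close> so do the constants.\<close>

lemma affine_merge:
  fixes s :: "real \<Rightarrow> real"
  assumes um: "0 \<le> u" "u < m" and mv: "m < v" "v \<le> 1" and d: "s differentiable (at m within {0..1})"
    and l: "\<forall>x\<in>{u..m}. s x = of_int a * x + of_int b" and r: "\<forall>x\<in>{m..v}. s x = of_int a' * x + of_int (b'::int)"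
  shows "\<forall>x\<in>{u..v}. s x = of_int a * x + of_int b"
proof -
  obtain D where D: "(s has_vector_derivative D) (at m within {0..1})"
    using d unfolding vector_derivative_works by blast
  have deriv: "D = of_int k" if "x < y" "{x..y} \<subseteq> {0..1}" "m \<in> {x..y}" "\<forall>z\<in>{x..y}. s z = of_int k * z + of_int l"
    for x y and k l :: int
  proof (rule vector_derivative_unique_within_closed_interval[of x y m s])
    show "(s has_vector_derivative D) (at m within cbox x y)"
      using has_vector_derivative_within_subset[OF D] that by simp
    have "((\<lambda>z. of_int k * z + of_int l) has_vector_derivative of_int k) (at m within cbox x y)"
      by (auto intro!: derivative_eq_intros simp: has_real_derivative_iff_has_vector_derivative[symmetric])
    then show "(s has_vector_derivative of_int k) (at m within cbox x y)"
      by (rule has_vector_derivative_transform_within[where d = 1]) (use that in auto)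
  qed (use that in auto)
  have "D = of_int a" by (rule deriv[of u m a b]) (use um mv l in auto)
  moreover have "D = of_int a'" by (rule deriv[of m v a' b']) (use um mv r in auto)
  ultimately have "a = a'" by simp
  moreover have "s m = of_int a * m + of_int b" "s m = of_int a' * m + of_int b'"
    using bspec[OF l, of m] bspec[OF r, of m] um mv by simp_all
  ultimately have "b = b'" by simp
  show ?thesis
  proof
    fix x assume "x \<in> {u..v}"
    then show "s x = of_int a * x + of_int b" using l r \<open>a = a'\<close> \<open>b = b'\<close> by (cases "x \<le> m") auto
  qed
qed

text \<open>\<open>C\<close> may contain points at which \<open>s\<close> is differentiable. The
  interval is split at one of them and the two halves are merged, by induction on their
  number.\<close>

lemma affine_between_kinks:
  fixes s :: "real \<Rightarrow> real"
  assumes C: "finite C" and pieces: "\<And>u v. 0 \<le> u \<Longrightarrow> u < v \<Longrightarrow> v \<le> 1 \<Longrightarrow> {u<..<v} \<inter> C = {} \<Longrightarrow>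
      \<exists>a b :: int. \<forall>x\<in>{u..v}. s x = of_int a * x + of_int b"
    and "0 \<le> u" "u < v" "v \<le> 1" "\<And>x. x \<in> {u<..<v} \<Longrightarrow> s differentiable (at x within {0..1})"
  shows "\<exists>a b :: int. \<forall>x\<in>{u..v}. s x = of_int a * x + of_int b"
  using assms(3-)
proof (induction "card ({u<..<v} \<inter> C)" arbitrary: u v rule: less_induct)
  case less
  show ?case
  proof (cases "{u<..<v} \<inter> C = {}")
    case True
    then show ?thesis using pieces less.prems by blast
  next
    case False
    then obtain m where m: "u < m" "m < v" "m \<in> C" by auto
    have "card ({u<..<m} \<inter> C) < card ({u<..<v} \<inter> C)" "card ({m<..<v} \<inter> C) < card ({u<..<v} \<inter> C)"
      using C m by (auto intro!: psubset_card_mono)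
    from less.hyps[OF this(1)] less.hyps[OF this(2)] less.prems m obtain a b a' b' :: int where
      "\<forall>x\<in>{u..m}. s x = of_int a * x + of_int b" "\<forall>x\<in>{m..v}. s x = of_int a' * x + of_int b'" by force
    from affine_merge[OF _ m(1,2) _ _ this] less.prems m show ?thesis by auto
  qed
qed

lemma common_denominator:
  fixes C :: "real set"
  assumes "finite C" "C \<subseteq> \<rat>"
  shows "\<exists>D::nat. D > 0 \<and> (\<forall>x\<in>C. real D * x \<in> \<int>)"
  using assms
proof (induction rule: finite_induct)
  case (insert x C)
  then obtain D where D: "D > 0" "\<And>y. y \<in> C \<Longrightarrow> real D * y \<in> \<int>" by auto
  obtain m n :: int where mn: "n > 0" "x = of_int m / of_int n" using insert.prems by (auto elim: Rats_cases')
  have "real (D * nat n) * x \<in> \<int>" using mn by simp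
  moreover have "real (D * nat n) * y \<in> \<int>" if "y \<in> C" for y
    using Ints_mult[OF Ints_of_nat[of "nat n"] D(2)[OF that]] by (simp add: mult_ac)
  ultimately show ?case using D(1) mn(1) by (intro exI[of _ "D * nat n"]) auto
qed auto

section \<open>The Markov partition of a McNaughton function\<close>

context
  fixes s assumes s: "s \<in> mcnaughton"
begin

lemma mcnaughton_pieces:
  "\<exists>C. finite C \<and> {0, 1} \<subseteq> C \<and> C \<subseteq> {0..1} \<inter> \<rat> \<and>
    (\<forall>u v. 0 \<le> u \<longrightarrow> u < v \<longrightarrow> v \<le> 1 \<longrightarrow> {u<..<v} \<inter> C = {} \<longrightarrow>
      (\<exists>a b :: int. \<forall>x\<in>{u..v}. s x = of_int a * x + of_int b))"
proof -
  obtain F where F: "finite F" "selection F s" using s mcnaughton_iff_selection by blast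
  show ?thesis by (rule selection_pieces[OF F(1) mcnaughtonD(2)[OF s] F(2)])
qed

lemma break_points: "finite (break_chain s 0)" "break_chain s 0 \<subseteq> {0..1} \<inter> \<rat>"
proof -
  obtain C where C: "finite C" "{0, 1} \<subseteq> C" "C \<subseteq> {0..1} \<inter> \<rat>" and
    pieces: "\<And>u v. 0 \<le> u \<Longrightarrow> u < v \<Longrightarrow> v \<le> 1 \<Longrightarrow> {u<..<v} \<inter> C = {} \<Longrightarrow>
      \<exists>a b :: int. \<forall>x\<in>{u..v}. s x = of_int a * x + of_int b" using mcnaughton_pieces by blast
  have "s differentiable (at x within {0..1})" if x: "x \<in> {0..1}" "x \<notin> C" for x
  proof -
    have C': "C \<subseteq> {0..1}" using C by blast
    note enum = enumerate_finite_set[OF C(1,2) C']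
    let ?c = "\<lambda>i. sorted_list_of_set C ! i" and ?n = "card C - 1"
    obtain i where i: "i < ?n" "x \<in> {?c i..?c (Suc i)}"
      using interval_in_piece[of ?c x ?n] x enum(1,2,3) by auto
    have cC: "?c i \<in> C" "?c (Suc i) \<in> C" using enum(5) i(1) by auto
    then have lt: "?c i < x" "x < ?c (Suc i)" using i(2) x(2) by (auto simp: less_le)
    have c01: "0 \<le> ?c i" "?c (Suc i) \<le> 1" using cC C' by auto
    from pieces[OF c01(1) enum(4)[OF i(1)] c01(2) enum(6)[OF i(1)]]
    obtain a b :: int where ab: "\<forall>x\<in>{?c i..?c (Suc i)}. s x = of_int a * x + of_int b" by blast
    show ?thesis
    proof (rule differentiable_transform_within[where d = "min (x - ?c i) (?c (Suc i) - x)"])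
      show "(\<lambda>x. of_int a * x + of_int b) differentiable (at x within {0..1})"
        by (auto intro!: derivative_intros)
      show "of_int a * y + of_int b = s y" if "y \<in> {0..1}" "dist y x < min (x - ?c i) (?c (Suc i) - x)" for y
        using ab that by (simp add: dist_real_def abs_less_iff)
    qed (use lt x in auto)
  qed
  then have "break_chain s 0 \<subseteq> C" using C(2) by auto
  then show "finite (break_chain s 0)" "break_chain s 0 \<subseteq> {0..1} \<inter> \<rat>"
    using C(1,3) finite_subset by blast+
qed

lemma markov_points_invariant: "x \<in> markov_points s \<Longrightarrow> s x \<in> markov_points s"
proof -
  assume "x \<in> markov_points s"
  then obtain i where "x \<in> break_chain s i" by (auto simp: markov_points_def)
  then have "s x \<in> break_chain s (Suc i)" by simp
  then show ?thesis unfolding markov_points_def by blast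
qed

text \<open>With \<open>D\<close> a common denominator of the break points, the finite set of
  fractions with denominator \<open>D\<close> in the unit interval is mapped into itself, because
  \<open>s\<close> has integer coefficients. It therefore contains the whole chain.\<close>

lemma markov_points_props:
  shows "finite (markov_points s)" "{0, 1} \<subseteq> markov_points s" "markov_points s \<subseteq> {0..1} \<inter> \<rat>"
proof -
  obtain D :: nat where D: "D > 0" "\<And>x. x \<in> break_chain s 0 \<Longrightarrow> real D * x \<in> \<int>"
    using common_denominator[OF break_points(1)] break_points(2) by blast
  let ?Z = "{x \<in> {0..1}. real D * x \<in> \<int>}"
  obtain F where F: "\<And>x. x \<in> {0..1} \<Longrightarrow> \<exists>(a, b)\<in>F. s x = of_int a * x + of_int (b::int)"
    using mcnaughton_selection[OF s] by blast
  have inv: "s x \<in> ?Z" if x: "x \<in> ?Z" for x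
  proof -
    obtain a b :: int where "s x = of_int a * x + of_int b" using F[of x] x by blast
    then have "real D * s x = of_int a * (real D * x) + real D * of_int b" by (simp add: algebra_simps)
    also have "\<dots> \<in> \<int>"
    proof (rule Ints_add)
      show "of_int a * (real D * x) \<in> \<int>" using x by (intro Ints_mult[OF Ints_of_int]) simp
    qed (intro Ints_mult Ints_of_int Ints_of_nat)
    finally show ?thesis using x mcnaughtonD(1)[OF s] by simp
  qed
  have "break_chain s i \<subseteq> ?Z" for i
  proof (induction i)
    case 0
    then show ?case using D(2) break_points(2) by blast
  next
    case (Suc i)
    then show ?case using inv by auto
  qed
  then have sub: "markov_points s \<subseteq> ?Z" by (auto simp: markov_points_def)
  have Z: "?Z \<subseteq> (\<lambda>j. of_int j / real D) ` {0..int D}"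
  proof
    fix x assume x: "x \<in> ?Z"
    then obtain j :: int where j: "real D * x = of_int j" by (auto elim: Ints_cases)
    then have "x = of_int j / real D" using D(1) by (simp add: field_simps)
    moreover have "0 \<le> real D * x" "real D * x \<le> real D" using x D(1) by auto
    then have "j \<in> {0..int D}" unfolding j by auto
    ultimately show "x \<in> (\<lambda>j. of_int j / real D) ` {0..int D}" by blast
  qed
  then show "finite (markov_points s)" using finite_subset[OF sub] finite_subset[OF Z] by blast
  have "?Z \<subseteq> \<rat>" using Z by auto
  then show "markov_points s \<subseteq> {0..1} \<inter> \<rat>" using sub by blast
  have "{0, 1} \<subseteq> break_chain s 0" by auto
  then show "{0, 1} \<subseteq> markov_points s" unfolding markov_points_def by blast
qed

lemma mcnaughton_markov_map: "\<exists>a. markov_map s (markov_point s) (markov_size s) a"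
proof -
  note props = markov_points_props
  have P01: "markov_points s \<subseteq> {0..1}" using props(3) by blast
  note enum = enumerate_finite_set[OF props(1,2) P01, folded markov_size_def markov_point_def]
  obtain C where C: "finite C" and
    pieces: "\<And>u v. 0 \<le> u \<Longrightarrow> u < v \<Longrightarrow> v \<le> 1 \<Longrightarrow> {u<..<v} \<inter> C = {} \<Longrightarrow>
      \<exists>a b :: int. \<forall>x\<in>{u..v}. s x = of_int a * x + of_int b" using mcnaughton_pieces by blast
  have "\<exists>a b :: int. \<forall>x\<in>{markov_point s i..markov_point s (Suc i)}. s x = of_int a * x + of_int b"
    if i: "i < markov_size s" for i
  proof (rule affine_between_kinks[OF C pieces])
    have "markov_point s k \<in> {0..1}" if "k \<le> markov_size s" for k using enum(5) P01 that by blast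
    from this[of i] this[of "Suc i"] i show "0 \<le> markov_point s i" "markov_point s (Suc i) \<le> 1" by auto
    show "markov_point s i < markov_point s (Suc i)" using enum(4)[OF i] .
    fix x assume x: "x \<in> {markov_point s i<..<markov_point s (Suc i)}"
    then have "x \<in> {0..1}" using \<open>0 \<le> markov_point s i\<close> \<open>markov_point s (Suc i) \<le> 1\<close> by auto
    moreover have "x \<notin> markov_points s" using enum(6)[OF i] x by blast
    then have "x \<notin> break_chain s 0" unfolding markov_points_def by blast
    ultimately show "s differentiable (at x within {0..1})" by auto
  qed
  then obtain a b :: "nat \<Rightarrow> int" where ab: "\<And>i x. i < markov_size s \<Longrightarrow>
      x \<in> {markov_point s i..markov_point s (Suc i)} \<Longrightarrow> s x = of_int (a i) * x + of_int (b i)" by metis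
  \<comment> \<open>The pieces are indexed from 0 by their left end points, the slopes of the locale
    from 1.\<close>
  have "markov_map s (markov_point s) (markov_size s) (\<lambda>i. a (i - 1))"
  proof
    show "markov_point s i \<in> \<rat>" if "i \<le> markov_size s" for i using enum(5) props(3) that by blast
    show "s \<in> {0..1} \<rightarrow> {0..1}" using mcnaughtonD(1)[OF s] by blast
    show "s (markov_point s i) \<in> markov_point s ` {..markov_size s}" if "i \<le> markov_size s" for i
      using markov_points_invariant[of "markov_point s i"] enum(5) that by auto
    show "s x = s (markov_point s (i - 1)) + of_int (a (i - 1)) * (x - markov_point s (i - 1))"
      if i: "i \<in> {1..markov_size s}" and x: "x \<in> {markov_point s (i - 1)..markov_point s i}" for i x
    proof -
      have lt: "i - 1 < markov_size s" "Suc (i - 1) = i" using i by auto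
      then have "markov_point s (i - 1) \<in> {markov_point s (i - 1)..markov_point s (Suc (i - 1))}"
        using enum(4)[OF lt(1)] by simp
      from ab[OF lt(1) this] ab[OF lt(1), of x] x lt(2) show ?thesis by (simp add: algebra_simps)
    qed
  qed (use enum mcnaughtonD(2)[OF s] in auto)
  then show ?thesis by blast
qed

text \<open>A continuous injection is strictly monotone, so its integer slopes have modulus at least
  1 and a common sign; a map of the unit interval into itself has no room for more.\<close>

lemma mcnaughton_injective_isometry:
  assumes inj: "inj_on s {0..1}"
  shows "(\<forall>x\<in>{0..1}. s x = x) \<or> (\<forall>x\<in>{0..1}. s x = 1 - x)"
proof -
  obtain n c where c: "c 0 = 0" "c n = (1::real)" "\<And>i. i < n \<Longrightarrow> c i < c (Suc i)"
      "\<And>i. i < n \<Longrightarrow> \<exists>a b :: int. \<forall>x\<in>{c i..c (Suc i)}. s x = of_int a * x + of_int b"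
    using s by (auto simp: mcnaughton_def)
  have c01: "c i \<in> {0..1}" if "i \<le> n" for i
  proof -
    have "c i \<le> c j" if "i \<le> j" "j \<le> n" for i j
      using that
    proof (induction j rule: dec_induct)
      case (step j)
      then show ?case using c(3)[of j] by simp
    qed simp
    from this[of 0 i] this[of i n] that c show ?thesis by auto
  qed
  have b: "0 \<le> s x \<and> s x \<le> 1" if "x \<in> {0..1}" for x using mcnaughtonD(1)[OF s that] by simp
  have mono: "x < y \<Longrightarrow> (if s 0 < s 1 then s x < s y else s y < s x)" if xy01: "x \<in> {0..1}" "y \<in> {0..1}" for x y
  proof -
    assume xy: "x < y"
    have tri: "(s u < s v \<and> s v < s w) \<or> (s w < s v \<and> s v < s u)" if "u < v" "v < w" "0 \<le> u" "w \<le> 1" for u v w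
      using that by (intro continuous_inj_imp_mono continuous_on_subset[OF mcnaughtonD(2)[OF s]] inj_on_subset[OF inj]) auto
    consider "x = 0" "y = 1" | "x = 0" "y < 1" | "0 < x" "y = 1" | "0 < x" "y < 1"
      using xy01 xy by fastforce
    then show ?thesis
    proof cases
      case 1
      then show ?thesis using inj_onD[OF inj, of 0 1] by force
    next
      case 2
      then show ?thesis using tri[of 0 y 1] xy by auto
    next
      case 3
      then show ?thesis using tri[of 0 x 1] xy by auto
    next
      case 4
      then show ?thesis using tri[of 0 x 1] tri[of x y 1] xy by auto
    qed
  qed
  \<comment> \<open>The direction of monotonicity: \<open>of_int e * s x\<close> increases in either
    case.\<close>
  define e :: int where "e = (if s 0 < s 1 then 1 else -1)"
  have mono: "of_int e * s x < of_int e * s y" if "x \<in> {0..1}" "y \<in> {0..1}" "x < y" for x y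
    using mono[OF that] by (auto simp: e_def split: if_splits)
  have "mono_on {c 0..c n} (\<lambda>x. of_int e * s x - x)"
  proof (rule mono_on_concat)
    fix i assume i: "i < n"
    obtain a b :: int where ab: "\<And>x. x \<in> {c i..c (Suc i)} \<Longrightarrow> s x = of_int a * x + of_int b" using c(4)[OF i] by blast
    have "of_int e * s (c i) < of_int e * s (c (Suc i))" using mono[OF c01 c01 c(3)[OF i]] i by simp
    then have "0 < real_of_int (e * a) * (c (Suc i) - c i)"
      using ab[of "c i"] ab[of "c (Suc i)"] c(3)[OF i] by (simp add: algebra_simps)
    then have "0 < real_of_int (e * a)" using c(3)[OF i] by (simp only: zero_less_mult_iff) simp
    then have "1 \<le> e * a" by linarith
    then have a: "0 \<le> real_of_int (e * a) - 1" by linarith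
    show "mono_on {c i..c (Suc i)} (\<lambda>x. of_int e * s x - x)"
    proof (rule mono_onI)
      fix x y assume xy: "x \<in> {c i..c (Suc i)}" "y \<in> {c i..c (Suc i)}" "x \<le> y"
      then have "0 \<le> (real_of_int (e * a) - 1) * (y - x)" using a by simp
      then show "of_int e * s x - x \<le> of_int e * s y - y"
        unfolding ab[OF xy(1)] ab[OF xy(2)] by (simp add: algebra_simps)
    qed
  qed (use c in auto)
  then have m: "of_int e * s x - x \<le> of_int e * s y - y" if "0 \<le> x" "x \<le> y" "y \<le> 1" for x y
    using that c unfolding mono_on_def by auto
  have "s x = (if e = 1 then x else 1 - x)" if "x \<in> {0..1}" for x
    using m[of 0 x] m[of x 1] b[of 0] b[of 1] that by (auto simp: e_def)
  then show ?thesis by (cases "e = 1") auto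
qed

end


section \<open>The spectrum\<close>

text \<open>The transitivity axiom with both of its first arguments equal to
  \<open>mone B\<close>.\<close>

lemma mv_imp_refl:
  assumes "mv_algebra B" "z \<in> univ B"
  shows "mimp B z z = mone B"
proof -
  have ax: "mone B \<in> univ B" "\<And>x. x \<in> univ B \<Longrightarrow> mimp B (mone B) x = x"
    "\<And>x y z. x \<in> univ B \<Longrightarrow> y \<in> univ B \<Longrightarrow> z \<in> univ B \<Longrightarrow>
      mimp B (mimp B x y) (mimp B (mimp B y z) (mimp B x z)) = mone B"
    "\<And>x y. x \<in> univ B \<Longrightarrow> y \<in> univ B \<Longrightarrow> mimp B x y \<in> univ B"
    using assms(1) unfolding mv_algebra_def by blast+
  from ax(3)[OF ax(1,1) assms(2)] show ?thesis using ax(1,2,4) assms(2) by simp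
qed

lemma mv_conj_one: "mv_algebra B \<Longrightarrow> mconj B (mone B) (mone B) = mone B"
proof -
  assume B: "mv_algebra B"
  have ax: "mone B \<in> univ B" "mzero B \<in> univ B" "\<And>x. x \<in> univ B \<Longrightarrow> mimp B (mone B) x = x"
    "\<And>x y. x \<in> univ B \<Longrightarrow> y \<in> univ B \<Longrightarrow>
      mconj B x y = mimp B (mimp B x (mimp B y (mzero B))) (mzero B)"
    using B unfolding mv_algebra_def by blast+
  show ?thesis using ax(4)[OF ax(1,1)] ax(3)[OF ax(2)] mv_imp_refl[OF B ax(2)] by simp
qed

lemma mv_specD:
  assumes p: "p \<in> mv_spec Free1"
  shows "p \<subseteq> mcnaughton" "mone Free1 \<in> p" "mzero Free1 \<notin> p"
    "\<And>a b. a \<in> p \<Longrightarrow> b \<in> p \<Longrightarrow> mconj Free1 a b \<in> p"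
    "\<And>a b. a \<in> p \<Longrightarrow> b \<in> mcnaughton \<Longrightarrow> (\<And>x. x \<in> {0..1} \<Longrightarrow> a x \<le> b x) \<Longrightarrow> b \<in> p"
    "\<And>a b. a \<in> mcnaughton \<Longrightarrow> b \<in> mcnaughton \<Longrightarrow> mv_join Free1 a b \<in> p \<Longrightarrow> a \<in> p \<or> b \<in> p"
proof -
  obtain B :: "(real \<Rightarrow> real) set mv_alg" and h where B: "mv_algebra B" and h: "h \<in> mv_hom Free1 B"
    and p_eq: "p = {a \<in> mcnaughton. h a = mone B}"
    using p by (auto simp: mv_spec_def mv_filter_def)
  have hh: "\<And>a. a \<in> mcnaughton \<Longrightarrow> h a \<in> univ B"
    "\<And>a b. a \<in> mcnaughton \<Longrightarrow> b \<in> mcnaughton \<Longrightarrow> h (mconj Free1 a b) = mconj B (h a) (h b)"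
    "\<And>a b. a \<in> mcnaughton \<Longrightarrow> b \<in> mcnaughton \<Longrightarrow> h (mimp Free1 a b) = mimp B (h a) (h b)"
    "h (mone Free1) = mone B"
    using h by (auto simp: mv_hom_def Pi_iff)
  have one_imp: "mimp B (mone B) x = x" if "x \<in> univ B" for x using B that unfolding mv_algebra_def by blast
  show "p \<subseteq> mcnaughton" by (auto simp: p_eq)
  show one: "mone Free1 \<in> p" using hh(4) mcnaughton_const by (simp add: p_eq)
  show "mconj Free1 a b \<in> p" if "a \<in> p" "b \<in> p" for a b
    using that mv_conj_one[OF B] hh(2) mconj_closed by (auto simp: p_eq)
  show up: "b \<in> p" if "a \<in> p" "b \<in> mcnaughton" "\<And>x. x \<in> {0..1} \<Longrightarrow> a x \<le> b x" for a b
  proof -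
    have "mimp Free1 a b = mone Free1" using that(3) by (auto simp: mimp_Free1 intro!: restrict_ext)
    then have "mimp B (h a) (h b) = mone B" using hh(3)[of a b] hh(4) that by (simp add: p_eq del: mone_Free1)
    then show ?thesis using that one_imp[OF hh(1)[OF that(2)]] by (simp add: p_eq)
  qed
  show "mzero Free1 \<notin> p"
  proof
    assume "mzero Free1 \<in> p"
    then have "b \<in> p" if "b \<in> mcnaughton" for b
      by (rule up) (use that mcnaughton_bounds in auto)
    then have "p = univ Free1" using p_eq by auto
    then show False using p by (simp add: mv_spec_def)
  qed
  show "a \<in> p \<or> b \<in> p" if "a \<in> mcnaughton" "b \<in> mcnaughton" "mv_join Free1 a b \<in> p" for a b
    using p that by (auto simp: mv_spec_def)
qed

lemma mv_join_closed: "a \<in> mcnaughton \<Longrightarrow> b \<in> mcnaughton \<Longrightarrow> mv_join Free1 a b \<in> mcnaughton"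
  unfolding mv_join_def by (intro mimp_closed)

text \<open>Filters are defined through homomorphisms into algebras of sets, hence the standard algebra on the
  unit interval is coded by singletons of constant functions.\<close>

definition enc :: "real \<Rightarrow> (real \<Rightarrow> real) set" where "enc r = {\<lambda>_. r}"

definition dec :: "(real \<Rightarrow> real) set \<Rightarrow> real" where "dec X = the_elem X 0"

lemma dec_enc [simp]: "dec (enc r) = r" by (simp add: enc_def dec_def)

lemma enc_inject [simp]: "enc r = enc r' \<longleftrightarrow> r = r'" by (metis dec_enc)

definition std_mv :: "(real \<Rightarrow> real) set mv_alg" where
  "std_mv = \<lparr> univ = enc ` {0..1},
     mconj = (\<lambda>X Y. enc (max 0 (dec X + dec Y - 1))),
     mimp = (\<lambda>X Y. enc (min 1 (1 - dec X + dec Y))),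
     mzero = enc 0, mone = enc 1 \<rparr>"

lemma mv_algebra_std: "mv_algebra std_mv"
  unfolding mv_algebra_def std_mv_def
  by (auto simp: min_def max_def)

lemma point_filter_spec:
  assumes x: "x \<in> {0..1}"
  shows "point_filter x \<in> mv_spec Free1"
proof -
  have "(\<lambda>t. enc (t x)) \<in> mv_hom Free1 std_mv"
    using x mcnaughtonD(1) by (auto simp: mv_hom_def std_mv_def mconj_Free1 mimp_Free1)
  moreover have "point_filter x = {a \<in> univ Free1. enc (a x) = mone std_mv}"
    by (auto simp: point_filter_def std_mv_def)
  ultimately have "mv_filter Free1 (point_filter x)"
    unfolding mv_filter_def using mv_algebra_std by (intro exI[of _ std_mv] exI[of _ "\<lambda>t. enc (t x)"]) simp
  moreover have "mzero Free1 \<notin> point_filter x" using x by (simp add: point_filter_def)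
  then have "point_filter x \<noteq> univ Free1" using mcnaughton_const by auto
  moreover have "a \<in> point_filter x \<or> b \<in> point_filter x"
    if "a \<in> mcnaughton" "b \<in> mcnaughton" "mv_join Free1 a b \<in> point_filter x" for a b
    using that x by (auto simp: point_filter_def mv_join_Free1 max_def split: if_splits)
  ultimately show ?thesis by (simp add: mv_spec_def)
qed

definition clip :: "int \<Rightarrow> int \<Rightarrow> real \<Rightarrow> real" where
  "clip k m = (\<lambda>x\<in>{0..1}. max 0 (min 1 (of_int k * x + of_int m)))"

lemma clip_mcnaughton: "clip k m \<in> mcnaughton"
  unfolding clip_def by (rule mcnaughton_affine_clip)

lemma clip_eq_1_iff: "x \<in> {0..1} \<Longrightarrow> clip k m x = 1 \<longleftrightarrow> of_int k * x + of_int m \<ge> 1"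
  by (auto simp: clip_def max_def min_def)

text \<open>The ramps are 1 exactly where k * x is at least, respectively at most, m, so their join
  is constantly 1 and a prime filter has to choose a side.\<close>

lemma ramps_separate:
  assumes p: "p \<in> mv_spec Free1"
  shows "clip k (1 - m) \<in> p \<or> clip (-k) (m + 1) \<in> p"
proof (rule mv_specD(6)[OF p clip_mcnaughton clip_mcnaughton])
  have "mv_join Free1 (clip k (1 - m)) (clip (- k) (m + 1)) = mone Free1"
    unfolding mv_join_Free1[OF clip_mcnaughton clip_mcnaughton] mone_Free1
    by (rule restrict_ext) (auto simp: clip_def max_def min_def)
  then show "mv_join Free1 (clip k (1 - m)) (clip (- k) (m + 1)) \<in> p" using mv_specD(2)[OF p] by (simp only:)
qed

text \<open>If \<open>g\<close> stayed below 1, compactness would give a bound 1 - e. Each further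
  conjunction with \<open>g\<close> lowers the values by at least \<open>e\<close> until they are 0,
  and a proper filter does not contain 0.\<close>

lemma filter_has_zero:
  assumes p: "p \<in> mv_spec Free1" and g: "g \<in> p"
  shows "\<exists>x\<in>{0..1}. g x = 1"
proof (rule ccontr)
  assume neg: "\<not> ?thesis"
  have g': "g \<in> mcnaughton" using mv_specD(1)[OF p] g by blast
  have "continuous_on {0..1} g" by (rule mcnaughtonD(2)[OF g'])
  then obtain y where y: "y \<in> {0..1}" "\<And>x. x \<in> {0..1} \<Longrightarrow> g x \<le> g y"
    using continuous_attains_sup[of "{0..1}" g] by auto
  define e where "e = 1 - g y"
  have e: "e > 0" using neg y(1) mcnaughtonD(1)[OF g' y(1)] by (force simp: e_def)
  define P where "P = (\<lambda>n. ((mconj Free1 g) ^^ n) (mone Free1))"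
  have P: "P n \<in> p \<and> (\<forall>x\<in>{0..1}. P n x \<le> max 0 (1 - real n * e))" for n
  proof (induction n)
    case 0
    have P0: "P 0 = mone Free1" unfolding P_def funpow.simps id_apply ..
    have "mone Free1 x \<le> max 0 (1 - real 0 * e)" if "x \<in> {0..1}" for x using that by simp
    then show ?case unfolding P0 using mv_specD(2)[OF p] by blast
  next
    case (Suc n)
    have "P (Suc n) = mconj Free1 g (P n)" by (simp add: P_def)
    moreover have "max 0 (g x + P n x - 1) \<le> max 0 (1 - real (Suc n) * e)" if "x \<in> {0..1}" for x
      using y(2)[OF that] bspec[OF conjunct2[OF Suc] that] e by (auto simp: e_def algebra_simps max_def split: if_splits)
    then have "mconj Free1 g (P n) x \<le> max 0 (1 - real (Suc n) * e)" if "x \<in> {0..1}" for x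
      unfolding mconj_Free1 restrict_apply'[OF that] using that by blast
    moreover have "mconj Free1 g (P n) \<in> p" using mv_specD(4)[OF p g] Suc by blast
    ultimately show ?case by metis
  qed
  obtain n where "1 < real n * e" using reals_Archimedean3[OF e] by blast
  then have "P n x \<le> 0" if "x \<in> {0..1}" for x using P[of n] that by fastforce
  moreover have "P n \<in> mcnaughton" using P mv_specD(1)[OF p] by blast
  ultimately have "P n = mzero Free1"
    using mcnaughton_const mcnaughtonD(1)[of "P n"] by (intro mcnaughton_eqI) (auto intro: antisym)
  then show False using P[of n] mv_specD(3)[OF p] by simp
qed

text \<open>Compactness of the unit interval: a conjunction of finitely many members is again a
  member and is 1 only where all of them are.\<close>

lemma spec_point_exists:
  assumes p: "p \<in> mv_spec Free1"
  shows "\<exists>x\<in>{0..1}. p \<subseteq> point_filter x"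
proof -
  define Z where "Z t = {x \<in> {0..1::real}. t x = (1::real)}" for t
  have "{0..1} \<inter> \<Inter>(Z ` p) \<noteq> {}"
  proof (rule compact_imp_fip)
    show "compact {0..1::real}" by simp
    show "closed T" if "T \<in> Z ` p" for T
    proof -
      from that obtain t where t: "t \<in> p" "T = Z t" by blast
      then have "continuous_on {0..1} t" using mv_specD(1)[OF p] mcnaughtonD(2) by blast
      then show ?thesis unfolding t(2) Z_def by (intro continuous_closed_preimage_constant) auto
    qed
    fix F assume "finite F" "F \<subseteq> Z ` p"
    then obtain T where T: "finite T" "T \<subseteq> p" "F = Z ` T" by (meson finite_subset_image)
    have "\<exists>g\<in>p. \<forall>x\<in>{0..1}. g x = 1 \<longrightarrow> (\<forall>t\<in>T. t x = 1)" using T(1,2)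
    proof (induction rule: finite_induct)
      case empty
      then show ?case using mv_specD(2)[OF p] by blast
    next
      case (insert t T)
      then obtain g where g: "g \<in> p" "\<forall>x\<in>{0..1}. g x = 1 \<longrightarrow> (\<forall>t\<in>T. t x = 1)" by auto
      have tg: "t \<in> mcnaughton" "g \<in> mcnaughton" using insert.prems g(1) mv_specD(1)[OF p] by auto
      have both: "t x = 1 \<and> g x = 1" if "x \<in> {0..1}" "mconj Free1 t g x = 1" for x
        using that mcnaughtonD(1)[OF tg(1) that(1)] mcnaughtonD(1)[OF tg(2) that(1)]
        by (auto simp: mconj_Free1 max_def split: if_splits)
      have "mconj Free1 t g \<in> p" using insert.prems g(1) mv_specD(4)[OF p] by blast
      moreover have "\<forall>x\<in>{0..1}. mconj Free1 t g x = 1 \<longrightarrow> (\<forall>t'\<in>insert t T. t' x = 1)"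
        using both g(2) by (metis insert_iff)
      ultimately show ?case by (intro bexI[of _ "mconj Free1 t g"])
    qed
    then obtain g where "g \<in> p" "\<forall>x\<in>{0..1}. g x = 1 \<longrightarrow> (\<forall>t\<in>T. t x = 1)" by blast
    moreover from this(1) obtain x where "x \<in> {0..1}" "g x = 1" using filter_has_zero[OF p] by blast
    ultimately have "x \<in> {0..1} \<inter> \<Inter>F" by (auto simp: T(3) Z_def)
    then show "{0..1} \<inter> \<Inter>F \<noteq> {}" by blast
  qed
  then have "\<exists>x\<in>{0..1}. \<forall>t\<in>p. t x = 1" by (auto simp: Z_def)
  then obtain x where "x \<in> {0..1}" "\<forall>t\<in>p. t x = 1" by blast
  then show ?thesis using mv_specD(1)[OF p] by (auto simp: point_filter_def)
qed

lemma ratio_between: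
  fixes x y :: real
  assumes "x < y"
  obtains k m :: int where "k > 0" "x < of_int m / of_int k" "of_int m / of_int k < y"
proof -
  obtain z where z: "z \<in> \<rat>" "x < z" "z < y" using Rats_dense_in_real[OF assms] by blast
  from z(1) obtain m k :: int where "k > 0" "z = of_int m / of_int k" by (auto elim: Rats_cases')
  with z that show ?thesis by blast
qed

text \<open>At a rational between two candidates the filter contains one of the two ramps, and each
  ramp is below 1 at one of the candidates.\<close>

lemma spec_point_unique:
  assumes p: "p \<in> mv_spec Free1" and x: "x \<in> {0..1}" "p \<subseteq> point_filter x"
    and y: "y \<in> {0..1}" "p \<subseteq> point_filter y"
  shows "x = y"
proof -
  have False if xy: "x < y" and x: "x \<in> {0..1}" "p \<subseteq> point_filter x" and y: "y \<in> {0..1}" "p \<subseteq> point_filter y" for x y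
  proof -
    obtain k m :: int where km: "k > 0" "x < of_int m / of_int k" "of_int m / of_int k < y"
      using ratio_between[OF xy] .
    then have "of_int k * x < of_int m" "of_int m < of_int k * y" by (auto simp: field_simps)
    then have "clip k (1 - m) x \<noteq> 1" "clip (- k) (m + 1) y \<noteq> 1"
      using x(1) y(1) by (auto simp: clip_eq_1_iff)
    then show False using ramps_separate[OF p, of k m] x(2) y(2) by (auto simp: point_filter_def)
  qed
  from this[of x y] this[of y x] x y show ?thesis by (cases x y rule: linorder_cases) auto
qed

definition retr :: "(real \<Rightarrow> real) set \<Rightarrow> real" where
  "retr p = (THE x. x \<in> {0..1} \<and> p \<subseteq> point_filter x)"

lemma retr:
  assumes "p \<in> mv_spec Free1"
  shows "retr p \<in> {0..1}" "p \<subseteq> point_filter (retr p)"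
proof -
  have "\<exists>!x. x \<in> {0..1} \<and> p \<subseteq> point_filter x"
    using spec_point_exists[OF assms] spec_point_unique[OF assms] by blast
  from theI'[OF this] show "retr p \<in> {0..1}" "p \<subseteq> point_filter (retr p)" by (auto simp: retr_def)
qed

lemma retr_eqI: "p \<in> mv_spec Free1 \<Longrightarrow> x \<in> {0..1} \<Longrightarrow> p \<subseteq> point_filter x \<Longrightarrow> retr p = x"
  by (rule spec_point_unique[of p "retr p" x]) (simp_all only: retr)

lemma retr_point_filter [simp]: "x \<in> {0..1} \<Longrightarrow> retr (point_filter x) = x"
proof -
  assume x: "x \<in> {0..1}"
  show ?thesis by (rule retr_eqI[OF point_filter_spec[OF x] x subset_refl])
qed

text \<open>The truncation of \<open>g + y\<close> arises from those of \<open>g\<close> and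
  \<open>g + 1\<close>: add \<open>y\<close> to the first by the truncated sum, which is the
  implication from the negation, and conjoin with the second.\<close>

lemma clip_step:
  fixes g y :: real
  assumes "0 \<le> y" "y \<le> 1"
  shows "max 0 (min 1 (g + y)) =
    max 0 (min 1 (1 - min 1 (1 - max 0 (min 1 g) + 0) + y) + max 0 (min 1 (g + 1)) - 1)"
  using assms by (auto simp: max_def min_def)

text \<open>A real-valued homomorphism commutes with the truncations of \<open>k a + m\<close>, which are terms; comparing
  these with 1 determines its values by rational approximation.\<close>

lemma hom_real_eval:
  fixes h :: "(real \<Rightarrow> real) \<Rightarrow> real"
  assumes h01: "\<And>a. a \<in> mcnaughton \<Longrightarrow> h a \<in> {0..1}"
    and h_conj: "\<And>a b. a \<in> mcnaughton \<Longrightarrow> b \<in> mcnaughton \<Longrightarrow> h (mconj Free1 a b) = max 0 (h a + h b - 1)"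
    and h_imp: "\<And>a b. a \<in> mcnaughton \<Longrightarrow> b \<in> mcnaughton \<Longrightarrow> h (mimp Free1 a b) = min 1 (1 - h a + h b)"
    and h0: "h (mzero Free1) = 0" and h1: "h (mone Free1) = 1"
    and y: "y \<in> {0..1}" and sub: "\<And>a. a \<in> mcnaughton \<Longrightarrow> h a = 1 \<Longrightarrow> a y = 1"
    and a: "a \<in> mcnaughton"
  shows "h a = a y"
proof -
  define cl where "cl k m a = (\<lambda>x\<in>{0..1}. max 0 (min 1 (real k * a x + of_int m)))" for k and m :: int and a :: "real \<Rightarrow> real"
  have one: "mone Free1 \<in> mcnaughton" and zero: "mzero Free1 \<in> mcnaughton"
    using mcnaughton_const by (simp_all only: mone_Free1 mzero_Free1)
  have cl: "cl k m a \<in> mcnaughton \<and> h (cl k m a) = max 0 (min 1 (real k * h a + of_int m))"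
    if a: "a \<in> mcnaughton" for k m a
  proof (induction k arbitrary: m)
    case 0
    show ?case
    proof (cases "m \<ge> 1")
      case True
      then have "cl 0 m a = mone Free1" by (auto simp: cl_def intro!: restrict_ext)
      moreover have "max 0 (min 1 (real 0 * h a + of_int m)) = 1" using True by simp
      ultimately show ?thesis using h1 one by (simp only: conj_ac simp_thms)
    next
      case False
      then have "cl 0 m a = mzero Free1" by (auto simp: cl_def intro!: restrict_ext)
      moreover have "max 0 (min 1 (real 0 * h a + of_int m)) = 0" using False by simp
      ultimately show ?thesis using h0 zero by (simp only: conj_ac simp_thms)
    qed
  next
    case (Suc k)
    have ax: "0 \<le> a x \<and> a x \<le> 1" if "x \<in> {0..1}" for x using mcnaughtonD(1)[OF a that] by simp
    have eq: "cl (Suc k) m a = mconj Free1 (mimp Free1 (mimp Free1 (cl k m a) (mzero Free1)) a) (cl k (m + 1) a)"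
      unfolding mconj_Free1 mimp_Free1 cl_def[of "Suc k"]
    proof (rule restrict_ext)
      fix x :: real assume x: "x \<in> {0..1}"
      define g where "g = real k * a x + of_int m"
      have g: "real (Suc k) * a x + of_int m = g + a x" by (simp add: g_def algebra_simps)
      have cl_x: "cl k m a x = max 0 (min 1 g)" "cl k (m + 1) a x = max 0 (min 1 (g + 1))"
        unfolding cl_def restrict_apply'[OF x] g_def by (simp_all only: of_int_add of_int_1 add.assoc)
      show "max 0 (min 1 (real (Suc k) * a x + of_int m)) =
          max 0 ((\<lambda>x\<in>{0..1}. min 1 (1 - (\<lambda>x\<in>{0..1}. min 1 (1 - cl k m a x + mzero Free1 x)) x + a x)) x + cl k (m + 1) a x - 1)"
        unfolding mzero_Free1 restrict_apply'[OF x] cl_x g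
        by (rule clip_step) (use ax[OF x] in auto)
    qed
    have IH: "cl k m a \<in> mcnaughton" "cl k (m + 1) a \<in> mcnaughton" using Suc.IH by blast+
    have "h (cl (Suc k) m a) = max 0 (min 1 (1 - min 1 (1 - h (cl k m a) + 0) + h a) + h (cl k (m + 1) a) - 1)"
      unfolding eq using IH zero a by (simp add: h_conj h_imp h0 mimp_closed del: mzero_Free1)
    also have "\<dots> = max 0 (min 1 ((real k * h a + of_int m) + h a))"
    proof -
      have "h (cl k m a) = max 0 (min 1 (real k * h a + of_int m))" using Suc.IH by blast
      moreover have "h (cl k (m + 1) a) = max 0 (min 1 ((real k * h a + of_int m) + 1))"
        using conjunct2[OF Suc.IH[of "m + 1"]] by (simp only: of_int_add of_int_1 add.assoc)
      ultimately show ?thesis by (simp only:) (rule clip_step[symmetric], use h01[OF a] in auto)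
    qed
    also have "(real k * h a + of_int m) + h a = real (Suc k) * h a + of_int m" by (simp add: algebra_simps)
    finally show ?case using IH zero a unfolding eq by (auto intro!: mconj_closed mimp_closed)
  qed
  have le: "h a \<le> a y" if a: "a \<in> mcnaughton" for a
  proof (rule ccontr)
    assume "\<not> ?thesis"
    then have "a y < h a" by simp
    \<comment> \<open>For a rational m / k strictly between, the truncation of k * a + (1 - m) has
      value 1 under \<open>h\<close> but is below 1 at \<open>y\<close>, against
      \<open>sub\<close>.\<close>
    then obtain k m :: int where km: "k > 0" "a y < of_int m / of_int k" "of_int m / of_int k < h a"
      using ratio_between by blast
    then have *: "of_int k * a y < of_int m" "of_int m < of_int k * h a" by (auto simp: field_simps)
    have K: "real (nat k) = of_int k" using km(1) by simp
    have "h (cl (nat k) (1 - m) a) = max 0 (min 1 (of_int k * h a + of_int (1 - m)))"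
      using cl[OF a] unfolding K[symmetric] by blast
    also have "\<dots> = 1" using *(2) by simp
    finally have "cl (nat k) (1 - m) a y = 1" using sub cl[OF a] by blast
    then have "max 0 (min 1 (of_int k * a y + of_int (1 - m))) = 1"
      unfolding cl_def restrict_apply'[OF y] K .
    then show False using *(1) by (simp add: max_def min_def split: if_splits)
  qed
  \<comment> \<open>Applying \<open>le\<close> to the negation of \<open>a\<close> gives the
    opposite inequality.\<close>
  have "h (mimp Free1 a (mzero Free1)) = 1 - h a" using h_imp[OF a zero] h0 h01[OF a] by simp
  moreover have "mimp Free1 a (mzero Free1) y = 1 - a y"
    using y mcnaughtonD(1)[OF a y] by (simp add: mimp_Free1)
  ultimately have "a y \<le> h a" using le[OF mimp_closed[OF a zero]] by simp
  then show ?thesis using le[OF a] by simp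
qed

lemma x0_mcnaughton: "x0 \<in> mcnaughton"
proof -
  have "x0 = clip 1 0" unfolding x0_def clip_def by (rule restrict_ext) auto
  then show ?thesis using clip_mcnaughton[of 1 0] by (simp only:)
qed

section \<open>Topology and Borel structure of the spectrum\<close>

definition basic_open :: "(real \<Rightarrow> real) \<Rightarrow> (real \<Rightarrow> real) set set" where
  "basic_open a = {p \<in> mv_spec Free1. a \<notin> p}"

lemma mv_spec_top_eq: "mv_spec_top Free1 = topology_generated_by (basic_open ` mcnaughton)"
  by (simp add: mv_spec_top_def basic_open_def)

lemma openin_basic: "a \<in> mcnaughton \<Longrightarrow> openin (mv_spec_top Free1) (basic_open a)"
  unfolding mv_spec_top_eq by (rule topology_generated_by_Basis) simp

lemma Union_basic_open: "\<Union> (basic_open ` mcnaughton) = mv_spec Free1"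
  using mv_specD(3) mcnaughton_const by (fastforce simp: basic_open_def)

lemma topspace_mv_spec [simp]: "topspace (mv_spec_top Free1) = mv_spec Free1"
  by (simp only: mv_spec_top_eq topology_generated_by_topspace Union_basic_open)

text \<open>The subbasis is a basis: by primality and upward closure, a join lies outside a prime
  filter exactly when both of its arguments do.\<close>

lemma openin_contains_basic:
  assumes "openin (mv_spec_top Free1) U" "p \<in> U"
  shows "\<exists>a\<in>mcnaughton. a \<notin> p \<and> basic_open a \<subseteq> U"
proof -
  have U: "U \<subseteq> mv_spec Free1" if "generate_topology_on (basic_open ` mcnaughton) U" for U
    using that openin_subset[of "mv_spec_top Free1" U] unfolding topspace_mv_spec
    by (simp only: mv_spec_top_eq openin_topology_generated_by_iff)
  have "generate_topology_on (basic_open ` mcnaughton) U"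
    using assms(1) by (simp add: mv_spec_top_eq openin_topology_generated_by_iff)
  then show ?thesis using assms(2)
  proof (induction arbitrary: p)
    case (Int A B)
    then obtain a b where ab: "a \<in> mcnaughton" "a \<notin> p" "basic_open a \<subseteq> A" "b \<in> mcnaughton" "b \<notin> p" "basic_open b \<subseteq> B"
      by (meson IntE)
    have p: "p \<in> mv_spec Free1" using U[OF Int.hyps(1)] Int.prems by blast
    have "mv_join Free1 a b \<notin> p" using mv_specD(6)[OF p] ab by blast
    moreover have "basic_open (mv_join Free1 a b) \<subseteq> basic_open a \<inter> basic_open b"
    proof
      fix r assume "r \<in> basic_open (mv_join Free1 a b)"
      then have r: "r \<in> mv_spec Free1" "mv_join Free1 a b \<notin> r" by (auto simp: basic_open_def)
      have "mv_join Free1 a b \<in> r" if "a \<in> r"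
        by (rule mv_specD(5)[OF r(1) that mv_join_closed[OF ab(1,4)]]) (simp add: mv_join_Free1[OF ab(1,4)])
      moreover have "mv_join Free1 a b \<in> r" if "b \<in> r"
        by (rule mv_specD(5)[OF r(1) that mv_join_closed[OF ab(1,4)]]) (simp add: mv_join_Free1[OF ab(1,4)])
      ultimately show "r \<in> basic_open a \<inter> basic_open b" using r by (auto simp: basic_open_def)
    qed
    ultimately show ?case using ab mv_join_closed by blast
  next
    case (UN K)
    then show ?case by (meson Sup_upper UnionE subset_trans)
  next
    case (Basis S)
    then show ?case by (auto simp: basic_open_def)
  qed simp
qed

lemma space_borel_spec [simp]: "space borel_spec = mv_spec Free1"
  and openin_sets_borel_spec: "openin (mv_spec_top Free1) U \<Longrightarrow> U \<in> sets borel_spec"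
  and measurable_borel_specI: "f \<in> space M \<rightarrow> mv_spec Free1 \<Longrightarrow>
    (\<And>U. openin (mv_spec_top Free1) U \<Longrightarrow> f -` U \<inter> space M \<in> sets M) \<Longrightarrow> f \<in> measurable M borel_spec"
proof -
  have sub: "{U. openin (mv_spec_top Free1) U} \<subseteq> Pow (mv_spec Free1)"
    using openin_subset by fastforce
  show "space borel_spec = mv_spec Free1" unfolding borel_spec_def by (rule space_measure_of[OF sub])
  show "openin (mv_spec_top Free1) U \<Longrightarrow> U \<in> sets borel_spec"
    unfolding borel_spec_def using sub by (simp add: sets_measure_of)
  show "f \<in> space M \<rightarrow> mv_spec Free1 \<Longrightarrow>
    (\<And>U. openin (mv_spec_top Free1) U \<Longrightarrow> f -` U \<inter> space M \<in> sets M) \<Longrightarrow> f \<in> measurable M borel_spec"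
    unfolding borel_spec_def by (rule measurable_measure_of[OF sub]) auto
qed

lemma measurable_point_filter: "point_filter \<in> measurable leb01 borel_spec"
proof (rule measurable_borel_specI)
  show "point_filter \<in> space leb01 \<rightarrow> mv_spec Free1" using point_filter_spec by auto
  have cont: "continuous_map (top_of_set {0..1}) (mv_spec_top Free1) point_filter"
    unfolding mv_spec_top_eq
  proof (rule continuous_on_generated_topo)
    fix U assume "U \<in> basic_open ` mcnaughton"
    then obtain a where a: "a \<in> mcnaughton" "U = basic_open a" by blast
    have "point_filter -` U \<inter> topspace (top_of_set {0..1}) = {0..1} - {x \<in> {0..1}. a x = 1}"
      using a point_filter_spec by (auto simp: basic_open_def point_filter_def)
    moreover have "closedin (top_of_set {0..1}) {x \<in> {0..1}. a x = 1}"
      using mcnaughtonD(2)[OF a(1)] by (rule continuous_closedin_preimage_constant)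
    then have "openin (top_of_set {0..1}) ({0..1} - {x \<in> {0..1}. a x = 1})"
      by (simp add: openin_diff)
    ultimately show "openin (top_of_set {0..1}) (point_filter -` U \<inter> topspace (top_of_set {0..1}))" by simp
  next
    show "point_filter ` topspace (top_of_set {0..1}) \<subseteq> \<Union> (basic_open ` mcnaughton)"
      using point_filter_spec by (auto simp: Union_basic_open)
  qed
  show "point_filter -` U \<inter> space leb01 \<in> sets leb01" if "openin (mv_spec_top Free1) U" for U
  proof -
    have "openin (top_of_set {0..1}) (point_filter -` U \<inter> {0..1})"
    proof -
      have "{x \<in> topspace (top_of_set {0..1}). point_filter x \<in> U} = point_filter -` U \<inter> {0..1}" by auto
      with openin_continuous_map_preimage[OF cont that] show ?thesis by (simp only:)
    qed
    then obtain T where "open T" "point_filter -` U \<inter> {0..1} = {0..1} \<inter> T" by (auto simp: openin_open)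
    then show ?thesis by (simp add: in_sets_leb01)
  qed
qed

text \<open>\<open>retr p\<close> exceeds \<open>c\<close> exactly if, for some rational above
  \<open>c\<close>, the filter contains a ramp that is 1 from this rational on. This is a countable
  union of complements of basic open sets.\<close>

lemma measurable_retr: "retr \<in> measurable borel_spec leb01"
proof -
  have clip_set: "{p \<in> mv_spec Free1. clip k m \<in> p} \<in> sets borel_spec" for k m
  proof -
    have "space borel_spec - basic_open (clip k m) \<in> sets borel_spec"
      using openin_sets_borel_spec[OF openin_basic[OF clip_mcnaughton]] by blast
    moreover have "space borel_spec - basic_open (clip k m) = {p \<in> mv_spec Free1. clip k m \<in> p}"
      by (auto simp: basic_open_def)
    ultimately show ?thesis by simp
  qed
  have "{p \<in> space borel_spec. c < retr p} \<in> sets borel_spec" for c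
  proof -
    have "{p \<in> space borel_spec. c < retr p} =
        (\<Union>(k, m)\<in>{(k::int, m::int). k > 0 \<and> c < of_int m / of_int k}. {p \<in> mv_spec Free1. clip k (1 - m) \<in> p})"
    proof (intro set_eqI iffI)
      fix p assume "p \<in> {p \<in> space borel_spec. c < retr p}"
      then have p: "p \<in> mv_spec Free1" and c: "c < retr p" by auto
      obtain k m :: int where km: "k > 0" "c < of_int m / of_int k" "of_int m / of_int k < retr p"
        using ratio_between[OF c] .
      then have "of_int m < of_int k * retr p" by (simp add: field_simps)
      then have "clip (- k) (m + 1) (retr p) \<noteq> 1" using retr(1)[OF p] by (simp add: clip_eq_1_iff)
      then have "clip k (1 - m) \<in> p" using ramps_separate[OF p, of k m] retr(2)[OF p] by (auto simp: point_filter_def)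
      with p km show "p \<in> (\<Union>(k, m)\<in>{(k::int, m::int). k > 0 \<and> c < of_int m / of_int k}. {p \<in> mv_spec Free1. clip k (1 - m) \<in> p})"
        by blast
    next
      fix p assume "p \<in> (\<Union>(k, m)\<in>{(k::int, m::int). k > 0 \<and> c < of_int m / of_int k}. {p \<in> mv_spec Free1. clip k (1 - m) \<in> p})"
      then obtain k m :: int where km: "k > 0" "c < of_int m / of_int k" and p: "p \<in> mv_spec Free1" "clip k (1 - m) \<in> p" by blast
      then have "clip k (1 - m) (retr p) = 1" using retr(2)[OF p(1)] by (auto simp: point_filter_def)
      then have "of_int m \<le> of_int k * retr p" using retr(1)[OF p(1)] by (simp add: clip_eq_1_iff)
      then have "of_int m / of_int k \<le> retr p" using km(1) by (simp add: field_simps)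
      then show "p \<in> {p \<in> space borel_spec. c < retr p}" using km p by simp
    qed
    moreover have "\<dots> \<in> sets borel_spec"
      by (rule sets.countable_UN') (use clip_set in auto)
    ultimately show ?thesis by simp
  qed
  then have "retr \<in> borel_measurable borel_spec" by (simp add: borel_measurable_iff_greater)
  then have "retr \<in> measurable borel_spec (restrict_space borel {0..1})"
    using retr(1) by (intro measurable_restrict_space2) auto
  then show ?thesis by (simp cong: measurable_cong_sets add: sets_leb01)
qed

lemma mv_dual_spec:
  assumes \<sigma>: "\<sigma> \<in> mv_hom Free1 Free1" and p: "p \<in> mv_spec Free1"
  shows "mv_dual Free1 \<sigma> p \<in> mv_spec Free1"
proof -
  have s: "\<And>a. a \<in> mcnaughton \<Longrightarrow> \<sigma> a \<in> mcnaughton"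
    "\<And>a b. a \<in> mcnaughton \<Longrightarrow> b \<in> mcnaughton \<Longrightarrow> \<sigma> (mconj Free1 a b) = mconj Free1 (\<sigma> a) (\<sigma> b)"
    "\<And>a b. a \<in> mcnaughton \<Longrightarrow> b \<in> mcnaughton \<Longrightarrow> \<sigma> (mimp Free1 a b) = mimp Free1 (\<sigma> a) (\<sigma> b)"
    "\<sigma> (mzero Free1) = mzero Free1" "\<sigma> (mone Free1) = mone Free1"
    using \<sigma> by (auto simp: mv_hom_def Pi_iff)
  obtain B :: "(real \<Rightarrow> real) set mv_alg" and h where B: "mv_algebra B" and h: "h \<in> mv_hom Free1 B"
    and p_eq: "p = {a \<in> mcnaughton. h a = mone B}"
    using p by (auto simp: mv_spec_def mv_filter_def)
  have "h \<circ> \<sigma> \<in> mv_hom Free1 B" using h s by (auto simp: mv_hom_def Pi_iff)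
  moreover have "mv_dual Free1 \<sigma> p = {a \<in> univ Free1. (h \<circ> \<sigma>) a = mone B}"
    using s(1) by (auto simp: mv_dual_def p_eq)
  ultimately have "mv_filter Free1 (mv_dual Free1 \<sigma> p)" unfolding mv_filter_def using B by blast
  moreover have "mzero Free1 \<notin> mv_dual Free1 \<sigma> p" using mv_specD(3)[OF p] s(4) by (simp add: mv_dual_def)
  then have "mv_dual Free1 \<sigma> p \<noteq> univ Free1" using mcnaughton_const by auto
  moreover have "a \<in> mv_dual Free1 \<sigma> p \<or> b \<in> mv_dual Free1 \<sigma> p"
    if "a \<in> mcnaughton" "b \<in> mcnaughton" "mv_join Free1 a b \<in> mv_dual Free1 \<sigma> p" for a b
  proof -
    have "\<sigma> (mv_join Free1 a b) = mv_join Free1 (\<sigma> a) (\<sigma> b)"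
      using that s(3) mimp_closed by (simp add: mv_join_def)
    then show ?thesis using that mv_specD(6)[OF p] s(1) by (simp add: mv_dual_def)
  qed
  ultimately show ?thesis by (simp add: mv_spec_def)
qed

section \<open>The dual map of a substitution\<close>

context
  fixes \<sigma> s assumes \<sigma>: "\<sigma> \<in> mv_hom Free1 Free1" and s: "\<sigma> x0 = s"
begin

lemma subst_closed: "a \<in> mcnaughton \<Longrightarrow> \<sigma> a \<in> mcnaughton"
  using \<sigma> by (auto simp: mv_hom_def)

lemma s_mcnaughton: "s \<in> mcnaughton"
  using subst_closed[OF x0_mcnaughton] s by simp

lemma s_unit: "x \<in> {0..1} \<Longrightarrow> s x \<in> {0..1}"
  using mcnaughtonD(1)[OF s_mcnaughton] by blast

text \<open>Applying \<open>\<sigma>\<close> and evaluating at \<open>x\<close> is a real-valued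
  homomorphism, hence by \<open>hom_real_eval\<close> evaluation at some point; the generator
  \<open>x0\<close> identifies this point as \<open>s x\<close>.\<close>

lemma subst_eval:
  assumes a: "a \<in> mcnaughton" and x: "x \<in> {0..1}"
  shows "\<sigma> a x = a (s x)"
proof -
  define p where "p = mv_dual Free1 \<sigma> (point_filter x)"
  have p: "p \<in> mv_spec Free1" unfolding p_def by (rule mv_dual_spec[OF \<sigma> point_filter_spec[OF x]])
  have eval: "\<sigma> a x = a (retr p)" if "a \<in> mcnaughton" for a
  proof (rule hom_real_eval[where h = "\<lambda>a. \<sigma> a x"])
    show "\<sigma> a x \<in> {0..1}" if "a \<in> mcnaughton" for a using mcnaughtonD(1)[OF subst_closed[OF that] x] .
    show "\<sigma> (mconj Free1 a b) x = max 0 (\<sigma> a x + \<sigma> b x - 1)" if "a \<in> mcnaughton" "b \<in> mcnaughton" for a b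
      using \<sigma> that x by (simp add: mv_hom_def mconj_Free1)
    show "\<sigma> (mimp Free1 a b) x = min 1 (1 - \<sigma> a x + \<sigma> b x)" if "a \<in> mcnaughton" "b \<in> mcnaughton" for a b
      using \<sigma> that x by (simp add: mv_hom_def mimp_Free1)
    show "\<sigma> (mzero Free1) x = 0" "\<sigma> (mone Free1) x = 1" using \<sigma> x by (auto simp: mv_hom_def)
    show "retr p \<in> {0..1}" by (rule retr(1)[OF p])
    show "a (retr p) = 1" if "a \<in> mcnaughton" "\<sigma> a x = 1" for a
      using retr(2)[OF p] that subst_closed by (auto simp: p_def mv_dual_def point_filter_def)
  qed (rule that)
  have "s x = retr p" using eval[OF x0_mcnaughton] s retr(1)[OF p] by (simp add: x0_def)
  then show ?thesis using eval[OF a] by simp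
qed

lemma mv_dual_point: "x \<in> {0..1} \<Longrightarrow> mv_dual Free1 \<sigma> (point_filter x) = point_filter (s x)"
proof (rule set_eqI)
  fix a assume x: "x \<in> {0..1}"
  show "a \<in> mv_dual Free1 \<sigma> (point_filter x) \<longleftrightarrow> a \<in> point_filter (s x)"
    using subst_closed[of a] subst_eval[OF _ x, of a] by (cases "a \<in> mcnaughton") (simp_all add: mv_dual_def point_filter_def)
qed

lemma retr_mv_dual:
  assumes p: "p \<in> mv_spec Free1"
  shows "retr (mv_dual Free1 \<sigma> p) = s (retr p)"
proof (rule retr_eqI[OF mv_dual_spec[OF \<sigma> p] s_unit[OF retr(1)[OF p]]])
  have "mv_dual Free1 \<sigma> p \<subseteq> mv_dual Free1 \<sigma> (point_filter (retr p))"
    using retr(2)[OF p] by (auto simp: mv_dual_def)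
  then show "mv_dual Free1 \<sigma> p \<subseteq> point_filter (s (retr p))"
    using mv_dual_point[OF retr(1)[OF p]] by simp
qed

lemma measurable_mv_dual: "mv_dual Free1 \<sigma> \<in> measurable borel_spec borel_spec"
proof (rule measurable_borel_specI)
  show "mv_dual Free1 \<sigma> \<in> space borel_spec \<rightarrow> mv_spec Free1" using mv_dual_spec[OF \<sigma>] by auto
  have pre: "mv_dual Free1 \<sigma> -` basic_open a \<inter> mv_spec Free1 = basic_open (\<sigma> a)" if "a \<in> mcnaughton" for a
    using that mv_dual_spec[OF \<sigma>] by (auto simp: basic_open_def mv_dual_def)
  have cont: "continuous_map (mv_spec_top Free1) (mv_spec_top Free1) (mv_dual Free1 \<sigma>)"
    unfolding mv_spec_top_eq[THEN arg_cong[where f = "continuous_map (mv_spec_top Free1)"]]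
  proof (rule continuous_on_generated_topo)
    show "openin (mv_spec_top Free1) (mv_dual Free1 \<sigma> -` U \<inter> topspace (mv_spec_top Free1))"
      if "U \<in> basic_open ` mcnaughton" for U
      using that pre openin_basic subst_closed by auto
    show "mv_dual Free1 \<sigma> ` topspace (mv_spec_top Free1) \<subseteq> \<Union> (basic_open ` mcnaughton)"
      using mv_dual_spec[OF \<sigma>] by (auto simp: Union_basic_open)
  qed
  show "mv_dual Free1 \<sigma> -` U \<inter> space borel_spec \<in> sets borel_spec" if "openin (mv_spec_top Free1) U" for U
  proof (rule openin_sets_borel_spec)
    have "{p \<in> topspace (mv_spec_top Free1). mv_dual Free1 \<sigma> p \<in> U} = mv_dual Free1 \<sigma> -` U \<inter> space borel_spec" by auto
    with openin_continuous_map_preimage[OF cont that]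
    show "openin (mv_spec_top Free1) (mv_dual Free1 \<sigma> -` U \<inter> space borel_spec)" by (simp only:)
  qed
qed

end


section \<open>Automorphisms and transfer\<close>

lemma prob_space_leb_spec: "prob_space leb_spec"
  unfolding leb_spec_def by (rule prob_space.prob_space_distr[OF prob_space_leb01 measurable_point_filter])

lemma sets_leb_spec [simp]: "sets leb_spec = sets borel_spec"
  and space_leb_spec [simp]: "space leb_spec = mv_spec Free1"
  by (simp_all add: leb_spec_def)

lemma distr_leb_spec_retr: "distr leb_spec leb01 retr = leb01"
proof -
  have "distr leb_spec leb01 retr = distr leb01 leb01 (retr \<circ> point_filter)"
    unfolding leb_spec_def by (rule distr_distr[OF measurable_retr measurable_point_filter])
  also have "\<dots> = distr leb01 leb01 (\<lambda>x. x)" by (rule distr_cong) auto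
  finally show ?thesis by simp
qed

lemma leb01_flip:
  assumes B: "B \<in> sets leb01"
  shows "emeasure leb01 {x \<in> {0..1}. 1 - x \<in> B} = emeasure leb01 B"
proof -
  interpret prob_space leb01 by (rule prob_space_leb01)
  have B': "B \<in> sets borel" "B \<subseteq> {0..1}" using B by (auto simp: in_sets_leb01)
  have eq: "(\<lambda>x. 1 + (-1) * x) -` B = {x \<in> {0..1}. 1 - x \<in> B}" using B'(2) by auto
  have "measure lborel B = measure lborel {x \<in> {0..1}. 1 - x \<in> B}"
    using measure_lborel_affine_vimage[of "-1" B 1] B'(1) unfolding eq by simp
  moreover have "{x \<in> {0..1}. 1 - x \<in> B} \<subseteq> {0..1}" by blast
  ultimately have "measure leb01 {x \<in> {0..1}. 1 - x \<in> B} = measure leb01 B" using B'(2) by (simp add: measure_leb01)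
  then show ?thesis by (simp add: emeasure_eq_measure)
qed

context
  fixes \<sigma> s assumes \<sigma>: "\<sigma> \<in> mv_hom Free1 Free1" and s: "\<sigma> x0 = s"
begin

text \<open>Surjectivity alone provides \<open>t\<close> with \<open>t (s x) = x\<close>, so
  \<open>s\<close> is injective. Conversely the identity and the reflection are involutions, which
  makes \<open>\<sigma>\<close> its own inverse.\<close>

lemma mv_aut_iff: "\<sigma> \<in> mv_aut Free1 \<longleftrightarrow> (\<forall>x\<in>{0..1}. s x = x) \<or> (\<forall>x\<in>{0..1}. s x = 1 - x)"
proof
  assume "\<sigma> \<in> mv_aut Free1"
  then have "\<sigma> ` mcnaughton = mcnaughton" by (auto simp: mv_aut_def dest: bij_betw_imp_surj_on)
  then have "x0 \<in> \<sigma> ` mcnaughton" using x0_mcnaughton by simp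
  then obtain t where t: "t \<in> mcnaughton" "\<sigma> t = x0" by (elim imageE) simp
  have "t (s x) = x" if "x \<in> {0..1}" for x
    using subst_eval[OF \<sigma> s t(1) that] t(2) that by (simp add: x0_def)
  then have "inj_on s {0..1}" by (rule inj_on_inverseI)
  then show "(\<forall>x\<in>{0..1}. s x = x) \<or> (\<forall>x\<in>{0..1}. s x = 1 - x)"
    by (rule mcnaughton_injective_isometry[OF s_mcnaughton[OF \<sigma> s]])
next
  assume iso: "(\<forall>x\<in>{0..1}. s x = x) \<or> (\<forall>x\<in>{0..1}. s x = 1 - x)"
  have ss: "s (s x) = x" if "x \<in> {0..1}" for x
  proof -
    have "1 - x \<in> {0..1}" using that by auto
    with iso that show ?thesis by auto
  qed
  have inv: "\<sigma> (\<sigma> a) = a" if a: "a \<in> mcnaughton" for a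
  proof (rule mcnaughton_eqI)
    show "\<sigma> (\<sigma> a) x = a x" if x: "x \<in> {0..1}" for x
      using subst_eval[OF \<sigma> s subst_closed[OF \<sigma> s a] x] subst_eval[OF \<sigma> s a s_unit[OF \<sigma> s x]] ss[OF x] by (simp only:)
  qed (intro subst_closed[OF \<sigma> s] a)+
  have "bij_betw \<sigma> mcnaughton mcnaughton"
    by (rule bij_betw_byWitness[where f' = \<sigma>]) (use inv subst_closed[OF \<sigma> s] in blast)+
  then show "\<sigma> \<in> mv_aut Free1" using \<sigma> by (simp add: mv_aut_def)
qed

lemma mv_aut_preserves_leb_spec:
  assumes aut: "\<sigma> \<in> mv_aut Free1" and A: "A \<in> sets borel_spec"
  shows "emeasure leb_spec (mv_dual Free1 \<sigma> -` A \<inter> mv_spec Free1) = emeasure leb_spec A"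
proof -
  define B where "B = point_filter -` A \<inter> {0..1}"
  have B: "B \<in> sets leb01" unfolding B_def using measurable_sets[OF measurable_point_filter A] by simp
  have A': "mv_dual Free1 \<sigma> -` A \<inter> mv_spec Free1 \<in> sets borel_spec"
    using measurable_sets[OF measurable_mv_dual[OF \<sigma> s] A] by simp
  have "point_filter -` (mv_dual Free1 \<sigma> -` A \<inter> mv_spec Free1) \<inter> {0..1} = {x \<in> {0..1}. s x \<in> B}"
    using mv_dual_point[OF \<sigma> s] point_filter_spec s_unit[OF \<sigma> s] by (auto simp: B_def)
  then have 1: "emeasure leb_spec (mv_dual Free1 \<sigma> -` A \<inter> mv_spec Free1) = emeasure leb01 {x \<in> {0..1}. s x \<in> B}"
    unfolding leb_spec_def using emeasure_distr[OF measurable_point_filter A'] by simp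
  have 2: "emeasure leb_spec A = emeasure leb01 B"
    unfolding leb_spec_def B_def using emeasure_distr[OF measurable_point_filter A] by simp
  from aut consider "\<forall>x\<in>{0..1}. s x = x" | "\<forall>x\<in>{0..1}. s x = 1 - x" using mv_aut_iff by blast
  then show ?thesis
  proof cases
    case 1
    then have "{x \<in> {0..1}. s x \<in> B} = B" by (auto simp: B_def)
    then show ?thesis using \<open>emeasure leb_spec (_ \<inter> _) = _\<close> 2 by simp
  next
    case 2
    then have "{x \<in> {0..1}. s x \<in> B} = {x \<in> {0..1}. 1 - x \<in> B}" by auto
    then show ?thesis using \<open>emeasure leb_spec (_ \<inter> _) = _\<close> \<open>emeasure leb_spec A = _\<close> leb01_flip[OF B] by simp
  qed
qed

end

text \<open>Automorphisms preserve \<open>leb_spec\<close>, so every quantifier over algebraically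
  equivalent measures collapses to this one.\<close>

lemma alg_equiv_leb_iff: "alg_equiv_leb \<nu> \<longleftrightarrow> \<nu> = leb_spec"
proof
  assume "alg_equiv_leb \<nu>"
  then obtain \<rho> where sets: "sets \<nu> = sets borel_spec" and \<rho>: "\<rho> \<in> mv_aut Free1"
    and eq: "\<And>A. A \<in> sets borel_spec \<Longrightarrow>
      emeasure \<nu> A = emeasure leb_spec (mv_dual Free1 \<rho> -` A \<inter> mv_spec Free1)"
    by (auto simp: alg_equiv_leb_def)
  from \<rho> have hom: "\<rho> \<in> mv_hom Free1 Free1" by (simp add: mv_aut_def)
  show "\<nu> = leb_spec"
  proof (rule measure_eqI)
    show "emeasure \<nu> A = emeasure leb_spec A" if "A \<in> sets \<nu>" for A
      using eq[of A] mv_aut_preserves_leb_spec[OF hom refl \<rho>, of A] that sets by simp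
  qed (simp add: sets)
next
  assume \<nu>: "\<nu> = leb_spec"
  have "id \<in> mv_aut Free1" by (auto simp: mv_aut_def mv_hom_def)
  moreover have "emeasure leb_spec A = emeasure leb_spec (mv_dual Free1 id -` A \<inter> mv_spec Free1)"
    if "A \<in> sets borel_spec" for A
  proof -
    have "mv_dual Free1 id p = p" if "p \<in> mv_spec Free1" for p
      using mv_specD(1)[OF that] by (auto simp: mv_dual_def)
    then have "mv_dual Free1 id -` A \<inter> mv_spec Free1 = A"
      using sets.sets_into_space[OF that] by auto
    then show ?thesis by simp
  qed
  ultimately show "alg_equiv_leb \<nu>"
    using prob_space_leb_spec unfolding \<nu> alg_equiv_leb_def by auto
qed

text \<open>The basic open set of such a \<open>b\<close> contains a point filter, and all point
  filters in it come from the given interval. So density of an orbit in the spectrum forces it to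
  enter the interval.\<close>

lemma mcnaughton_hat:
  assumes uv: "0 \<le> u" "u < v" "v \<le> 1"
  shows "\<exists>b\<in>mcnaughton. (\<exists>y\<in>{0..1}. b y \<noteq> 1) \<and> (\<forall>x\<in>{0..1}. b x \<noteq> 1 \<longrightarrow> x \<in> {u<..<v})"
proof -
  obtain N :: nat where "3 < real N * (v - u)" using reals_Archimedean3[of "v - u"] uv by auto
  then have N: "3 < real N * v - real N * u" by (simp add: right_diff_distrib)
  have "N \<noteq> 0" using N by (intro notI) simp
  then have N0: "0 < real N" by simp
  \<comment> \<open>With \<open>N\<close> this large, (m - 1) / N is at least \<open>u\<close> and
    (m + 1) / N is below \<open>v\<close>: the 3 covers the rounding and the two flanks of a
    function that is below 1 exactly between them.\<close>
  define m where "m = \<lceil>real N * u\<rceil> + 1"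
  have m: "real N * u + 1 \<le> of_int m" "of_int m < real N * u + 2" unfolding m_def by linarith+
  define b where "b = mv_join Free1 (clip (int N) (- m)) (clip (- int N) m)"
  have b: "b x \<noteq> 1 \<longleftrightarrow> real N * x - of_int m < 1 \<and> of_int m - real N * x < 1" if "x \<in> {0..1}" for x
  proof -
    have "b x = max (clip (int N) (- m) x) (clip (- int N) m x)"
      unfolding b_def mv_join_Free1[OF clip_mcnaughton clip_mcnaughton] restrict_apply'[OF that] ..
    moreover have "clip (int N) (- m) x \<le> 1" "clip (- int N) m x \<le> 1"
      using mcnaughtonD(1)[OF clip_mcnaughton that] by simp_all
    ultimately have "b x \<noteq> 1 \<longleftrightarrow> clip (int N) (- m) x \<noteq> 1 \<and> clip (- int N) m x \<noteq> 1"
      by (auto simp: max_def)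
    then show ?thesis unfolding clip_eq_1_iff[OF that] by auto
  qed
  have "x \<in> {u<..<v}" if "x \<in> {0..1}" "b x \<noteq> 1" for x
  proof -
    have "real N * u < real N * x" "real N * x < real N * v" using b[OF that(1)] that(2) m N by linarith+
    then show ?thesis using N0 by simp
  qed
  moreover have "of_int m / real N \<in> {0..1}"
  proof -
    have "0 \<le> real N * u" "real N * v \<le> real N" using uv N0 by auto
    then have "0 \<le> real_of_int m" "real_of_int m \<le> real N" using m N by linarith+
    then show ?thesis using N0 by simp
  qed
  moreover from this have "b (of_int m / real N) \<noteq> 1" using N0 by (simp add: b)
  moreover have "b \<in> mcnaughton" unfolding b_def by (intro mv_join_closed clip_mcnaughton)
  ultimately show ?thesis by blast
qed

lemma interval_below_one:
  assumes a: "a \<in> mcnaughton" and x: "x \<in> {0..1}" "a x \<noteq> 1"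
  shows "\<exists>u v. 0 \<le> u \<and> u < v \<and> v \<le> 1 \<and> (\<forall>y\<in>{u<..<v}. a y \<noteq> 1)"
proof -
  have ax: "a x < 1" using mcnaughtonD(1)[OF a x(1)] x(2) by simp
  have "\<forall>e>0. \<exists>d>0. \<forall>y\<in>{0..1}. dist y x < d \<longrightarrow> dist (a y) (a x) < e"
    using mcnaughtonD(2)[OF a] x(1) unfolding continuous_on_iff by blast
  then obtain d where d: "d > 0" "\<And>y. y \<in> {0..1} \<Longrightarrow> dist y x < d \<Longrightarrow> dist (a y) (a x) < 1 - a x"
    using ax by (metis diff_gt_0_iff_gt)
  have "a y \<noteq> 1" if "y \<in> {max 0 (x - d)<..<min 1 (x + d)}" for y
    using d(2)[of y] that by (auto simp: dist_real_def abs_less_iff)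
  then show ?thesis using x(1) d(1) by (intro exI[of _ "max 0 (x - d)"] exI[of _ "min 1 (x + d)"]) auto
qed

section \<open>Transfer between the spectrum and the unit interval\<close>

context
  fixes \<sigma> s assumes \<sigma>: "\<sigma> \<in> mv_hom Free1 Free1" and s: "\<sigma> x0 = s"
begin

lemma mv_dual_funpow_spec: "p \<in> mv_spec Free1 \<Longrightarrow> (mv_dual Free1 \<sigma> ^^ k) p \<in> mv_spec Free1"
  by (induction k) (auto intro: mv_dual_spec[OF \<sigma>])

lemma retr_mv_dual_funpow:
  "p \<in> mv_spec Free1 \<Longrightarrow> retr ((mv_dual Free1 \<sigma> ^^ k) p) = (s ^^ k) (retr p)"
  by (induction k) (simp_all add: retr_mv_dual[OF \<sigma> s mv_dual_funpow_spec])

lemma mv_dual_funpow_point: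
  assumes x: "x \<in> {0..1}"
  shows "(mv_dual Free1 \<sigma> ^^ k) (point_filter x) = point_filter ((s ^^ k) x)"
proof (induction k)
  case (Suc k)
  have "(s ^^ k) x \<in> {0..1}" using x s_unit[OF \<sigma> s] by (induction k) auto
  then show ?case using Suc mv_dual_point[OF \<sigma> s] by simp
qed simp

text \<open>\<open>p\<close> need not be a point filter, but every filter of its orbit is contained
  in the point filter of its retraction. A function below 1 at that point is therefore outside the
  filter.\<close>

lemma dense_orbit_imp_spec_dense:
  assumes p: "p \<in> mv_spec Free1" and dense: "dense_orbit s (retr p)"
  shows "mv_spec_top Free1 closure_of (range (\<lambda>k. (mv_dual Free1 \<sigma> ^^ k) p)) = mv_spec Free1"
proof
  show "mv_spec_top Free1 closure_of (range (\<lambda>k. (mv_dual Free1 \<sigma> ^^ k) p)) \<subseteq> mv_spec Free1"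
    using closure_of_subset_topspace[of "mv_spec_top Free1"] by simp
  show "mv_spec Free1 \<subseteq> mv_spec_top Free1 closure_of (range (\<lambda>k. (mv_dual Free1 \<sigma> ^^ k) p))"
  proof
    fix r assume r: "r \<in> mv_spec Free1"
    have "\<exists>y\<in>range (\<lambda>k. (mv_dual Free1 \<sigma> ^^ k) p). y \<in> U" if U: "r \<in> U" "openin (mv_spec_top Free1) U" for U
    proof -
      obtain a where a: "a \<in> mcnaughton" "a \<notin> r" "basic_open a \<subseteq> U"
        using openin_contains_basic[OF U(2,1)] by blast
      have "\<exists>x\<in>{0..1}. a x \<noteq> 1"
      proof (rule ccontr)
        assume "\<not> ?thesis"
        then have "a \<in> r"
          using mv_specD(5)[OF r mv_specD(2)[OF r] a(1)] by simp
        with a(2) show False by simp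
      qed
      then obtain u v where uv: "0 \<le> u" "u < v" "v \<le> 1" "\<forall>y\<in>{u<..<v}. a y \<noteq> 1"
        using interval_below_one[OF a(1)] by blast
      then obtain k where "(s ^^ k) (retr p) \<in> {u<..<v}" using dense unfolding dense_orbit_def by blast
      then have "a (retr ((mv_dual Free1 \<sigma> ^^ k) p)) \<noteq> 1" using uv(4) retr_mv_dual_funpow[OF p] by simp
      then have "a \<notin> (mv_dual Free1 \<sigma> ^^ k) p"
        using retr(2)[OF mv_dual_funpow_spec[OF p, of k]] by (auto simp: point_filter_def)
      then have "(mv_dual Free1 \<sigma> ^^ k) p \<in> U"
        using a(3) mv_dual_funpow_spec[OF p, of k] by (auto simp: basic_open_def)
      then show ?thesis by blast
    qed
    then show "r \<in> mv_spec_top Free1 closure_of (range (\<lambda>k. (mv_dual Free1 \<sigma> ^^ k) p))"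
      using r unfolding in_closure_of by simp
  qed
qed

lemma spec_dense_imp_dense_orbit:
  assumes x: "x \<in> {0..1}"
    and dense: "mv_spec_top Free1 closure_of (range (\<lambda>k. (mv_dual Free1 \<sigma> ^^ k) (point_filter x))) = mv_spec Free1"
  shows "dense_orbit s x"
  unfolding dense_orbit_def
proof (intro allI impI)
  fix u v :: real assume "0 \<le> u" "u < v" "v \<le> 1"
  from mcnaughton_hat[OF this] obtain b y where b: "b \<in> mcnaughton" "y \<in> {0..1}" "b y \<noteq> 1"
    "\<And>x. x \<in> {0..1} \<Longrightarrow> b x \<noteq> 1 \<Longrightarrow> x \<in> {u<..<v}" by blast
  have "point_filter y \<in> basic_open b"
    using point_filter_spec[OF b(2)] b(3) by (simp add: basic_open_def point_filter_def)
  moreover have "point_filter y \<in> mv_spec_top Free1 closure_of (range (\<lambda>k. (mv_dual Free1 \<sigma> ^^ k) (point_filter x)))"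
    unfolding dense by (rule point_filter_spec[OF b(2)])
  ultimately obtain k where "(mv_dual Free1 \<sigma> ^^ k) (point_filter x) \<in> basic_open b"
    using openin_basic[OF b(1)] unfolding in_closure_of by blast
  then have "b ((s ^^ k) x) \<noteq> 1"
    unfolding mv_dual_funpow_point[OF x] using b(1) by (simp add: basic_open_def point_filter_def)
  moreover have "(s ^^ k) x \<in> {0..1}" using x s_unit[OF \<sigma> s] by (induction k) auto
  ultimately show "\<exists>k. (s ^^ k) x \<in> {u<..<v}" using b(4) by blast
qed

lemma generic_subst_iff: "generic_subst \<sigma> \<longleftrightarrow> (AE x in leb01. dense_orbit s x)"
proof
  assume "generic_subst \<sigma>"
  then have "AE p in leb_spec. mv_spec_top Free1 closure_of (range (\<lambda>k. (mv_dual Free1 \<sigma> ^^ k) p)) = mv_spec Free1"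
    by (simp add: generic_subst_def alg_equiv_leb_iff)
  then have "AE x in leb01. mv_spec_top Free1 closure_of (range (\<lambda>k. (mv_dual Free1 \<sigma> ^^ k) (point_filter x))) = mv_spec Free1"
    unfolding leb_spec_def by (rule AE_distrD[OF measurable_point_filter])
  then show "AE x in leb01. dense_orbit s x"
    by (rule AE_mp) (intro AE_I2 impI spec_dense_imp_dense_orbit, simp_all)
next
  assume "AE x in leb01. dense_orbit s x"
  then have "AE x in distr leb_spec leb01 retr. dense_orbit s x" by (simp only: distr_leb_spec_retr)
  then have "AE p in leb_spec. dense_orbit s (retr p)"
    by (rule AE_distrD[rotated]) (simp add: measurable_retr cong: measurable_cong_sets)
  then have "AE p in leb_spec. mv_spec_top Free1 closure_of (range (\<lambda>k. (mv_dual Free1 \<sigma> ^^ k) p)) = mv_spec Free1"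
    by (rule AE_mp) (intro AE_I2 impI dense_orbit_imp_spec_dense, simp_all)
  then show "generic_subst \<sigma>" by (simp add: generic_subst_def alg_equiv_leb_iff)
qed

lemma s_measurable01: "s \<in> measurable leb01 leb01"
  using mcnaughtonD(2)[OF s_mcnaughton[OF \<sigma> s]] s_unit[OF \<sigma> s] by (intro measurable_leb01_continuous) auto

text \<open>\<open>retr\<close> carries \<open>leb_spec\<close> to \<open>leb01\<close>, so the
  image still dominates Lebesgue measure; the rest is \<open>factor_map\<close>.\<close>

lemma push_to_unit_interval:
  assumes inv: "invariant_dominating \<sigma> M"
  defines "N \<equiv> distr M leb01 retr"
  shows "dominating01 s N" "ergodic_map M (mv_dual Free1 \<sigma>) \<Longrightarrow> ergodic_map N s"
    "mixing_map M (mv_dual Free1 \<sigma>) \<Longrightarrow> mixing_map N s" "exact_map M (mv_dual Free1 \<sigma>) \<Longrightarrow> exact_map N s"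
proof -
  have sets: "sets M = sets borel_spec" and ac: "absolutely_continuous M leb_spec"
    using inv by (auto simp: invariant_dominating_def alg_equiv_leb_iff)
  have sp: "space M = mv_spec Free1" using sets_eq_imp_space_eq[OF sets] by simp
  have retr_M: "retr \<in> measurable M leb01" using measurable_retr sets by (simp cong: measurable_cong_sets)
  interpret factor_map M leb01 "mv_dual Free1 \<sigma>" s retr
  proof (rule factor_map.intro)
    show "prob_space M" "preserves_measure M (mv_dual Free1 \<sigma>)"
      using inv by (simp_all only: invariant_dominating_def)
    show "retr (mv_dual Free1 \<sigma> p) = s (retr p)" if "p \<in> space M" for p
      using retr_mv_dual[OF \<sigma> s] that by (simp only: sp)
  qed (rule s_measurable01 retr_M)+
  have "absolutely_continuous N leb01"
    unfolding absolutely_continuous_def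
  proof
    fix B assume "B \<in> null_sets N"
    then have B: "B \<in> sets leb01" "emeasure N B = 0" by (auto simp: N_def null_sets_def)
    then have "emeasure M (retr -` B \<inter> space M) = 0" using emeasure_distr[OF retr_M B(1)] by (simp add: N_def)
    then have "retr -` B \<inter> mv_spec Free1 \<in> null_sets M" using vimage_sets[OF B(1)] sp by (simp add: null_sets_def)
    then have "retr -` B \<inter> mv_spec Free1 \<in> null_sets leb_spec" using ac by (auto simp: absolutely_continuous_def)
    moreover have "retr \<in> measurable leb_spec leb01" using measurable_retr by (simp cong: measurable_cong_sets)
    ultimately have "emeasure (distr leb_spec leb01 retr) B = 0" using emeasure_distr[of retr leb_spec leb01 B] B(1)
      by (simp add: null_setsD1)
    then show "B \<in> null_sets leb01" using B(1) by (simp add: distr_leb_spec_retr null_sets_def)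
  qed
  then show "dominating01 s N"
    using img_prob img_preserves by (simp add: dominating01_def N_def)
  show "ergodic_map M (mv_dual Free1 \<sigma>) \<Longrightarrow> ergodic_map N s" unfolding N_def by (rule img_ergodic)
  show "mixing_map M (mv_dual Free1 \<sigma>) \<Longrightarrow> mixing_map N s" unfolding N_def by (rule img_mixing)
  show "exact_map M (mv_dual Free1 \<sigma>) \<Longrightarrow> exact_map N s" unfolding N_def by (rule img_exact)
qed

text \<open>\<open>leb_spec\<close> is by definition the image of \<open>leb01\<close> under
  \<open>point_filter\<close>, so a null set of the new measure has a Lebesgue null
  preimage.\<close>

lemma push_to_spec:
  assumes dom: "dominating01 s M"
  defines "N \<equiv> distr M borel_spec point_filter"
  shows "invariant_dominating \<sigma> N" "ergodic_map M s \<Longrightarrow> ergodic_map N (mv_dual Free1 \<sigma>)"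
    "mixing_map M s \<Longrightarrow> mixing_map N (mv_dual Free1 \<sigma>)" "exact_map M s \<Longrightarrow> exact_map N (mv_dual Free1 \<sigma>)"
proof -
  have sets: "sets M = sets leb01" and ac: "absolutely_continuous M leb01" using dom by (auto simp: dominating01_def)
  have sp: "space M = {0..1}" by (rule dominating01_space[OF dom])
  have pf_M: "point_filter \<in> measurable M borel_spec" using measurable_point_filter sets by (simp cong: measurable_cong_sets)
  interpret factor_map M borel_spec s "mv_dual Free1 \<sigma>" point_filter
  proof (rule factor_map.intro)
    show "prob_space M" "preserves_measure M s" using dom by (simp_all only: dominating01_def)
    show "point_filter (s x) = mv_dual Free1 \<sigma> (point_filter x)" if "x \<in> space M" for x
      using mv_dual_point[OF \<sigma> s, of x] that by (simp only: sp)
  qed (rule measurable_mv_dual[OF \<sigma> s] pf_M)+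
  have "absolutely_continuous N leb_spec"
    unfolding absolutely_continuous_def
  proof
    fix B assume "B \<in> null_sets N"
    then have B: "B \<in> sets borel_spec" "emeasure N B = 0" by (auto simp: N_def null_sets_def)
    then have "emeasure M (point_filter -` B \<inter> space M) = 0" using emeasure_distr[OF pf_M B(1)] by (simp add: N_def)
    then have "point_filter -` B \<inter> {0..1} \<in> null_sets M" using vimage_sets[OF B(1)] sp by (simp add: null_sets_def)
    then have "point_filter -` B \<inter> {0..1} \<in> null_sets leb01" using ac by (auto simp: absolutely_continuous_def)
    then have "emeasure leb_spec B = 0"
      unfolding leb_spec_def using emeasure_distr[OF measurable_point_filter B(1)] by (simp add: null_setsD1)
    then show "B \<in> null_sets leb_spec" using B(1) by (simp add: null_sets_def)
  qed
  then show "invariant_dominating \<sigma> N"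
    using img_prob img_preserves by (simp add: invariant_dominating_def alg_equiv_leb_iff N_def)
  show "ergodic_map M s \<Longrightarrow> ergodic_map N (mv_dual Free1 \<sigma>)" unfolding N_def by (rule img_ergodic)
  show "mixing_map M s \<Longrightarrow> mixing_map N (mv_dual Free1 \<sigma>)" unfolding N_def by (rule img_mixing)
  show "exact_map M s \<Longrightarrow> exact_map N (mv_dual Free1 \<sigma>)" unfolding N_def by (rule img_exact)
qed

lemma ergodic_subst_iff: "ergodic_subst \<sigma> \<longleftrightarrow> (\<exists>M. dominating01 s M \<and> ergodic_map M s)"
  unfolding ergodic_subst_def using push_to_unit_interval(1,2) push_to_spec(1,2) by metis

lemma mixing_subst_iff: "mixing_subst \<sigma> \<longleftrightarrow> (\<exists>M. dominating01 s M \<and> mixing_map M s)"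
  unfolding mixing_subst_def using push_to_unit_interval(1,3) push_to_spec(1,3) by metis

lemma exact_subst_iff: "exact_subst \<sigma> \<longleftrightarrow> (\<exists>M. dominating01 s M \<and> exact_map M s)"
  unfolding exact_subst_def using push_to_unit_interval(1,4) push_to_spec(1,4) by metis

end

theorem theorem3p3:
  fixes \<sigma> :: "(real \<Rightarrow> real) \<Rightarrow> (real \<Rightarrow> real)" and s :: "real \<Rightarrow> real"
  assumes "\<sigma> \<in> mv_hom Free1 Free1" and "\<sigma> x0 = s"
  defines "gen \<equiv> generic_subst \<sigma>"
    and "erg \<equiv> ergodic_subst \<sigma>"
    and "conn \<equiv> \<sigma> \<notin> mv_aut Free1 \<and> strongly_connected_graph (markov_vertices s) (markov_edges s)"
    and "mix \<equiv> mixing_subst \<sigma>"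
    and "exct \<equiv> exact_subst \<sigma>"
    and "prim \<equiv> \<sigma> \<notin> mv_aut Free1 \<and> primitive_graph (markov_vertices s) (markov_edges s)"
  shows "(gen \<longleftrightarrow> erg) \<and> (erg \<longleftrightarrow> conn) \<and>
    (mix \<longleftrightarrow> exct) \<and> (exct \<longleftrightarrow> prim) \<and>
    (gen \<or> erg \<or> conn \<or> mix \<or> exct \<or> prim \<longrightarrow>
      (\<exists>!\<mu>. ergodic_dominating01 s \<mu>) \<and>
      (\<forall>\<mu>. ergodic_dominating01 s \<mu> \<longrightarrow>
         absolutely_continuous leb01 \<mu> \<and>
         integrable leb01 (\<lambda>x. enn2real (RN_deriv leb01 \<mu> x)) \<and>
         (\<forall>i\<in>markov_vertices s. \<exists>c::rat.
            AE x in leb01. x \<in> markov_interval s i \<longrightarrow> RN_deriv leb01 \<mu> x = ennreal (of_rat c))))"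
proof -
  note hom = assms(1,2)
  note iffs = generic_subst_iff[OF hom] ergodic_subst_iff[OF hom] mixing_subst_iff[OF hom] exact_subst_iff[OF hom]
  obtain a where "markov_map s (markov_point s) (markov_size s) a"
    using mcnaughton_markov_map[OF s_mcnaughton[OF hom]] by blast
  then interpret markov_map s "markov_point s" "markov_size s" a .
  have V: "markov_vertices s = V" by (simp add: markov_vertices_def V_def)
  have I: "markov_interval s = I" by (rule ext) (simp add: markov_interval_def I_def)
  have E: "markov_edges s = E" by (simp add: markov_edges_def E_def V I)
  have expanding: "expanding_markov_map s (markov_point s) (markov_size s) a" if conn
    using that mv_aut_iff[OF hom] unfolding conn_def V E by unfold_locales blast+
  \<comment> \<open>Genericity, connectedness and ergodicity are linked in a cycle. Mixing and
    exactness each imply ergodicity, hence connectedness, and separately period 1.\<close>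
  have gen_conn: conn if gen
    using that dense_orbits_imp_connected dense_orbits_imp_not_isometry mv_aut_iff[OF hom]
    unfolding gen_def conn_def V E iffs by blast
  have conn_erg: erg if conn
  proof -
    interpret expanding_markov_map s "markov_point s" "markov_size s" a by (rule expanding[OF that])
    show ?thesis unfolding erg_def iffs using dominating_\<mu> \<mu>_ergodic by blast
  qed
  have erg_gen: gen if erg
    using that ergodic_imp_dense_orbits unfolding erg_def gen_def iffs by blast
  have mix_erg: erg if mix
    using that mixing_imp_ergodic unfolding erg_def mix_def iffs by blast
  have exct_erg: erg if exct
  proof -
    from that obtain M where M: "dominating01 s M" "exact_map M s" unfolding exct_def iffs by blast
    then have "s \<in> space M \<rightarrow> space M" by (auto simp: dominating01_def preserves_measure_def measurable_def)
    with M show ?thesis unfolding erg_def iffs using exact_imp_ergodic by blast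
  qed
  have prim_conn: conn if prim using that by (simp add: prim_def conn_def primitive_graph_def)
  have conn_prim: prim if conn "\<And>v. v \<in> V \<Longrightarrow> graph_period E v = 1"
    using that by (simp add: prim_def conn_def primitive_graph_def V E)
  have mix_prim: prim if m: mix
  proof -
    obtain M where M: "dominating01 s M" "mixing_map M s" using m unfolding mix_def iffs by blast
    show ?thesis using conn_prim gen_conn erg_gen mix_erg m mixing_imp_aperiodic[OF M] by blast
  qed
  have exct_prim: prim if exct
  proof -
    obtain M where M: "dominating01 s M" "exact_map M s" using \<open>exct\<close> unfolding exct_def iffs by blast
    have conn using gen_conn erg_gen exct_erg that by blast
    moreover from this have "(v, v) \<in> E\<^sup>+" if "v \<in> V" for v
      using that by (simp add: conn_def strongly_connected_graph_def V E)
    ultimately show ?thesis using conn_prim exact_imp_aperiodic[OF M] by blast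
  qed
  have prim_mix_exct: "mix \<and> exct" if prim
  proof -
    interpret expanding_markov_map s "markov_point s" "markov_size s" a by (rule expanding[OF prim_conn[OF that]])
    have "primitive_graph V E" using that by (simp add: prim_def V E)
    then show ?thesis unfolding mix_def exct_def iffs using dominating_\<mu> \<mu>_mixing \<mu>_exact by blast
  qed
  have density: "(\<exists>!\<mu>. ergodic_dominating01 s \<mu>) \<and>
      (\<forall>\<mu>. ergodic_dominating01 s \<mu> \<longrightarrow>
         absolutely_continuous leb01 \<mu> \<and>
         integrable leb01 (\<lambda>x. enn2real (RN_deriv leb01 \<mu> x)) \<and>
         (\<forall>i\<in>markov_vertices s. \<exists>c::rat.
            AE x in leb01. x \<in> markov_interval s i \<longrightarrow> RN_deriv leb01 \<mu> x = ennreal (of_rat c)))" if conn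
  proof -
    interpret expanding_markov_map s "markov_point s" "markov_size s" a by (rule expanding[OF that])
    show ?thesis
      unfolding V I
      using ergodic_dominating_\<mu> ergodic_dominating_unique \<mu>_ac_leb RN_deriv_\<mu>_integrable RN_deriv_\<mu>_on_I by blast
  qed
  show ?thesis
    using gen_conn conn_erg erg_gen mix_erg exct_erg prim_conn mix_prim exct_prim prim_mix_exct density by blast
qed

end
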